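(* Let $d\in\mathbb{N}$, $p,q\in[1,\infty]$ and $1/p<r<2$ (with $1/\infty:=0$). There exists a constant $C>0$ depending only on $p,q,r,d$ such that the following holds. Let $t\in\mathbb{N}_0$ and let $\mathcal{S}_d=(\boldsymbol{x}_n)_{n\ge 0}$ be an order-2 digital $(t,d)$-sequence over $\mathbb{F}_2$ with generating matrices $E_i=(e_{i,k,\ell})_{k,\ell\ge1}\in\mathbb{F}_2^{\mathbb{N}\times\mathbb{N}}$, $i\in\{1,\dots,d\}$, for which $e_{i,k,\ell}=0$ for all $k>2\ell$ and all $i\in\{1,\dots,d\}$. For $N\in\mathbb{N}$ let $\mathcal{S}_{d,N}$ denote the point set consisting of the $N$ initial terms $\boldsymbol{x}_0,\dots,\boldsymbol{x}_{N-1}$ of $\mathcal{S}_d$. Then for all $N\in\mathbb{N}\setminus\{1\}$, $$\mathrm{wce}(\mathcal{S}_{d,N},S^r_{p,q}B(\mathbb{T}^d))\le C\,2^{(r+1-1/p)t/2}\times\begin{cases}(\log N)^{(d-1)(1-1/q)}\,N^{-\min(r,1)} & \text{if } r\neq1,\\ (\log N)^{d(1-1/q)}\,N^{-1} & \text{if } r=1.\end{cases}$$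
   Context: **Digital sequences over $\mathbb{F}_2$.** $\mathbb{F}_2=\{0,1\}$ is the field with two elements. Let $C_1,\dots,C_d\in\mathbb{F}_2^{\mathbb{N}\times\mathbb{N}}$, $C_j=(c_{j,k,\ell})_{k,\ell\ge1}$ ($k$ = row index, $\ell$ = column index), be such that for each $\ell$ there is $K(\ell)$ with $c_{j,k,\ell}=0$ for all $k>K(\ell)$. For $k\in\mathbb{N}_0$ with binary expansion $k=k_0+k_12+\dots+k_{m-1}2^{m-1}$ put $\vec k=(k_0,\dots,k_{m-1},0,0,\dots)^\top\in\mathbb{F}_2^{\mathbb{N}}$, compute over $\mathbb{F}_2$ the vectors $C_j\vec k=(x_{j,k,1},x_{j,k,2},\dots)^\top$, and put $x_{j,k}=\sum_{i\ge1}x_{j,k,i}2^{-i}\in[0,1)$ and $\boldsymbol{x}_k=(x_{1,k},\dots,x_{d,k})\in[0,1)^d$. The sequence $(\boldsymbol{x}_k)_{k\ge0}$ is the digital sequence over $\mathbb{F}_2$ with generating matrices $C_1,\dots,C_d$. **Order-$\alpha$ digital nets.** Let $n,m,\alpha\in\mathbb{N}$ with $m\ge\alpha n$, and $t\in\mathbb{N}_0$ with $0\le t\le\alpha n$. Matrices $C_1,\dots,C_d\in\mathbb{F}_2^{m\times n}$, where $\vec c_{j,i}$ denotes the $i$-th row of $C_j$, generate an order-$\alpha$ digital $(t,n,d)$-net over $\mathbb{F}_2$ if for all integers $\nu_1,\dots,\nu_d\ge0$ and all integers $1\le i_{j,\nu_j}<\dots<i_{j,1}\le m$ ($j=1,\dots,d$;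 no indices for $j$ if $\nu_j=0$) with $\sum_{j=1}^d\sum_{l=1}^{\min(\nu_j,\alpha)}i_{j,l}\le\alpha n-t$, the vectors $\vec c_{1,i_{1,\nu_1}},\dots,\vec c_{1,i_{1,1}},\dots,\vec c_{d,i_{d,\nu_d}},\dots,\vec c_{d,i_{d,1}}$ are linearly independent over $\mathbb{F}_2$. **Order-$\alpha$ digital sequences.** The digital sequence with generating matrices $C_1,\dots,C_d\in\mathbb{F}_2^{\mathbb{N}\times\mathbb{N}}$ is an order-$\alpha$ digital $(t,d)$-sequence over $\mathbb{F}_2$ if for all $n>t/\alpha$ the left upper $\alpha n\times n$ submatrices of $C_1,\dots,C_d$ generate an order-$\alpha$ digital $(t,n,d)$-net over $\mathbb{F}_2$. Here $\alpha=2$. **Besov spaces.** $\mathbb{T}^d$ is the $d$-dimensional torus, identified with $[0,1)^d$; functions on it are 1-periodic in each variable. Fix $\varphi_0\in C_c^\infty(\mathbb{R})$ with $\varphi_0=1$ on $[-1,1]$ and $\operatorname{supp}\varphi_0\subseteq[-2,2]$, and set $\varphi_j(x)=\varphi_0(2^{-j}x)-\varphi_0(2^{-j+1}x)$ for $j\in\mathbb{N}$. For $f\in L_1(\mathbb{T}^d)$ with Fourier coefficients $\hat f(\boldsymbol{k})=\int_{\mathbb{T}^d}f(\boldsymbol{x})e^{-2\pi\mathrm{i}\boldsymbol{k}\cdot\boldsymbol{x}}\,\mathrm{d}\boldsymbol{x}$ and $\boldsymbol{j}\in\mathbb{N}_0^d$ put $\delta_{\boldsymbol{j}}[f](\boldsymbol{x})=\sum_{\boldsymbol{k}\in\mathbb{Z}^d}\varphi_{j_1}(k_1)\cdots\varphi_{j_d}(k_d)\hat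 f(\boldsymbol{k})e^{2\pi\mathrm{i}\boldsymbol{k}\cdot\boldsymbol{x}}$. The Besov space of dominating mixed smoothness $S^r_{p,q}B(\mathbb{T}^d)$ consists of all $f$ with finite norm $$\|f\|_{S^r_{p,q}B(\mathbb{T}^d)}=\Big(\sum_{\boldsymbol{j}\in\mathbb{N}_0^d}2^{r|\boldsymbol{j}|_1q}\|\delta_{\boldsymbol{j}}[f]\|_{L_p(\mathbb{T}^d)}^q\Big)^{1/q},\qquad |\boldsymbol{j}|_1=j_1+\dots+j_d,$$ with the usual modification (supremum) for $q=\infty$. Different choices of $\varphi_0$ give equivalent norms. For $r>1/p$ the space embeds continuously into $C(\mathbb{T}^d)$, and its elements are identified with their continuous representatives; only real-valued $f$ are considered. **Worst-case error.** For points $\boldsymbol{x}_0,\dots,\boldsymbol{x}_{N-1}\in[0,1)^d$ (counted with multiplicity) forming $\mathcal{P}_{d,N}$ and a normed space $F$ of functions $f:\mathbb{T}^d\to\mathbb{R}$, $$\mathrm{wce}(\mathcal{P}_{d,N},F)=\sup_{f\in F,\ \|f\|_F\le1}\Big|\int_{\mathbb{T}^d}f(\boldsymbol{x})\,\mathrm{d}\boldsymbol{x}-\frac1N\sum_{n=0}^{N-1}f(\boldsymbol{x}_n)\Big|.$$ *)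

theory Defs
  imports
    "HOL-Analysis.Analysis"
    "HOL-Probability.Essential_Supremum"
    "HOL-Library.Z2"
begin

section \<open>Digital sequences and digital nets\<close>

text \<open>
  The field with two elements is the type \<^typ>\<open>bit\<close>.  A family of matrices is a
  function \<open>C j k l\<close>, with \<open>j\<close> the coordinate, \<open>k\<close> the row and \<open>l\<close> the column.  Rows and columns
  are numbered from 1; entries with \<open>k = 0\<close> or \<open>l = 0\<close> are never read.
\<close>

definition finite_columns :: "('d \<Rightarrow> nat \<Rightarrow> nat \<Rightarrow> bit) \<Rightarrow> bool" where
  "finite_columns C \<longleftrightarrow> (\<forall>j. \<forall>l\<ge>1. \<exists>K. \<forall>k>K. C j k l = 0)"

definition binary_vec :: "nat \<Rightarrow> nat \<Rightarrow> bit" where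
  "binary_vec k l = of_bool (odd (k div 2 ^ (l - 1)))"

text \<open>
  Since \<open>k < 2 ^ k\<close>, the binary digits of \<open>k\<close> beyond the \<open>k\<close>-th one vanish, so that the sum
  below is the full matrix-vector product.
\<close>

definition digital_digit :: "(nat \<Rightarrow> nat \<Rightarrow> bit) \<Rightarrow> nat \<Rightarrow> nat \<Rightarrow> bit" where
  "digital_digit M k i = (\<Sum>l=1..k. M i l * binary_vec k l)"

definition digital_seq :: "('d::finite \<Rightarrow> nat \<Rightarrow> nat \<Rightarrow> bit) \<Rightarrow> nat \<Rightarrow> real ^ 'd" where
  "digital_seq C k = (\<chi> j. \<Sum>i. of_bit (digital_digit (C j) k (Suc i)) / 2 ^ Suc i)"

text \<open>Linear independence of the family \<open>(v a)\<close>, \<open>a \<in> A\<close>, of vectors of length \<open>n\<close>, with \<open>A\<close> finite.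
  Being a statement about families, it fails if a vector occurs twice.\<close>

definition lin_indep_family :: "nat \<Rightarrow> 'a set \<Rightarrow> ('a \<Rightarrow> nat \<Rightarrow> bit) \<Rightarrow> bool" where
  "lin_indep_family n A v \<longleftrightarrow>
     (\<forall>c. (\<forall>l\<in>{1..n}. (\<Sum>a\<in>A. c a * v a l) = 0) \<longrightarrow> (\<forall>a\<in>A. c a = 0))"

definition order_digital_net ::
    "nat \<Rightarrow> nat \<Rightarrow> nat \<Rightarrow> nat \<Rightarrow> ('d::finite \<Rightarrow> nat \<Rightarrow> nat \<Rightarrow> bit) \<Rightarrow> bool" where
  "order_digital_net \<alpha> t m n C \<longleftrightarrow>
     1 \<le> \<alpha> \<and> 1 \<le> n \<and> \<alpha> * n \<le> m \<and> t \<le> \<alpha> * n \<and>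
     (\<forall>(\<nu> :: 'd \<Rightarrow> nat) (i :: 'd \<Rightarrow> nat \<Rightarrow> nat).
        (\<forall>j. \<forall>l\<in>{1..\<nu> j}. 1 \<le> i j l \<and> i j l \<le> m) \<and>
        (\<forall>j. \<forall>l\<in>{1..\<nu> j}. \<forall>l'\<in>{1..\<nu> j}. l < l' \<longrightarrow> i j l' < i j l) \<and>
        (\<Sum>j\<in>UNIV. \<Sum>l=1..min (\<nu> j) \<alpha>. i j l) \<le> \<alpha> * n - t
        \<longrightarrow> lin_indep_family n (SIGMA j:UNIV. {1..\<nu> j}) (\<lambda>(j, l). C j (i j l)))"

text \<open>The net condition only reads the rows \<open>1..\<alpha> * n\<close> and columns \<open>1..n\<close> of \<open>C\<close>, that is, the
  left upper submatrices.\<close>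

definition order_digital_seq ::
    "nat \<Rightarrow> nat \<Rightarrow> ('d::finite \<Rightarrow> nat \<Rightarrow> nat \<Rightarrow> bit) \<Rightarrow> bool" where
  "order_digital_seq \<alpha> t C \<longleftrightarrow>
     finite_columns C \<and>
     (\<forall>n. real n > real t / real \<alpha> \<longrightarrow> order_digital_net \<alpha> t (\<alpha> * n) n C)"


section \<open>Besov spaces of dominating mixed smoothness\<close>

text \<open>The torus is \<open>[0,1)\<close> to the power \<open>d\<close> with Lebesgue measure; functions on it are periodic
  functions on the whole space.\<close>

definition torus :: "(real ^ 'd) measure" where
  "torus = restrict_space lborel {x. \<forall>i. 0 \<le> x $ i \<and> x $ i < 1}"

definition periodic :: "(real ^ 'd \<Rightarrow> 'b) \<Rightarrow> bool" where
  "periodic f \<longleftrightarrow> (\<forall>x i. f (x + axis i 1) = f x)"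

definition admissible_cutoff :: "(real \<Rightarrow> complex) \<Rightarrow> bool" where
  "admissible_cutoff \<phi> \<longleftrightarrow>
     (\<exists>D :: nat \<Rightarrow> real \<Rightarrow> complex.
        D 0 = \<phi> \<and> (\<forall>n x. (D n has_vector_derivative D (Suc n) x) (at x))) \<and>
     (\<forall>x\<in>{-1..1}. \<phi> x = 1) \<and>
     closure {x. \<phi> x \<noteq> 0} \<subseteq> {-2..2}"

definition dyadic_cutoff :: "(real \<Rightarrow> complex) \<Rightarrow> nat \<Rightarrow> real \<Rightarrow> complex" where
  "dyadic_cutoff \<phi> j x =
     (if j = 0 then \<phi> x else \<phi> (x / 2 ^ j) - \<phi> (x / 2 ^ (j - 1)))"

definition character :: "int ^ 'd \<Rightarrow> real ^ 'd::finite \<Rightarrow> complex" where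
  "character k x = exp (2 * of_real pi * \<i> * of_real (\<Sum>i\<in>UNIV. of_int (k $ i) * x $ i))"

definition fourier_coeff :: "(real ^ 'd::finite \<Rightarrow> real) \<Rightarrow> int ^ 'd \<Rightarrow> complex" where
  "fourier_coeff f k = (LINT x|torus. of_real (f x) * character (- k) x)"

text \<open>Only finitely many terms of the following sum are nonzero.\<close>

definition dyadic_block ::
    "(real \<Rightarrow> complex) \<Rightarrow> nat ^ 'd \<Rightarrow> (real ^ 'd::finite \<Rightarrow> real) \<Rightarrow> real ^ 'd \<Rightarrow> complex" where
  "dyadic_block \<phi> j f x =
     (\<Sum>\<^sub>\<infinity>k\<in>UNIV. (\<Prod>i\<in>UNIV. dyadic_cutoff \<phi> (j $ i) (of_int (k $ i)))
                 * fourier_coeff f k * character k x)"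

definition ennreal_powr :: "ennreal \<Rightarrow> real \<Rightarrow> ennreal" where
  "ennreal_powr x a = (if x = \<infinity> then \<infinity> else ennreal (enn2real x powr a))"

text \<open>The real number \<open>1 / p\<close> for \<open>p\<close> in \<open>[1,\<infinity>]\<close>, which is \<open>0\<close> for \<open>p = \<infinity>\<close>.\<close>

definition recip :: "ennreal \<Rightarrow> real" where
  "recip p = enn2real (1 / p)"

definition Lp_norm :: "ennreal \<Rightarrow> 'a measure \<Rightarrow> ('a \<Rightarrow> complex) \<Rightarrow> ennreal" where
  "Lp_norm p M g =
     (if p = \<infinity> then esssup M (\<lambda>x. ennreal (norm (g x)))
      else ennreal_powr (\<integral>\<^sup>+x. ennreal (norm (g x) powr enn2real p) \<partial>M) (recip p))"

definition besov_norm ::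
    "(real \<Rightarrow> complex) \<Rightarrow> real \<Rightarrow> ennreal \<Rightarrow> ennreal \<Rightarrow> (real ^ 'd::finite \<Rightarrow> real) \<Rightarrow> ennreal" where
  "besov_norm \<phi> r p q f =
     (if q = \<infinity>
      then (SUP j::nat^'d. ennreal (2 powr (r * real (\<Sum>i\<in>UNIV. j $ i)))
                           * Lp_norm p torus (dyadic_block \<phi> j f))
      else ennreal_powr
             (\<Sum>\<^sub>\<infinity>(j::nat^'d)\<in>UNIV.
                 ennreal (2 powr (r * real (\<Sum>i\<in>UNIV. j $ i) * enn2real q))
                 * ennreal_powr (Lp_norm p torus (dyadic_block \<phi> j f)) (enn2real q))
             (recip q))"

definition besov_space ::
    "(real \<Rightarrow> complex) \<Rightarrow> real \<Rightarrow> ennreal \<Rightarrow> ennreal \<Rightarrow> (real ^ 'd::finite \<Rightarrow> real) set" where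
  "besov_space \<phi> r p q =
     {f. periodic f \<and> integrable torus f \<and> besov_norm \<phi> r p q f < \<infinity>}"

text \<open>For \<open>r > 1 / p\<close> every class of functions in the Besov space has a unique continuous
  representative.  Point evaluations, hence the worst-case error, refer to this representative.\<close>

definition besov_space_cont ::
    "(real \<Rightarrow> complex) \<Rightarrow> real \<Rightarrow> ennreal \<Rightarrow> ennreal \<Rightarrow> (real ^ 'd::finite \<Rightarrow> real) set" where
  "besov_space_cont \<phi> r p q = {f \<in> besov_space \<phi> r p q. continuous_on UNIV f}"


section \<open>Worst-case error\<close>

text \<open>The worst-case error of the points \<open>x 0, \<dots>, x (N - 1)\<close> on a space of functions \<open>F\<close> with norm
  \<open>nrm\<close>.\<close>

definition wce ::
    "nat \<Rightarrow> (nat \<Rightarrow> real ^ 'd) \<Rightarrow> (real ^ 'd \<Rightarrow> real) set \<Rightarrow> ((real ^ 'd \<Rightarrow> real) \<Rightarrow> ennreal) \<Rightarrow> ennreal" where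
  "wce N x F nrm =
     (SUP f\<in>{f \<in> F. nrm f \<le> 1}. ennreal \<bar>(LINT y|torus. f y) - (1 / real N) * (\<Sum>n<N. f (x n))\<bar>)"

end

theory Submission
  imports Defs
begin

text \<open>
  Split \<open>f\<close> into its dyadic blocks \<open>g = \<delta>\<^sub>j f\<close>.  Each block is a trigonometric polynomial of degree
  about \<open>2\<^sup>j\<^sub>i\<close> in the \<open>i\<close>-th variable, hence reproduced from its values on a suitable grid by a tensor
  product of de la Vallee Poussin kernels, and its discrete \<open>p\<close>-th mean on a well chosen shift of
  the grid is at most its \<open>L\<^sub>p\<close> norm.  So only sums of the kernels over the points have to be estimated.

  The first \<open>N\<close> points are a union of blocks of \<open>2\<^sup>n\<close> points, each of which is a digitally shifted
  order-2 net.  The sum of a product function over such a block is the sum of its Walsh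
  coefficients over the dual net.  For a trigonometric polynomial of degree \<open>2\<^sup>m\<close>, every bit \<open>a > m\<close>
  of the Walsh index contributes a factor of order \<open>2\<^sup>m\<^sup>-\<^sup>a\<close>, while the order-2 net property
  forces the two leading bits of a nonzero dual index to be large and leaves at most one choice of
  the low bits once the high ones are fixed.  This gives a relative error
  \<open>2 powr (- 3/2 * (n - t/2 - \<bar>j\<bar>))\<close> for coarse blocks; any exponent larger than 1 (in
  absolute value) makes the sum over \<open>n\<close> converge to its first term.  Fine blocks are estimated
  without cancellation.  Summing over \<open>j\<close> with Hoelder's inequality gives the rate.
\<close>


section \<open>Trigonometric polynomials on grids\<close>

text \<open>The obstacle is that \<open>N\<close> is arbitrary: for a dyadic block of total degree
  exponent about \<open>lvl\<close>, the net property gives nothing below the scale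
  \<open>2 ^ (lvl + T)\<close>, with \<open>T\<close> half of \<open>t\<close> rounded up. The error
  should stay of that size however large \<open>N\<close> is. A net of \<open>2 ^ n\<close> points
  contributes \<open>2 ^ n\<close> times its relative error, so the relative error must decay faster
  than \<open>2 powr (- n)\<close>. This is what order 2 buys: the bits of a nonzero dual index
  exceed the degrees by more than \<open>2 * n - t - 2 * lvl\<close> in total, and its Walsh
  coefficient is, up to a constant per bit, 2 to minus that excess. Three quarters of the exponent
  are spent on decay, which makes 3/2; the last quarter keeps the sum over the free high bits
  convergent. Kernels have a discrete L1 norm bounded independently of the degree, so
  \<open>p\<close> enters only through the sampled values and one Hoelder step. Fejer means identify
  a continuous \<open>f\<close> with its dyadic series.\<close>

definition ex :: "real \<Rightarrow> complex" where
  "ex x = cis (2 * pi * x)"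

lemma ex_0 [simp]: "ex 0 = 1"
  by (simp add: ex_def)

lemma norm_ex [simp]: "norm (ex x) = 1"
  by (simp add: ex_def)

lemma ex_add: "ex (x + y) = ex x * ex y"
  by (simp add: ex_def cis_mult ring_distribs)

lemma ex_of_int [simp]: "ex (of_int k) = 1"
  by (simp add: ex_def cis_multiple_2pi)

lemma cnj_ex: "cnj (ex x) = ex (- x)"
  by (simp add: ex_def cis_cnj)

lemma ex_sum: "finite I \<Longrightarrow> ex (\<Sum>i\<in>I. f i) = (\<Prod>i\<in>I. ex (f i))"
  by (induction I rule: finite_induct) (auto simp: ex_add)

lemma ex_power: "ex x ^ k = ex (real k * x)"
  unfolding ex_def Complex.DeMoivre by (simp add: mult_ac)

lemma norm_ex_diff: "norm (ex x - 1) = 2 * \<bar>sin (pi * x)\<bar>"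
  using dist_exp_i_1[of "2 * pi * x"] by (simp add: ex_def cis_conv_exp)

lemma norm_ex_diff_le: "norm (ex x - 1) \<le> 2 * pi * \<bar>x\<bar>"
  using abs_sin_x_le_abs_x[of "pi * x"] by (simp add: norm_ex_diff abs_mult)

lemma ex_eq_1_iff: "ex x = 1 \<longleftrightarrow> x \<in> \<int>"
proof
  assume "ex x = 1"
  then have "sin (pi * x) = 0"
    using norm_ex_diff[of x] by simp
  then obtain i :: int where "pi * x = of_int i * pi"
    using sin_zero_iff_int2 by blast
  then have "x = of_int i" by simp
  then show "x \<in> \<int>" by simp
next
  assume "x \<in> \<int>"
  then show "ex x = 1" by (auto elim!: Ints_cases)
qed

text \<open>A geometric sum in \<open>ex (k / n)\<close>, an \<open>n\<close>-th root of unity that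
  equals 1 exactly when \<open>n\<close> divides \<open>k\<close>.\<close>

lemma sum_ex_grid:
  assumes "n > 0"
  shows "(\<Sum>z<n. ex (of_int k * (real z / real n))) = (if int n dvd k then of_nat n else 0)"
proof -
  let ?w = "ex (of_int k / real n)"
  have pw: "ex (of_int k * (real z / real n)) = ?w ^ z" for z
    by (simp add: ex_power algebra_simps)
  have "?w ^ n = 1"
    using assms by (simp add: ex_power)
  moreover have "?w = 1 \<longleftrightarrow> int n dvd k"
  proof -
    have "(of_int k / real n \<in> \<int>) \<longleftrightarrow> int n dvd k"
      using of_int_div_of_int_in_Ints_iff[of k "int n", where ?'a = real] assms by simp
    then show ?thesis by (simp add: ex_eq_1_iff)
  qed
  ultimately show ?thesis
    using assms unfolding pw by (simp add: sum_gp_strict)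
qed

lemma sum_ex_grid_shift:
  assumes "n > 0"
  shows "(\<Sum>z<n. ex (of_int k * (y + real z / real n))) =
    (if int n dvd k then of_nat n * ex (of_int k * y) else 0)"
proof -
  have "(\<Sum>z<n. ex (of_int k * (y + real z / real n))) =
      ex (of_int k * y) * (\<Sum>z<n. ex (of_int k * (real z / real n)))"
    by (simp add: sum_distrib_left ring_distribs ex_add)
  then show ?thesis
    using sum_ex_grid[OF assms, of k] by simp
qed

definition tpoly :: "int set \<Rightarrow> (int \<Rightarrow> complex) \<Rightarrow> real \<Rightarrow> complex" where
  "tpoly I a x = (\<Sum>l\<in>I. a l * ex (of_int l * x))"

text \<open>No aliasing: two frequencies from a window of \<open>n\<close> consecutive integers are
  congruent modulo \<open>n\<close> only if they are equal, so the cross terms vanish on every shift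
  of the grid.\<close>

lemma parseval_grid:
  assumes n: "n > 0" and I: "I \<subseteq> {l0..<l0 + int n}"
  shows "(\<Sum>z<n. (norm (tpoly I a (y + real z / real n)))\<^sup>2) = real n * (\<Sum>l\<in>I. (norm (a l))\<^sup>2)"
proof -
  have fI: "finite I" using I finite_subset by blast
  have dv: "int n dvd (l - l') \<longleftrightarrow> l = l'" if "l \<in> I" "l' \<in> I" for l l'
  proof
    assume "int n dvd (l - l')"
    moreover have "\<bar>l - l'\<bar> < int n" using subsetD[OF I that(1)] subsetD[OF I that(2)] by auto
    ultimately show "l = l'" using zdvd_imp_le[of "int n" "\<bar>l - l'\<bar>"] by (cases "l = l'") auto
  qed auto
  have nsq: "complex_of_real ((norm (tpoly I a x))\<^sup>2) =
      (\<Sum>l\<in>I. \<Sum>l'\<in>I. a l * cnj (a l') * ex (of_int (l - l') * x))" for x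
  proof -
    have "complex_of_real ((norm (tpoly I a x))\<^sup>2) = tpoly I a x * cnj (tpoly I a x)"
      by (rule complex_norm_square)
    also have "\<dots> = (\<Sum>l\<in>I. \<Sum>l'\<in>I. (a l * ex (of_int l * x)) * cnj (a l' * ex (of_int l' * x)))"
      by (simp add: tpoly_def sum_product cnj_sum)
    also have "\<dots> = (\<Sum>l\<in>I. \<Sum>l'\<in>I. a l * cnj (a l') * ex (of_int (l - l') * x))"
    proof (intro sum.cong refl)
      fix l l'
      have "ex (of_int (l - l') * x) = ex (of_int l * x) * ex (- (of_int l' * x))"
        by (simp add: ex_add[symmetric] algebra_simps)
      then show "(a l * ex (of_int l * x)) * cnj (a l' * ex (of_int l' * x)) =
          a l * cnj (a l') * ex (of_int (l - l') * x)"
        by (simp add: cnj_ex)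
    qed
    finally show ?thesis .
  qed
  have "complex_of_real (\<Sum>z<n. (norm (tpoly I a (y + real z / real n)))\<^sup>2) =
      (\<Sum>z<n. \<Sum>l\<in>I. \<Sum>l'\<in>I. a l * cnj (a l') * ex (of_int (l - l') * (y + real z / real n)))"
    by (simp only: of_real_sum nsq)
  also have "\<dots> = (\<Sum>l\<in>I. \<Sum>l'\<in>I. a l * cnj (a l') * (\<Sum>z<n. ex (of_int (l - l') * (y + real z / real n))))"
    by (subst sum.swap, rule sum.cong, simp, subst sum.swap, simp add: sum_distrib_left)
  also have "\<dots> = (\<Sum>l\<in>I. \<Sum>l'\<in>I. if l = l' then of_nat n * (a l * cnj (a l)) else 0)"
    by (intro sum.cong refl, simp only: sum_ex_grid_shift[OF n], auto simp: dv)
  also have "\<dots> = (\<Sum>l\<in>I. of_nat n * (a l * cnj (a l)))"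
    using fI by simp
  also have "\<dots> = complex_of_real (real n * (\<Sum>l\<in>I. (norm (a l))\<^sup>2))"
    by (simp only: complex_norm_square of_real_mult of_real_sum sum_distrib_left of_real_of_nat_eq)
  finally show ?thesis by (simp only: of_real_eq_iff)
qed

text \<open>Cauchy-Schwarz followed by \<open>parseval_grid\<close>. As the latter is blind to the
  shift, the two factors may be sampled on differently shifted grids, which the product rule for
  differences requires.\<close>

lemma grid_mean_product_le:
  assumes n: "n > 0" and I: "I \<subseteq> {l0..<l0 + int n}" and J: "J \<subseteq> {l1..<l1 + int n}"
    and A: "(\<Sum>l\<in>I. (norm (a l))\<^sup>2) \<le> A\<^sup>2" and B: "(\<Sum>l\<in>J. (norm (b l))\<^sup>2) \<le> B\<^sup>2"
    and pos: "0 \<le> A" "0 \<le> B"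
  shows "(\<Sum>z<n. norm (tpoly I a (y + real z / real n)) * norm (tpoly J b (y' + real z / real n)))
    \<le> real n * (A * B)"
proof -
  let ?S = "\<Sum>z<n. norm (tpoly I a (y + real z / real n)) * norm (tpoly J b (y' + real z / real n))"
  have "?S\<^sup>2 \<le> (\<Sum>z<n. (norm (tpoly I a (y + real z / real n)))\<^sup>2) *
      (\<Sum>z<n. (norm (tpoly J b (y' + real z / real n)))\<^sup>2)"
    by (rule Cauchy_Schwarz_ineq_sum)
  also have "\<dots> = (real n * (\<Sum>l\<in>I. (norm (a l))\<^sup>2)) * (real n * (\<Sum>l\<in>J. (norm (b l))\<^sup>2))"
    using parseval_grid[OF n I] parseval_grid[OF n J] by simp
  also have "\<dots> \<le> (real n * A\<^sup>2) * (real n * B\<^sup>2)"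
    using A B by (intro mult_mono) (auto intro!: mult_nonneg_nonneg sum_nonneg)
  also have "\<dots> = (real n * (A * B))\<^sup>2"
    by (simp add: power2_eq_square)
  finally show ?thesis
    using pos by (intro power2_le_imp_le[of ?S]) auto
qed

section \<open>Dirichlet and de la Vallee Poussin kernels\<close>

definition dirichlet :: "int set \<Rightarrow> real \<Rightarrow> complex" where
  "dirichlet I = tpoly I (\<lambda>_. 1)"

lemma norm_dirichlet_minus: "norm (dirichlet I (- x)) = norm (dirichlet I x)"
proof -
  have "dirichlet I (- x) = cnj (dirichlet I x)"
    by (simp add: dirichlet_def tpoly_def cnj_sum cnj_ex)
  then show ?thesis by simp
qed

text \<open>Asymmetric because it consists of the differences \<open>k - l\<close> with
  \<open>\<bar>k\<bar> \<le> b\<close> and \<open>l\<close> in \<open>right_freqs b\<close>.\<close>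

definition left_freqs :: "nat \<Rightarrow> int set" where
  "left_freqs b = {- int b..<2 * int b}"

definition right_freqs :: "nat \<Rightarrow> int set" where
  "right_freqs b = {- int b<..0}"

text \<open>A de la Vallee Poussin kernel: every frequency \<open>k\<close> with \<open>\<bar>k\<bar> \<le> b\<close> is a sum of elements of
  \<^term>\<open>left_freqs b\<close> and \<^term>\<open>right_freqs b\<close> in exactly \<open>b\<close> ways.\<close>

definition vp_kernel :: "nat \<Rightarrow> real \<Rightarrow> complex" where
  "vp_kernel b x = dirichlet (left_freqs b) x * dirichlet (right_freqs b) x / of_nat b"

text \<open>The kernel is a product, so half the sum of the squares dominates it. Unlike the modulus
  of the kernel, this is again a trigonometric polynomial, and the Walsh estimates apply to it
  directly.\<close>

definition vp_majorant :: "nat \<Rightarrow> real \<Rightarrow> real" where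
  "vp_majorant b x = ((norm (dirichlet (left_freqs b) x))\<^sup>2 + (norm (dirichlet (right_freqs b) x))\<^sup>2)
     / (2 * real b)"

lemma vp_majorant_nonneg: "0 \<le> vp_majorant b x"
  by (simp add: vp_majorant_def)

lemma vp_majorant_minus: "vp_majorant b (- x) = vp_majorant b x"
  by (simp add: vp_majorant_def norm_dirichlet_minus)

lemma norm_vp_kernel_le: "norm (vp_kernel b x) \<le> vp_majorant b x"
proof (cases "b = 0")
  case False
  let ?p = "norm (dirichlet (left_freqs b) x)" and ?q = "norm (dirichlet (right_freqs b) x)"
  have "2 * (?p * ?q) \<le> ?p\<^sup>2 + ?q\<^sup>2"
    using sum_squares_bound[of ?p ?q] by simp
  then show ?thesis
    using False by (simp add: vp_kernel_def vp_majorant_def norm_mult norm_divide divide_simps)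
qed (simp add: vp_kernel_def vp_majorant_def)

lemma norm_dirichlet_le: "norm (dirichlet I x) \<le> real (card I)"
  unfolding dirichlet_def tpoly_def
  by (rule order_trans[OF norm_sum]) (simp add: norm_mult)

text \<open>Counting frequencies: \<open>((3 * b)^2 + b^2) / (2 * b)\<close> is
  \<open>5 * b\<close>.\<close>

lemma vp_majorant_le: 
  assumes "b > 0" shows "vp_majorant b x \<le> 5 * real b"
proof -
  have "(norm (dirichlet (left_freqs b) x))\<^sup>2 \<le> (3 * real b)\<^sup>2"
    using norm_dirichlet_le[of "left_freqs b" x] by (intro power_mono) (auto simp: left_freqs_def)
  moreover have "(norm (dirichlet (right_freqs b) x))\<^sup>2 \<le> (real b)\<^sup>2"
    using norm_dirichlet_le[of "right_freqs b" x] by (intro power_mono) (auto simp: right_freqs_def)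
  ultimately show ?thesis
    using assms by (simp add: vp_majorant_def power2_eq_square divide_simps)
qed

lemma card_left_freqs [simp]: "card (left_freqs b) = 3 * b"
  by (simp add: left_freqs_def)
lemma card_right_freqs [simp]: "card (right_freqs b) = b"
  by (simp add: right_freqs_def)
lemma finite_left_freqs [simp]: "finite (left_freqs b)"
  by (simp add: left_freqs_def)
lemma finite_right_freqs [simp]: "finite (right_freqs b)"
  by (simp add: right_freqs_def)

text \<open>Parseval on both windows: \<open>(3 * b + b) / (2 * b)\<close> is 2. This 2 is the
  discrete L1 bound of the kernels in all later estimates.\<close>

lemma vp_majorant_mean:
  assumes "b > 0" "3 * b \<le> n"
  shows "(\<Sum>z<n. vp_majorant b (y + real z / real n)) = 2 * real n"
proof -
  have n: "n > 0" using assms by simp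
  have 1: "(\<Sum>z<n. (norm (dirichlet (left_freqs b) (y + real z / real n)))\<^sup>2) = real n * (3 * real b)"
    unfolding dirichlet_def
    by (subst parseval_grid[OF n, of _ "- int b"]) (use assms in \<open>auto simp: left_freqs_def\<close>)
  have 2: "(\<Sum>z<n. (norm (dirichlet (right_freqs b) (y + real z / real n)))\<^sup>2) = real n * real b"
    unfolding dirichlet_def
    by (subst parseval_grid[OF n, of _ "- int b"]) (use assms in \<open>auto simp: right_freqs_def\<close>)
  have "(\<Sum>z<n. vp_majorant b (y + real z / real n)) =
      (real n * (3 * real b) + real n * real b) / (2 * real b)"
    unfolding vp_majorant_def sum_divide_distrib[symmetric] sum.distrib 1 2 by simp
  also have "\<dots> = 2 * real n" using assms by simp
  finally show ?thesis .
qed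

text \<open>Summation over the grid leaves only the pairs with \<open>l + l' = k\<close>, since
  \<open>k - l - l'\<close> is too small to be another multiple of \<open>4 * b\<close>. There are
  \<open>b\<close> such pairs, and the normalisation of the kernel divides this number out.\<close>

lemma vp_reproduces_ex:
  assumes b: "b > 0" and k: "\<bar>k\<bar> \<le> int b"
  shows "(\<Sum>z<4*b. ex (of_int k * (y + real z / real (4*b))) * vp_kernel b (x - (y + real z / real (4*b))))
    = of_nat (4*b) * ex (of_int k * x)"
proof -
  let ?n = "4 * b"
  let ?w = "\<lambda>z. y + real z / real ?n"
  have n: "?n > 0" using b by simp
  have 1: "ex (of_int k * w) * vp_kernel b (x - w) =
     (\<Sum>l'\<in>right_freqs b. \<Sum>l\<in>left_freqs b. ex (of_int (l + l') * x) * ex (of_int (k - l - l') * w)) / of_nat b"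
    for w
  proof -
    have "ex (of_int k * w) * vp_kernel b (x - w) =
      (\<Sum>l\<in>left_freqs b. \<Sum>l'\<in>right_freqs b.
         ex (of_int k * w) * (ex (of_int l * (x - w)) * ex (of_int l' * (x - w)))) / of_nat b"
      by (simp add: vp_kernel_def dirichlet_def tpoly_def sum_product) (simp add: sum_distrib_left)
    also have "\<dots> = (\<Sum>l\<in>left_freqs b. \<Sum>l'\<in>right_freqs b.
         ex (of_int (l + l') * x) * ex (of_int (k - l - l') * w)) / of_nat b"
      by (simp add: ex_add[symmetric] algebra_simps)
    finally show ?thesis by (subst sum.swap)
  qed
  have key: "(\<Sum>l\<in>left_freqs b. ex (of_int (l + l') * x) * (\<Sum>z<?n. ex (of_int (k - l - l') * ?w z)))
      = of_nat ?n * ex (of_int k * x)" if l': "l' \<in> right_freqs b" for l'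
  proof -
    have dv: "int ?n dvd (k - l - l') \<longleftrightarrow> l = k - l'" if "l \<in> left_freqs b" for l
    proof
      assume d: "int ?n dvd (k - l - l')"
      have "\<bar>k - l - l'\<bar> < int ?n" using that l' k b
        unfolding left_freqs_def right_freqs_def by (auto simp: abs_if split: if_splits)
      with d have "k - l - l' = 0"
        using zdvd_imp_le[of "int ?n" "\<bar>k - l - l'\<bar>"] by (cases "k - l - l' = 0") auto
      then show "l = k - l'" by simp
    qed auto
    have "(\<Sum>l\<in>left_freqs b. ex (of_int (l + l') * x) * (\<Sum>z<?n. ex (of_int (k - l - l') * ?w z)))
       = (\<Sum>l\<in>left_freqs b. if l = k - l' then of_nat ?n * ex (of_int k * x) else 0)"
    proof (intro sum.cong refl)
      fix l assume l: "l \<in> left_freqs b"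
      show "ex (of_int (l + l') * x) * (\<Sum>z<?n. ex (of_int (k - l - l') * ?w z)) =
          (if l = k - l' then of_nat ?n * ex (of_int k * x) else 0)"
        unfolding sum_ex_grid_shift[OF n] dv[OF l] by auto
    qed
    also have "k - l' \<in> left_freqs b"
      using l' k by (auto simp: left_freqs_def right_freqs_def)
    then have "(\<Sum>l\<in>left_freqs b. if l = k - l' then of_nat ?n * ex (of_int k * x) else 0) =
        of_nat ?n * ex (of_int k * x)"
      by (subst sum.delta) auto
    finally show ?thesis .
  qed
  have "(\<Sum>z<?n. ex (of_int k * ?w z) * vp_kernel b (x - ?w z)) =
    (\<Sum>z<?n. \<Sum>l'\<in>right_freqs b. \<Sum>l\<in>left_freqs b. ex (of_int (l + l') * x) * ex (of_int (k - l - l') * ?w z)) / of_nat b"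
    by (simp only: 1 sum_divide_distrib)
  also have "\<dots> = (\<Sum>l'\<in>right_freqs b. \<Sum>l\<in>left_freqs b. ex (of_int (l + l') * x) * (\<Sum>z<?n. ex (of_int (k - l - l') * ?w z))) / of_nat b"
    by (subst sum.swap, rule arg_cong2[where f = "(/)"], rule sum.cong, simp, subst sum.swap,
        simp_all add: sum_distrib_left)
  also have "\<dots> = of_nat ?n * ex (of_int k * x)"
    using b by (subst sum.cong[OF refl key]) auto
  finally show ?thesis .
qed

section \<open>Trigonometric polynomials of bounded degree\<close>

definition band :: "nat \<Rightarrow> (real \<Rightarrow> complex) \<Rightarrow> bool" where
  "band b u \<longleftrightarrow> (\<exists>a. u = tpoly {- int b..int b} a)"

lemma band_ex:
  assumes "\<bar>k\<bar> \<le> int b" shows "band b (\<lambda>x. c * ex (of_int k * x))"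
  unfolding band_def
proof (intro exI ext)
  fix x
  have "tpoly {- int b..int b} (\<lambda>l. if l = k then c else 0) x =
     (\<Sum>l\<in>{- int b..int b}. if l = k then c * ex (of_int k * x) else 0)"
    unfolding tpoly_def by (intro sum.cong) auto
  also have "\<dots> = c * ex (of_int k * x)"
    using assms by (subst sum.delta) auto
  finally show "c * ex (of_int k * x) = tpoly {- int b..int b} (\<lambda>l. if l = k then c else 0) x" by simp
qed

lemma band_add:
  assumes "band b u" "band b v" shows "band b (\<lambda>x. u x + v x)"
proof -
  obtain a a' where "u = tpoly {- int b..int b} a" "v = tpoly {- int b..int b} a'"
    using assms by (auto simp: band_def)
  then have "(\<lambda>x. u x + v x) = tpoly {- int b..int b} (\<lambda>l. a l + a' l)"
    by (auto simp: tpoly_def sum.distrib ring_distribs)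
  then show ?thesis unfolding band_def by blast
qed

lemma band_cmult:
  assumes "band b u" shows "band b (\<lambda>x. c * u x)"
proof -
  obtain a where "u = tpoly {- int b..int b} a"
    using assms by (auto simp: band_def)
  then have "(\<lambda>x. c * u x) = tpoly {- int b..int b} (\<lambda>l. c * a l)"
    by (auto simp: tpoly_def sum_distrib_left mult_ac)
  then show ?thesis unfolding band_def by blast
qed

lemma band_shift:
  assumes "band b u" shows "band b (\<lambda>x. u (x + h))"
proof -
  obtain a where "u = tpoly {- int b..int b} a"
    using assms by (auto simp: band_def)
  then have "(\<lambda>x. u (x + h)) = tpoly {- int b..int b} (\<lambda>l. a l * ex (of_int l * h))"
    by (auto simp: tpoly_def ring_distribs ex_add mult_ac)
  then show ?thesis unfolding band_def by blast
qed

lemma band_diff: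
  assumes "band b u" "band b v" shows "band b (\<lambda>x. u x - v x)"
  using band_add[OF assms(1) band_cmult[OF assms(2), of "-1"]] by simp

lemma band_sum:
  assumes "\<And>i. i \<in> I \<Longrightarrow> band b (u i)" shows "band b (\<lambda>x. \<Sum>i\<in>I. u i x)"
proof (cases "finite I")
  case True
  then show ?thesis using assms
  proof (induction I rule: finite_induct)
    case empty
    show ?case using band_ex[of 0 b 0] by simp
  next
    case (insert i I)
    then show ?case using band_add[of b "u i" "\<lambda>x. \<Sum>i\<in>I. u i x"] by simp
  qed
next
  case False
  then show ?thesis using band_ex[of 0 b 0] by simp
qed

lemma band_double_sum:
  assumes "\<And>l l'. l \<in> I \<Longrightarrow> l' \<in> J \<Longrightarrow> \<bar>k l l'\<bar> \<le> int b"
  shows "band b (\<lambda>x. \<Sum>l\<in>I. \<Sum>l'\<in>J. c l l' * ex (of_int (k l l') * x))"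
  by (intro band_sum band_ex) (use assms in auto)

lemma norm_dirichlet_sq:
  "complex_of_real ((norm (dirichlet I x))\<^sup>2) = (\<Sum>l\<in>I. \<Sum>l'\<in>I. ex (of_int (l - l') * x))"
proof -
  have "complex_of_real ((norm (dirichlet I x))\<^sup>2) = dirichlet I x * cnj (dirichlet I x)"
    by (rule complex_norm_square)
  also have "\<dots> = (\<Sum>l\<in>I. \<Sum>l'\<in>I. ex (of_int (l - l') * x))"
    by (simp add: dirichlet_def tpoly_def sum_product cnj_sum cnj_ex ex_add[symmetric] algebra_simps)
  finally show ?thesis .
qed

lemma band_vp_kernel:
  assumes "b' \<ge> 4 * b"
  shows "band b' (vp_kernel b)"
proof -
  have "vp_kernel b = (\<lambda>x. (1 / of_nat b) *
      (\<Sum>l\<in>left_freqs b. \<Sum>l'\<in>right_freqs b. 1 * ex (of_int (l + l') * x)))"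
    by (auto simp: vp_kernel_def dirichlet_def tpoly_def sum_product ex_add[symmetric] algebra_simps)
  moreover have "band b' (\<lambda>x. (1 / of_nat b) *
      (\<Sum>l\<in>left_freqs b. \<Sum>l'\<in>right_freqs b. 1 * ex (of_int (l + l') * x)))"
    by (intro band_cmult band_double_sum) (use assms in \<open>auto simp: left_freqs_def right_freqs_def\<close>)
  ultimately show ?thesis by simp
qed

lemma band_vp_majorant:
  assumes "b' \<ge> 4 * b"
  shows "band b' (\<lambda>x. complex_of_real (vp_majorant b x))"
proof -
  have "(\<lambda>x. complex_of_real (vp_majorant b x)) = (\<lambda>x. (1 / (2 * of_nat b)) *
      ((\<Sum>l\<in>left_freqs b. \<Sum>l'\<in>left_freqs b. 1 * ex (of_int (l - l') * x))
      + (\<Sum>l\<in>right_freqs b. \<Sum>l'\<in>right_freqs b. 1 * ex (of_int (l - l') * x))))"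
    by (intro ext) (simp only: vp_majorant_def of_real_divide of_real_add norm_dirichlet_sq, simp)
  moreover have "band b' \<dots>"
    by (intro band_cmult band_add band_double_sum)
      (use assms in \<open>auto simp: left_freqs_def right_freqs_def\<close>)
  ultimately show ?thesis by simp
qed

lemma band_reproduce:
  assumes b: "b > 0" and u: "band b u"
  shows "of_nat (4*b) * u x =
    (\<Sum>z<4*b. u (y + real z / real (4*b)) * vp_kernel b (x - (y + real z / real (4*b))))"
proof -
  obtain a where a: "u = tpoly {- int b..int b} a"
    using u by (auto simp: band_def)
  have "(\<Sum>z<4*b. u (y + real z / real (4*b)) * vp_kernel b (x - (y + real z / real (4*b)))) =
     (\<Sum>l\<in>{- int b..int b}. a l * (\<Sum>z<4*b. ex (of_int l * (y + real z / real (4*b))) * vp_kernel b (x - (y + real z / real (4*b)))))"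
    unfolding a tpoly_def sum_distrib_right sum_distrib_left by (subst sum.swap) (simp add: mult_ac)
  also have "\<dots> = (\<Sum>l\<in>{- int b..int b}. a l * (of_nat (4*b) * ex (of_int l * x)))"
    by (intro sum.cong refl) (subst vp_reproduces_ex[OF b], auto)
  also have "\<dots> = of_nat (4*b) * u x"
    by (simp add: a tpoly_def sum_distrib_left mult_ac)
  finally show ?thesis by simp
qed

text \<open>Product rule for differences: in each of two products one Dirichlet kernel is replaced
  by its difference, whose coefficients are at most \<open>4 * pi * b * h\<close>, and
  \<open>grid_mean_product_le\<close> applies.\<close>

lemma vp_kernel_diff_mean:
  assumes b: "b > 0" and h: "h \<ge> 0"
  shows "(\<Sum>z<4*b. norm (vp_kernel b (y + h + real z / real (4*b)) - vp_kernel b (y + real z / real (4*b))))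
    \<le> real (4*b) * (64 * real b * h)"
proof -
  let ?n = "4 * b"
  let ?L = "left_freqs b" and ?R = "right_freqs b"
  let ?w = "\<lambda>z. y + real z / real ?n" and ?w' = "\<lambda>z. y + h + real z / real ?n"
  let ?d = "\<lambda>l. ex (of_int l * h) - 1"
  have n: "?n > 0" using b by simp
  have sh: "dirichlet I (w + h) - dirichlet I w = tpoly I ?d w" for I w
    by (simp add: dirichlet_def tpoly_def sum_subtractf[symmetric] ring_distribs ex_add algebra_simps)
  have d: "norm (?d l) \<le> 4 * pi * real b * h" if "\<bar>l\<bar> \<le> 2 * int b" for l
  proof -
    have "norm (?d l) \<le> 2 * pi * (\<bar>of_int l\<bar> * h)"
      using norm_ex_diff_le[of "of_int l * h"] h by (simp add: abs_mult)
    also have "\<bar>of_int l\<bar> \<le> 2 * real b" using that by linarith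
    then have "2 * pi * (\<bar>of_int l\<bar> * h) \<le> 2 * pi * ((2 * real b) * h)"
      using h by (intro mult_left_mono mult_right_mono) auto
    finally show ?thesis by simp
  qed
  have sq: "(\<Sum>l\<in>I. (norm (?d l))\<^sup>2) \<le> (sqrt (real (card I)) * (4 * pi * real b * h))\<^sup>2"
    if "\<And>l. l \<in> I \<Longrightarrow> \<bar>l\<bar> \<le> 2 * int b" for I
  proof -
    have "(\<Sum>l\<in>I. (norm (?d l))\<^sup>2) \<le> (\<Sum>l\<in>I. (4 * pi * real b * h)\<^sup>2)"
      by (intro sum_mono power_mono d that) auto
    also have "\<dots> = (sqrt (real (card I)) * (4 * pi * real b * h))\<^sup>2"
      by (simp add: power_mult_distrib)
    finally show ?thesis .
  qed
  have one: "(\<Sum>l\<in>I. (norm ((\<lambda>_. 1::complex) l))\<^sup>2) \<le> (sqrt (real (card I)))\<^sup>2" for I :: "int set"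
    by simp
  have split: "norm (vp_kernel b (?w' z) - vp_kernel b (?w z)) \<le>
      (norm (tpoly ?L ?d (?w z)) * norm (tpoly ?R (\<lambda>_. 1) (?w' z))
       + norm (tpoly ?L (\<lambda>_. 1) (?w z)) * norm (tpoly ?R ?d (?w z))) / real b" for z
  proof -
    have e: "?w' z = ?w z + h" by simp
    have "vp_kernel b (?w' z) - vp_kernel b (?w z) =
      (tpoly ?L ?d (?w z) * tpoly ?R (\<lambda>_. 1) (?w' z) + tpoly ?L (\<lambda>_. 1) (?w z) * tpoly ?R ?d (?w z)) / of_nat b"
    proof -
      have L: "dirichlet ?L (?w' z) = dirichlet ?L (?w z) + tpoly ?L ?d (?w z)"
        and R: "dirichlet ?R (?w' z) = dirichlet ?R (?w z) + tpoly ?R ?d (?w z)"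
        using sh[of ?L "?w z"] sh[of ?R "?w z"] unfolding e by (simp_all add: algebra_simps)
      show ?thesis
        unfolding vp_kernel_def dirichlet_def[symmetric] L R diff_divide_distrib[symmetric]
        by (intro arg_cong2[where f = "(/)"] refl) algebra
    qed
    then show ?thesis
      by (simp only: norm_divide norm_of_nat) 
        (intro divide_right_mono order_trans[OF norm_triangle_ineq], auto simp: norm_mult)
  qed
  have Lr: "?L \<subseteq> {- int b..<- int b + int ?n}" and Rr: "?R \<subseteq> {- int b..<- int b + int ?n}"
    by (auto simp: left_freqs_def right_freqs_def)
  have Lb: "\<And>l. l \<in> ?L \<Longrightarrow> \<bar>l\<bar> \<le> 2 * int b" and Rb: "\<And>l. l \<in> ?R \<Longrightarrow> \<bar>l\<bar> \<le> 2 * int b"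
    by (auto simp: left_freqs_def right_freqs_def)
  have B1: "(\<Sum>z<?n. norm (tpoly ?L ?d (?w z)) * norm (tpoly ?R (\<lambda>_. 1) (?w' z))) \<le>
     real ?n * ((sqrt (real (card ?L)) * (4 * pi * real b * h)) * sqrt (real (card ?R)))"
    using h by (intro grid_mean_product_le[OF n Lr Rr sq[OF Lb] one]) auto
  have B2: "(\<Sum>z<?n. norm (tpoly ?L (\<lambda>_. 1) (?w z)) * norm (tpoly ?R ?d (?w z))) \<le>
     real ?n * (sqrt (real (card ?L)) * (sqrt (real (card ?R)) * (4 * pi * real b * h)))"
    using h by (intro grid_mean_product_le[OF n Lr Rr one sq[OF Rb]]) auto
  have "(\<Sum>z<?n. norm (vp_kernel b (?w' z) - vp_kernel b (?w z))) \<le>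
     (\<Sum>z<?n. (norm (tpoly ?L ?d (?w z)) * norm (tpoly ?R (\<lambda>_. 1) (?w' z))
       + norm (tpoly ?L (\<lambda>_. 1) (?w z)) * norm (tpoly ?R ?d (?w z))) / real b)"
    by (intro sum_mono split)
  also have "\<dots> \<le> (real ?n * ((sqrt (real (card ?L)) * (4 * pi * real b * h)) * sqrt (real (card ?R)))
      + real ?n * (sqrt (real (card ?L)) * (sqrt (real (card ?R)) * (4 * pi * real b * h)))) / real b"
    unfolding sum_divide_distrib[symmetric] sum.distrib
    by (intro divide_right_mono add_mono B1 B2) auto
  also have "\<dots> = real ?n * ((8 * sqrt 3 * pi) * real b * h)"
    using b by (simp add: real_sqrt_mult divide_simps)
  \<comment> \<open>Two products of size \<open>sqrt 3 * b * (4 * pi * b * h)\<close>, divided by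
    \<open>b\<close>, give \<open>8 * sqrt 3 * pi\<close>; 64 bounds this.\<close>
  also have "\<dots> \<le> real ?n * (64 * real b * h)"
  proof -
    have "sqrt 3 \<le> 2" using real_sqrt_le_mono[of 3 4] by simp
    then have "8 * sqrt 3 * pi \<le> 8 * 2 * 4"
      using pi_less_4 by (intro mult_mono) auto
    then show ?thesis using h by (intro mult_left_mono mult_right_mono) auto
  qed
  finally show ?thesis .
qed

text \<open>A Bernstein inequality in discrete L1. Reproducing \<open>u\<close> from its samples
  moves the difference onto the kernel, whose differences are small in the mean on every grid;
  \<open>u\<close> itself need be controlled on one shift \<open>y\<close> only.\<close>

lemma band_diff_mean:
  assumes b: "b > 0" and u: "band b u" and h: "h \<ge> 0"
    and Lam: "(\<Sum>z<4*b. norm (u (y + real z / real (4*b)))) \<le> real (4*b) * \<Lambda>"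
  shows "(\<Sum>z<4*b. norm (u (y' + h + real z / real (4*b)) - u (y' + real z / real (4*b))))
    \<le> real (4*b) * (64 * real b * h * \<Lambda>)"
proof -
  let ?n = "4 * b"
  let ?w = "\<lambda>z. y + real z / real ?n" and ?x = "\<lambda>z. y' + real z / real ?n"
  let ?K = "\<lambda>x. vp_kernel b (x + h) - vp_kernel b x"
  have n: "real ?n > 0" using b by simp
  have rep: "real ?n * norm (u (x + h) - u x) \<le> (\<Sum>w<?n. norm (u (?w w)) * norm (?K (x - ?w w)))" for x
  proof -
    have "of_nat ?n * (u (x + h) - u x) = (\<Sum>w<?n. u (?w w) * ?K (x - ?w w))"
      unfolding right_diff_distrib sum_subtractf
      using band_reproduce[OF b u, of "x + h" y] band_reproduce[OF b u, of x y]
      by (simp add: algebra_simps)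
    then have "norm (of_nat ?n * (u (x + h) - u x)) \<le> (\<Sum>w<?n. norm (u (?w w)) * norm (?K (x - ?w w)))"
      by (simp only:) (rule order_trans[OF norm_sum], simp add: norm_mult)
    then show ?thesis by (simp only: norm_mult norm_of_nat)
  qed
  have "real ?n * (\<Sum>z<?n. norm (u (?x z + h) - u (?x z))) \<le>
      (\<Sum>z<?n. \<Sum>w<?n. norm (u (?w w)) * norm (?K (?x z - ?w w)))"
    unfolding sum_distrib_left by (intro sum_mono rep)
  also have "\<dots> = (\<Sum>w<?n. norm (u (?w w)) * (\<Sum>z<?n. norm (?K (?x z - ?w w))))"
    by (subst sum.swap) (simp add: sum_distrib_left)
  also have "\<dots> \<le> (\<Sum>w<?n. norm (u (?w w)) * (real ?n * (64 * real b * h)))"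
  proof (intro sum_mono mult_left_mono)
    fix w
    have "(\<Sum>z<?n. norm (?K (?x z - ?w w))) = 
      (\<Sum>z<?n. norm (vp_kernel b ((y' - ?w w) + h + real z / real ?n) - vp_kernel b ((y' - ?w w) + real z / real ?n)))"
      by (intro sum.cong) (auto simp: algebra_simps)
    also have "\<dots> \<le> real ?n * (64 * real b * h)"
      by (rule vp_kernel_diff_mean[OF b h])
    finally show "(\<Sum>z<?n. norm (?K (?x z - ?w w))) \<le> real ?n * (64 * real b * h)" .
  qed auto
  also have "\<dots> = (\<Sum>w<?n. norm (u (?w w))) * (real ?n * (64 * real b * h))"
    by (simp add: sum_distrib_right)
  also have "\<dots> \<le> (real ?n * \<Lambda>) * (real ?n * (64 * real b * h))"
    using h by (intro mult_right_mono Lam) auto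
  finally have "real ?n * (\<Sum>z<?n. norm (u (?x z + h) - u (?x z))) \<le> real ?n * (real ?n * (64 * real b * h * \<Lambda>))"
    by (simp only: mult_ac)
  then have "(\<Sum>z<?n. norm (u (?x z + h) - u (?x z))) \<le> real ?n * (64 * real b * h * \<Lambda>)"
    using n by (rule mult_left_le_imp_le)
  then show ?thesis by (simp add: algebra_simps)
qed


section \<open>Walsh coefficients of trigonometric polynomials\<close>

text \<open>Dyadic rationals and Walsh indices are both encoded as sets of bit positions, so that
  sums over either are sums over a power set.\<close>

definition bitval :: "nat set \<Rightarrow> real" where
  "bitval X = (\<Sum>b\<in>X. 1 / 2 ^ b)"

definition walsh :: "nat set \<Rightarrow> nat set \<Rightarrow> complex" where
  "walsh K X = (-1) ^ card (X \<inter> K)"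

definition walsh_sum :: "(real \<Rightarrow> complex) \<Rightarrow> nat set \<Rightarrow> nat set \<Rightarrow> complex" where
  "walsh_sum v S K = (\<Sum>X\<in>Pow S. v (bitval X) * walsh K X)"

lemma sum_Pow_insert:
  fixes f :: "'a set \<Rightarrow> 'b::comm_monoid_add"
  assumes "finite S" "a \<notin> S"
  shows "(\<Sum>X\<in>Pow (insert a S). f X) = (\<Sum>X\<in>Pow S. f X) + (\<Sum>X\<in>Pow S. f (insert a X))"
proof -
  have "inj_on (insert a) (Pow S)"
    using assms by (auto simp: inj_on_def)
  moreover have "Pow S \<inter> insert a ` Pow S = {}"
    using assms by auto
  ultimately show ?thesis
    unfolding Pow_insert using assms
    by (subst sum.union_disjoint) (auto simp: sum.reindex)
qed

lemma bitval_insert: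
  assumes "finite X" "a \<notin> X" shows "bitval (insert a X) = bitval X + 1 / 2 ^ a"
  using assms by (simp add: bitval_def)

lemma walsh_insert:
  assumes "finite X" "a \<notin> X" shows "walsh K (insert a X) = (if a \<in> K then - 1 else 1) * walsh K X"
  using assms by (simp add: walsh_def)

text \<open>Splitting on the bit \<open>a\<close> pairs \<open>x\<close> with
  \<open>x + 1 / 2 ^ a\<close>; the pair is subtracted if \<open>a \<in> K\<close> and added
  otherwise. This is the induction step of \<open>walsh_sum_bound\<close>.\<close>

lemma walsh_sum_insert:
  assumes "finite S" "a \<notin> S"
  shows "walsh_sum v (insert a S) K =
    walsh_sum v S K + (if a \<in> K then - 1 else 1) * walsh_sum (\<lambda>x. v (x + 1 / 2 ^ a)) S K"
proof -
  have "(\<Sum>X\<in>Pow S. v (bitval (insert a X)) * walsh K (insert a X)) =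
      (\<Sum>X\<in>Pow S. (if a \<in> K then - 1 else 1) * (v (bitval X + 1 / 2 ^ a) * walsh K X))"
  proof (intro sum.cong refl)
    fix X assume "X \<in> Pow S"
    then have X: "finite X" "a \<notin> X" using assms finite_subset by auto
    show "v (bitval (insert a X)) * walsh K (insert a X) =
      (if a \<in> K then - 1 else 1) * (v (bitval X + 1 / 2 ^ a) * walsh K X)"
      unfolding bitval_insert[OF X] walsh_insert[OF X] by simp
  qed
  then show ?thesis
    using assms unfolding walsh_sum_def sum_Pow_insert[OF assms] by (simp only: sum_distrib_left)
qed

lemma walsh_sum_diff: "walsh_sum (\<lambda>x. v x - w x) S K = walsh_sum v S K - walsh_sum w S K"
  by (simp add: walsh_sum_def sum_subtractf left_diff_distrib)

lemma sum_pairs: "(\<Sum>c<2 * n. f c) = (\<Sum>c<n. f (2 * c) + f (2 * c + 1))"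
  for f :: "nat \<Rightarrow> 'a::comm_monoid_add"
  by (induction n) (auto simp: add_ac)

lemma sum_bitval:
  fixes h :: "real \<Rightarrow> 'a::comm_monoid_add"
  shows "(\<Sum>X\<in>Pow {1..m}. h (bitval X)) = (\<Sum>c<2 ^ m. h (real c / 2 ^ m))"
proof (induction m arbitrary: h)
  case 0
  show ?case by (simp add: bitval_def)
next
  case (Suc m)
  have ins: "{1..Suc m} = insert (Suc m) {1..m}" by auto
  have "(\<Sum>X\<in>Pow {1..Suc m}. h (bitval X)) =
     (\<Sum>X\<in>Pow {1..m}. h (bitval X)) + (\<Sum>X\<in>Pow {1..m}. h (bitval (insert (Suc m) X)))"
    unfolding ins by (rule sum_Pow_insert) auto
  also have "(\<Sum>X\<in>Pow {1..m}. h (bitval (insert (Suc m) X))) = 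
     (\<Sum>X\<in>Pow {1..m}. h (bitval X + 1 / 2 ^ Suc m))"
  proof (intro sum.cong refl)
    fix X assume "X \<in> Pow {1..m}"
    then have X: "finite X" "Suc m \<notin> X" using finite_subset by auto
    show "h (bitval (insert (Suc m) X)) = h (bitval X + 1 / 2 ^ Suc m)"
      unfolding bitval_insert[OF X] ..
  qed
  also have "(\<Sum>X\<in>Pow {1..m}. h (bitval X)) + (\<Sum>X\<in>Pow {1..m}. h (bitval X + 1 / 2 ^ Suc m)) =
      (\<Sum>c<2 ^ m. h (real c / 2 ^ m) + h (real c / 2 ^ m + 1 / 2 ^ Suc m))"
    by (simp only: Suc.IH[of h] Suc.IH[of "\<lambda>x. h (x + 1 / 2 ^ Suc m)"] sum.distrib)
  also have "\<dots> = (\<Sum>c<2 ^ m. h (real (2 * c) / 2 ^ Suc m) + h (real (2 * c + 1) / 2 ^ Suc m))"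
    by (simp add: add_divide_distrib add.commute)
  also have "\<dots> = (\<Sum>c<2 ^ Suc m. h (real c / 2 ^ Suc m))"
    unfolding power_Suc[of "2::nat"] sum_pairs ..
  finally show ?case .
qed

text \<open>The grid has four times as many points as the degree \<open>2 ^ m\<close>, so that \<open>band_reproduce\<close> applies
  to trigonometric polynomials of this degree.\<close>

definition grid_bound :: "nat \<Rightarrow> (real \<Rightarrow> complex) \<Rightarrow> real \<Rightarrow> bool" where
  "grid_bound m v \<Lambda> \<longleftrightarrow>
     (\<forall>y. (\<Sum>z<4 * 2 ^ m. norm (v (y + real z / real (4 * 2 ^ m)))) \<le> real (4 * 2 ^ m) * \<Lambda>)"

lemma grid_bound_shift:
  assumes "grid_bound m v \<Lambda>" shows "grid_bound m (\<lambda>x. v (x + h)) \<Lambda>"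
  unfolding grid_bound_def
proof
  fix y
  show "(\<Sum>z<4 * 2 ^ m. norm (v (y + real z / real (4 * 2 ^ m) + h))) \<le> real (4 * 2 ^ m) * \<Lambda>"
    using assms[unfolded grid_bound_def, rule_format, of "y + h"] by (simp add: add_ac)
qed

lemma grid_bound_diff:
  assumes "band (2 ^ m) v" "grid_bound m v \<Lambda>" "h \<ge> 0"
  shows "grid_bound m (\<lambda>x. v x - v (x + h)) (64 * 2 ^ m * h * \<Lambda>)"
  unfolding grid_bound_def
proof
  fix y
  have "(\<Sum>z<4 * 2 ^ m. norm (v (y + h + real z / real (4 * 2 ^ m)) - v (y + real z / real (4 * 2 ^ m))))
     \<le> real (4 * 2 ^ m) * (64 * real (2 ^ m) * h * \<Lambda>)"
    by (rule band_diff_mean) (use assms in \<open>auto simp: grid_bound_def\<close>)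
  then show "(\<Sum>z<4 * 2 ^ m. norm (v (y + real z / real (4 * 2 ^ m)) - v (y + real z / real (4 * 2 ^ m) + h)))
     \<le> real (4 * 2 ^ m) * (64 * 2 ^ m * h * \<Lambda>)"
    by (subst norm_minus_commute) (simp add: add_ac)
qed

text \<open>The points \<open>c / 2 ^ m\<close> are every fourth point of the fine grid with
  \<open>y = 0\<close>; this loses the factor 4.\<close>

lemma grid_bound_coarse:
  assumes "grid_bound m v \<Lambda>"
  shows "(\<Sum>c<2 ^ m. norm (v (real c / 2 ^ m))) \<le> 4 * 2 ^ m * \<Lambda>"
proof -
  have "(\<Sum>c<2 ^ m. norm (v (real c / 2 ^ m))) =
      (\<Sum>z\<in>(\<lambda>c. 4 * c) ` {..<2 ^ m}. norm (v (0 + real z / real (4 * 2 ^ m))))"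
    by (subst sum.reindex) (auto simp: inj_on_def)
  also have "\<dots> \<le> (\<Sum>z<4 * 2 ^ m. norm (v (0 + real z / real (4 * 2 ^ m))))"
    by (intro sum_mono2) auto
  also have "\<dots> \<le> real (4 * 2 ^ m) * \<Lambda>"
    using assms unfolding grid_bound_def by blast
  finally show ?thesis by simp
qed

text \<open>Each bit in \<open>K\<close> beyond the \<open>m\<close>-th one produces a difference of step size \<open>2\<^sup>-\<^sup>a\<close>.\<close>

lemma walsh_sum_bound:
  assumes "finite S" "S \<subseteq> {m<..}" "band (2 ^ m) v" "grid_bound m v \<Lambda>"
  shows "norm (walsh_sum v ({1..m} \<union> S) K) \<le>
    4 * 2 ^ m * \<Lambda> * (\<Prod>a\<in>S. if a \<in> K then 64 * 2 ^ m / 2 ^ a else 2)"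
  using assms
proof (induction S arbitrary: v \<Lambda> rule: finite_induct)
  case empty
  have "norm (walsh_sum v {1..m} K) \<le> (\<Sum>X\<in>Pow {1..m}. norm (v (bitval X)))"
    unfolding walsh_sum_def by (rule order_trans[OF norm_sum]) (simp add: norm_mult walsh_def norm_power)
  also have "\<dots> \<le> 4 * 2 ^ m * \<Lambda>"
    using grid_bound_coarse[OF empty(3)] unfolding sum_bitval[of "\<lambda>x. norm (v x)"] .
  finally show ?case by simp
next
  case (insert a S)
  let ?P = "\<Prod>a\<in>S. if a \<in> K then 64 * 2 ^ m / 2 ^ a else (2::real)"
  let ?T = "\<lambda>x. v (x + 1 / 2 ^ a)"
  have IH: "norm (walsh_sum v ({1..m} \<union> S) K) \<le> 4 * 2 ^ m * \<Lambda> * ?P"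
    if "band (2 ^ m) v" "grid_bound m v \<Lambda>" for v \<Lambda>
    using insert.IH[of v \<Lambda>] that insert.prems by simp
  have sp: "walsh_sum v ({1..m} \<union> insert a S) K = walsh_sum v ({1..m} \<union> S) K +
      (if a \<in> K then - 1 else 1) * walsh_sum ?T ({1..m} \<union> S) K"
    using insert walsh_sum_insert[of "{1..m} \<union> S" a v K] by auto
  show ?case
  proof (cases "a \<in> K")
    case True
    then have "walsh_sum v ({1..m} \<union> insert a S) K = walsh_sum (\<lambda>x. v x - ?T x) ({1..m} \<union> S) K"
      using sp by (simp add: walsh_sum_diff)
    then have "norm (walsh_sum v ({1..m} \<union> insert a S) K) \<le> 4 * 2 ^ m * (64 * 2 ^ m * (1 / 2 ^ a) * \<Lambda>) * ?P"
      using insert.prems by (simp only:) (intro IH band_diff band_shift grid_bound_diff, auto)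
    then show ?thesis using insert True by (simp add: mult_ac)
  next
    case False
    then have "norm (walsh_sum v ({1..m} \<union> insert a S) K) \<le> 
       norm (walsh_sum v ({1..m} \<union> S) K) + norm (walsh_sum ?T ({1..m} \<union> S) K)"
      using sp by (simp add: norm_triangle_ineq)
    also have "\<dots> \<le> 4 * 2 ^ m * \<Lambda> * ?P + 4 * 2 ^ m * \<Lambda> * ?P"
      using insert.prems by (intro add_mono IH band_shift grid_bound_shift) auto
    finally show ?thesis using insert False by (simp add: mult_ac)
  qed
qed

text \<open>The integral is replaced by the mean over multiples of \<open>2 powr (- B)\<close>. The
  points of interest have at most \<open>B\<close> digits, so the finite inversion formula is exact
  and no convergence question arises.\<close>

definition walsh_coeff :: "(real \<Rightarrow> complex) \<Rightarrow> nat \<Rightarrow> nat set \<Rightarrow> complex" where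
  "walsh_coeff v B K = walsh_sum v {1..B} K / 2 ^ B"

text \<open>In \<open>walsh_sum_bound\<close> a bit of \<open>K\<close> beyond \<open>m\<close>
  costs \<open>64 * 2 ^ m / 2 ^ a\<close> and any other such bit costs 2; normalising by 2 per bit
  turns 64 into 32.\<close>

definition bit_weight :: "nat \<Rightarrow> nat \<Rightarrow> real" where
  "bit_weight m a = (if a \<le> m then 1 else 32 * 2 ^ m / 2 ^ a)"

lemma walsh_coeff_bound:
  assumes "m \<le> B" "band (2 ^ m) v" "grid_bound m v \<Lambda>" "K \<subseteq> {1..B}"
  shows "norm (walsh_coeff v B K) \<le> 4 * \<Lambda> * (\<Prod>a\<in>K. bit_weight m a)"
proof -
  let ?S = "{m<..B}"
  have un: "{1..B} = {1..m} \<union> ?S" using assms(1) by auto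
  have fK: "finite K" using assms(4) finite_subset by blast
  have "(\<Prod>a\<in>?S. if a \<in> K then 64 * 2 ^ m / 2 ^ a else (2::real)) =
      (\<Prod>a\<in>?S. 2 * (if a \<in> K then bit_weight m a else 1))"
    by (intro prod.cong) (auto simp: bit_weight_def)
  also have "\<dots> = 2 ^ (B - m) * (\<Prod>a\<in>?S. if a \<in> K then bit_weight m a else 1)"
    by (simp add: prod.distrib)
  also have "(\<Prod>a\<in>?S. if a \<in> K then bit_weight m a else 1) = (\<Prod>a\<in>?S \<inter> K. bit_weight m a)"
    by (simp add: prod.inter_restrict)
  also have "\<dots> = (\<Prod>a\<in>K. bit_weight m a)"
    using fK assms(4) by (intro prod.mono_neutral_left) (auto simp: bit_weight_def)
  finally have P: "(\<Prod>a\<in>?S. if a \<in> K then 64 * 2 ^ m / 2 ^ a else (2::real)) =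
      2 ^ (B - m) * (\<Prod>a\<in>K. bit_weight m a)" .
  have "norm (walsh_sum v {1..B} K) \<le> 4 * 2 ^ m * \<Lambda> * (2 ^ (B - m) * (\<Prod>a\<in>K. bit_weight m a))"
    unfolding un P[symmetric] by (rule walsh_sum_bound) (use assms in auto)
  also have "\<dots> = 2 ^ B * (4 * \<Lambda> * (\<Prod>a\<in>K. bit_weight m a))"
  proof -
    have "(2::real) ^ B = 2 ^ m * 2 ^ (B - m)"
      using assms(1) by (simp flip: power_add)
    then show ?thesis by simp
  qed
  finally show ?thesis
    by (simp add: walsh_coeff_def norm_divide norm_power divide_simps mult_ac)
qed

lemma walsh_prod: "finite K \<Longrightarrow> walsh K X = (\<Prod>a\<in>K. if a \<in> X then - 1 else 1)"
  by (simp add: walsh_def prod.If_cases Int_commute)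

lemma sum_Pow_prod:
  fixes c :: "'a \<Rightarrow> 'b::comm_semiring_1"
  assumes "finite S" shows "(\<Sum>K\<in>Pow S. \<Prod>a\<in>K. c a) = (\<Prod>a\<in>S. 1 + c a)"
  using prod_add[OF assms, of c "\<lambda>_. 1"] by (simp add: add.commute)

text \<open>The sum factors over the bits of \<open>S\<close>; a bit on which \<open>X\<close> and
  \<open>Y\<close> differ gives the factor \<open>1 - 1\<close>.\<close>

lemma walsh_orth:
  assumes "finite S" "X \<subseteq> S" "Y \<subseteq> S"
  shows "(\<Sum>K\<in>Pow S. walsh K X * walsh K Y) = (if X = Y then 2 ^ card S else 0)"
proof -
  let ?c = "\<lambda>a. (if a \<in> X then - 1 else 1) * (if a \<in> Y then - 1 else (1::complex))"
  have "(\<Sum>K\<in>Pow S. walsh K X * walsh K Y) = (\<Sum>K\<in>Pow S. \<Prod>a\<in>K. ?c a)"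
  proof (intro sum.cong refl)
    fix K assume "K \<in> Pow S"
    then have "finite K" using assms(1) finite_subset by auto
    then show "walsh K X * walsh K Y = (\<Prod>a\<in>K. ?c a)"
      by (simp only: walsh_prod prod.distrib)
  qed
  also have "\<dots> = (\<Prod>a\<in>S. 1 + ?c a)"
    by (rule sum_Pow_prod[OF assms(1)])
  also have "\<dots> = (if X = Y then 2 ^ card S else 0)"
  proof (cases "X = Y")
    case True
    then have "(\<Prod>a\<in>S. 1 + ?c a) = (\<Prod>a\<in>S. 2)" by (intro prod.cong) auto
    then show ?thesis using True by simp
  next
    case False
    then obtain a where "a \<in> S" "(a \<in> X) \<noteq> (a \<in> Y)" using assms by blast
    then have "\<exists>a\<in>S. 1 + ?c a = 0" by (intro bexI[of _ a]) auto
    then show ?thesis using False assms(1) by (subst prod_zero) auto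
  qed
  finally show ?thesis .
qed

lemma walsh_inversion:
  assumes "X \<subseteq> {1..B}"
  shows "v (bitval X) = (\<Sum>K\<in>Pow {1..B}. walsh_coeff v B K * walsh K X)"
proof -
  have "(\<Sum>K\<in>Pow {1..B}. walsh_coeff v B K * walsh K X) =
     (\<Sum>K\<in>Pow {1..B}. \<Sum>Y\<in>Pow {1..B}. v (bitval Y) * (walsh K Y * walsh K X)) / 2 ^ B"
    unfolding walsh_coeff_def walsh_sum_def sum_distrib_right sum_divide_distrib
    by (intro sum.cong refl) simp
  also have "(\<Sum>K\<in>Pow {1..B}. \<Sum>Y\<in>Pow {1..B}. v (bitval Y) * (walsh K Y * walsh K X)) =
      (\<Sum>Y\<in>Pow {1..B}. v (bitval Y) * (\<Sum>K\<in>Pow {1..B}. walsh K Y * walsh K X))"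
    by (subst sum.swap) (simp add: sum_distrib_left)
  also have "\<dots> = (\<Sum>Y\<in>Pow {1..B}. if Y = X then v (bitval X) * 2 ^ B else 0)"
    using assms by (intro sum.cong refl) (subst walsh_orth, auto)
  also have "\<dots> = v (bitval X) * 2 ^ B"
    using assms by (subst sum.delta) auto
  finally show ?thesis by simp
qed

lemma walsh_coeff_empty: "walsh_coeff v B {} = (\<Sum>c<2 ^ B. v (real c / 2 ^ B)) / 2 ^ B"
  using sum_bitval[of v B] by (simp add: walsh_coeff_def walsh_sum_def walsh_def)


section \<open>The dual of a digital net\<close>

definition bit_sign :: "bit \<Rightarrow> complex" where
  "bit_sign b = (if b = 1 then - 1 else 1)"

lemma bit_sign_add: "bit_sign (x + y) = bit_sign x * bit_sign y"
  by (cases x; cases y) (auto simp: bit_sign_def)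

lemma bit_sign_0 [simp]: "bit_sign 0 = 1"
  by (simp add: bit_sign_def)

lemma bit_sign_sum: "bit_sign (\<Sum>a\<in>A. f a) = (\<Prod>a\<in>A. bit_sign (f a))"
  by (induction A rule: infinite_finite_induct)
    (simp_all only: sum.insert prod.insert bit_sign_add sum.infinite prod.infinite sum.empty prod.empty bit_sign_0 simp_thms)

lemma norm_bit_sign [simp]: "norm (bit_sign x) = 1"
  by (simp add: bit_sign_def)

lemma binary_vec_eq_0:
  assumes "k < 2 ^ J" "l > J" shows "binary_vec k l = 0"
proof -
  have "k < 2 ^ (l - 1)"
    using assms power_increasing[of J "l - 1" "2::nat"] by linarith
  then show ?thesis by (simp add: binary_vec_def)
qed

lemma digital_digit_extend:
  assumes "k \<le> J" shows "digital_digit M k i = (\<Sum>l=1..J. M i l * binary_vec k l)"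
proof -
  have "k < 2 ^ k" by simp
  then have "binary_vec k l = 0" if "l > k" for l using that by (rule binary_vec_eq_0)
  then show ?thesis
    unfolding digital_digit_def using assms by (intro sum.mono_neutral_left) auto
qed

text \<open>No carries occur: \<open>c\<close> occupies the lower \<open>n\<close> digits and
  \<open>a * 2 ^ n\<close> the others, so the digits simply add over the field.\<close>

lemma binary_vec_block:
  assumes "c < 2 ^ n" "l \<ge> 1"
  shows "binary_vec (a * 2 ^ n + c) l = (if l \<le> n then binary_vec c l else 0) + binary_vec (a * 2 ^ n) l"
proof (cases "l \<le> n")
  case True
  define u where "u = n - l"
  have n: "n = Suc u + (l - 1)" using True assms by (simp add: u_def)
  have "a * 2 ^ n = (2 * (a * 2 ^ u)) * 2 ^ (l - 1)"
    by (subst n) (simp only: power_add power_Suc mult_ac)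
  then have "(a * 2 ^ n + c) div 2 ^ (l - 1) = 2 * (a * 2 ^ u) + c div 2 ^ (l - 1)"
    "(a * 2 ^ n) div 2 ^ (l - 1) = 2 * (a * 2 ^ u)"
    by (simp_all only:) simp_all
  then show ?thesis using True by (simp add: binary_vec_def)
next
  case False
  define u where "u = l - 1 - n"
  have l: "l - 1 = n + u" using False by (simp add: u_def)
  have "(a * 2 ^ n + c) div 2 ^ (l - 1) = a div 2 ^ u" "(a * 2 ^ n) div 2 ^ (l - 1) = a div 2 ^ u"
    using assms unfolding l power_add div_mult2_eq by simp_all
  then show ?thesis using False by (simp add: binary_vec_def)
qed

text \<open>A linear part in the first \<open>n\<close> columns plus a summand free of
  \<open>c\<close>: every aligned block of \<open>2 ^ n\<close> indices is the same digital net,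
  digitally shifted.\<close>

lemma digital_digit_block:
  assumes "c < 2 ^ n"
  shows "digital_digit M (a * 2 ^ n + c) i =
    (\<Sum>l=1..n. M i l * binary_vec c l) + digital_digit M (a * 2 ^ n) i"
proof -
  let ?J = "a * 2 ^ n + c + n"
  have "digital_digit M (a * 2 ^ n + c) i = (\<Sum>l=1..?J. M i l * binary_vec (a * 2 ^ n + c) l)"
    by (rule digital_digit_extend) simp
  also have "\<dots> = (\<Sum>l=1..?J. M i l * (if l \<le> n then binary_vec c l else 0) + M i l * binary_vec (a * 2 ^ n) l)"
    using assms by (intro sum.cong refl) (subst binary_vec_block, auto simp only: ring_distribs atLeastAtMost_iff)
  also have "\<dots> = (\<Sum>l=1..?J. M i l * (if l \<le> n then binary_vec c l else 0)) + digital_digit M (a * 2 ^ n) i"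
    unfolding sum.distrib by (subst digital_digit_extend[of "a * 2 ^ n" ?J]) auto
  also have "(\<Sum>l=1..?J. M i l * (if l \<le> n then binary_vec c l else 0)) =
      (\<Sum>l=1..n. M i l * (if l \<le> n then binary_vec c l else 0))"
    by (intro sum.mono_neutral_right) auto
  also have "\<dots> = (\<Sum>l=1..n. M i l * binary_vec c l)"
    by (intro sum.cong) auto
  finally show ?thesis .
qed

lemma sum_lessThan_double: "(\<Sum>c<n + n. f c) = (\<Sum>c<n. f c) + (\<Sum>c<n. f (n + c))"
  for f :: "nat \<Rightarrow> 'a::comm_monoid_add"
proof -
  have "(\<Sum>c<n + n. f c) = (\<Sum>c=0..<n. f c) + (\<Sum>c=n..<n + n. f c)"
    by (simp add: sum.atLeastLessThan_concat lessThan_atLeast0)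
  also have "(\<Sum>c=n..<n + n. f c) = (\<Sum>c<n. f (n + c))"
    using sum.shift_bounds_nat_ivl[of f 0 n n] by (simp add: lessThan_atLeast0 add.commute)
  finally show ?thesis by (simp add: lessThan_atLeast0)
qed

text \<open>Orthogonality of characters on vectors of \<open>n\<close> bits. Splitting on the top
  bit of \<open>c\<close> contributes the factor \<open>1 + bit_sign (R (Suc n))\<close>, which is 2
  or 0.\<close>

lemma sum_bit_sign_linear:
  "(\<Sum>c<2 ^ n. \<Prod>l=1..n. bit_sign (R l * binary_vec c l)) =
    (if \<forall>l\<in>{1..n}. R l = 0 then 2 ^ n else 0)"
proof (induction n)
  case 0
  show ?case by simp
next
  case (Suc n)
  let ?g = "\<lambda>n c. \<Prod>l=1..n. bit_sign (R l * binary_vec c l)"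
  have 1: "?g (Suc n) c = ?g n c" if "c < 2 ^ n" for c
    using binary_vec_eq_0[OF that, of "Suc n"] by simp
  have 2: "?g (Suc n) (2 ^ n + c) = ?g n c * bit_sign (R (Suc n))" if c: "c < 2 ^ n" for c
  proof -
    have b1: "binary_vec (2 ^ n + c) l = (if l \<le> n then binary_vec c l else 0) + binary_vec (2 ^ n) l" if "l \<ge> 1" for l
      using binary_vec_block[OF c that, of 1] by simp
    have b2: "binary_vec (2 ^ n) (Suc n) = 1"
      by (simp add: binary_vec_def)
    have b3: "binary_vec (2 ^ n) l = 0" if "1 \<le> l" "l \<le> n" for l
    proof -
      have "(2::nat) ^ n div 2 ^ (l - 1) = 2 ^ Suc (n - l)"
        using that by (subst power_diff[symmetric]) (auto simp: Suc_diff_le)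
      then show ?thesis by (simp add: binary_vec_def)
    qed
    have "?g n (2 ^ n + c) = ?g n c"
      by (intro prod.cong refl) (simp add: b1 b3)
    moreover have "binary_vec (2 ^ n + c) (Suc n) = 1"
      using b1[of "Suc n"] b2 by simp
    ultimately show ?thesis by simp
  qed
  have "(\<Sum>c<2 ^ Suc n. ?g (Suc n) c) = (\<Sum>c<2 ^ n + 2 ^ n. ?g (Suc n) c)"
    by (simp add: mult_2)
  also have "\<dots> = (\<Sum>c<2 ^ n. ?g n c) + (\<Sum>c<2 ^ n. ?g n c * bit_sign (R (Suc n)))"
    unfolding sum_lessThan_double using 1 2 by (intro arg_cong2[where f = "(+)"] sum.cong) auto
  also have "\<dots> = (\<Sum>c<2 ^ n. ?g n c) * (1 + bit_sign (R (Suc n)))"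
    by (simp add: sum_distrib_right[symmetric] ring_distribs)
  also have "\<dots> = (if \<forall>l\<in>{1..Suc n}. R l = 0 then 2 ^ Suc n else 0)"
  proof -
    have "(\<forall>l\<in>{1..Suc n}. R l = 0) \<longleftrightarrow> (\<forall>l\<in>{1..n}. R l = 0) \<and> R (Suc n) = 0"
      by (simp add: atLeastAtMostSuc_conv conj_commute)
    then show ?thesis
      unfolding Suc.IH by (cases "R (Suc n)") (auto simp: bit_sign_def)
  qed
  finally show ?case .
qed

text \<open>The dual net, with an index given by the rows it selects: a nonempty member is a linear
  dependence among rows truncated to \<open>n\<close> columns, which is what the net condition
  restricts.\<close>

definition dual :: "('d::finite \<Rightarrow> nat \<Rightarrow> nat \<Rightarrow> bit) \<Rightarrow> nat \<Rightarrow> ('d \<Rightarrow> nat set) \<Rightarrow> bool" where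
  "dual E n K \<longleftrightarrow> (\<forall>l\<in>{1..n}. (\<Sum>i\<in>UNIV. \<Sum>b\<in>K i. E i b l) = 0)"

text \<open>The digital shift of the block only contributes a sign. Taking the norm removes it,
  which makes all later bounds uniform in \<open>a\<close>.\<close>

lemma norm_block_char_sum:
  "norm (\<Sum>c<2 ^ n. \<Prod>i\<in>UNIV. \<Prod>b\<in>K i. bit_sign (digital_digit (E i) (a * 2 ^ n + c) b)) =
    (if dual E n K then 2 ^ n else 0)"
proof -
  let ?s = "bit_sign (\<Sum>i\<in>UNIV. \<Sum>b\<in>K i. digital_digit (E i) (a * 2 ^ n) b)"
  let ?R = "\<lambda>l. \<Sum>i\<in>UNIV. \<Sum>b\<in>K i. E i b l"
  have "(\<Prod>i\<in>UNIV. \<Prod>b\<in>K i. bit_sign (digital_digit (E i) (a * 2 ^ n + c) b)) =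
      ?s * (\<Prod>l=1..n. bit_sign (?R l * binary_vec c l))" if c: "c < 2 ^ n" for c
  proof -
    have "(\<Sum>i\<in>UNIV. \<Sum>b\<in>K i. digital_digit (E i) (a * 2 ^ n + c) b) =
       (\<Sum>i\<in>UNIV. \<Sum>b\<in>K i. \<Sum>l=1..n. E i b l * binary_vec c l) +
       (\<Sum>i\<in>UNIV. \<Sum>b\<in>K i. digital_digit (E i) (a * 2 ^ n) b)"
      by (simp only: digital_digit_block[OF c] sum.distrib)
    also have "(\<Sum>i\<in>UNIV. \<Sum>b\<in>K i. \<Sum>l=1..n. E i b l * binary_vec c l) =
        (\<Sum>i\<in>UNIV. \<Sum>l=1..n. \<Sum>b\<in>K i. E i b l * binary_vec c l)"
      by (intro sum.cong refl sum.swap)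
    also have "\<dots> = (\<Sum>l=1..n. ?R l * binary_vec c l)"
      by (subst sum.swap) (simp only: sum_distrib_right)
    finally show ?thesis
      by (simp only: bit_sign_sum[symmetric] bit_sign_add mult_ac)
  qed
  then have "(\<Sum>c<2 ^ n. \<Prod>i\<in>UNIV. \<Prod>b\<in>K i. bit_sign (digital_digit (E i) (a * 2 ^ n + c) b)) =
      ?s * (\<Sum>c<2 ^ n. \<Prod>l=1..n. bit_sign (?R l * binary_vec c l))"
    by (simp add: sum_distrib_left)
  also have "\<dots> = ?s * (if dual E n K then 2 ^ n else 0)"
    unfolding sum_bit_sign_linear dual_def ..
  finally show ?thesis by (simp add: norm_mult norm_power)
qed

text \<open>Matches a set of rows with the decreasing row indices in the definition of a net, where
  the largest ones come first.\<close>

lemma decreasing_enumeration: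
  assumes "finite (K::nat set)"
  obtains f where "bij_betw f {1..card K} K"
    "\<And>l l'. \<lbrakk>1 \<le> l; l < l'; l' \<le> card K\<rbrakk> \<Longrightarrow> f l' < f l"
proof -
  define xs where "xs = rev (sorted_list_of_set K)"
  have len: "length xs = card K" and set: "set xs = K" and dist: "distinct xs"
    using assms by (simp_all add: xs_def)
  have "sorted_wrt (<) (sorted_list_of_set K)"
    by (rule strict_sorted_list_of_set)
  then have dec: "sorted_wrt (\<lambda>x y. y < x) xs"
    by (simp add: xs_def sorted_wrt_rev)
  have "bij_betw ((!) xs) {..<card K} K"
    using dist len set by (intro bij_betw_nth) auto
  moreover have "bij_betw (\<lambda>l. l - 1) {1..card K} {..<card K}"
    by (rule bij_betw_byWitness[where f' = Suc]) auto
  ultimately have "bij_betw ((!) xs \<circ> (\<lambda>l. l - 1)) {1..card K} K"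
    by (rule bij_betw_trans[rotated])
  moreover have "((!) xs \<circ> (\<lambda>l. l - 1)) l' < ((!) xs \<circ> (\<lambda>l. l - 1)) l"
    if "1 \<le> l" "l < l'" "l' \<le> card K" for l l'
    using that len sorted_wrt_nth_less[OF dec, of "l - 1" "l' - 1"] by auto
  ultimately show ?thesis using that by blast
qed

text \<open>For any \<open>m\<close>, the sum of the two largest elements of \<open>K i\<close> is at most
  \<open>2 * m i + (\<Sum>a\<in>K i. a - m i)\<close>, with truncated subtraction.\<close>

lemma dual_large:
  fixes E :: "'d::finite \<Rightarrow> nat \<Rightarrow> nat \<Rightarrow> bit"
  assumes seq: "order_digital_seq 2 t E" and K: "\<And>i. K i \<subseteq> {1..B}" and dual: "dual E n K"
    and ne: "K i0 \<noteq> {}"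
  shows "2 * n < t + (\<Sum>i\<in>UNIV. 2 * m i + (\<Sum>a\<in>K i. a - m i))"
proof (rule ccontr)
  let ?S = "\<lambda>i. 2 * m i + (\<Sum>a\<in>K i. a - m i)"
  assume "\<not> 2 * n < t + (\<Sum>i\<in>UNIV. ?S i)"
  then have le: "t + (\<Sum>i\<in>UNIV. ?S i) \<le> 2 * n" by simp
  have fK: "finite (K i)" for i using K finite_subset by blast
  have Sle: "?S i \<le> (\<Sum>i\<in>UNIV. ?S i)" for i
    by (rule member_le_sum) auto
  have bit_le: "a \<le> ?S i" if "a \<in> K i" for a i
  proof -
    have "a - m i \<le> (\<Sum>a\<in>K i. a - m i)"
      using that fK by (intro member_le_sum) auto
    then show ?thesis by linarith
  qed
  obtain a0 where a0: "a0 \<in> K i0" using ne by blast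
  have "1 \<le> a0" using K a0 by (meson atLeastAtMost_iff subsetD)
  \<comment> \<open>The negated claim itself forces \<open>n > t / 2\<close>, the range in which the
    sequence provides a net.\<close>
  then have "t < 2 * n" using bit_le[OF a0] Sle[of i0] le by linarith
  then have "real n > real t / real 2" by simp
  then have net: "order_digital_net 2 t (2 * n) n E"
    using seq unfolding order_digital_seq_def by blast
  have "\<exists>f. \<forall>i. bij_betw (f i) {1..card (K i)} (K i) \<and>
      (\<forall>l l'. 1 \<le> l \<longrightarrow> l < l' \<longrightarrow> l' \<le> card (K i) \<longrightarrow> f i l' < f i l)"
    by (intro choice allI) (metis decreasing_enumeration[OF fK])
  then obtain f where f: "\<And>i. bij_betw (f i) {1..card (K i)} (K i)"
    and dec: "\<And>i l l'. \<lbrakk>1 \<le> l; l < l'; l' \<le> card (K i)\<rbrakk> \<Longrightarrow> f i l' < f i l"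
    by blast
  have fin: "f i l \<in> K i" if "l \<in> {1..card (K i)}" for i l
    using bij_betwE[OF f] that by blast
  have inj: "inj_on (f i) {1..card (K i)}" for i using f by (auto simp: bij_betw_def)
  have top: "(\<Sum>l=1..min (card (K i)) 2. f i l) \<le> ?S i" for i
  proof -
    let ?A = "{1..min (card (K i)) 2}"
    have "(\<Sum>l\<in>?A. f i l) \<le> (\<Sum>l\<in>?A. m i + (f i l - m i))"
      by (intro sum_mono) simp
    also have "\<dots> = card ?A * m i + (\<Sum>l\<in>?A. f i l - m i)"
      by (simp add: sum.distrib)
    also have "(\<Sum>l\<in>?A. f i l - m i) = (\<Sum>a\<in>f i ` ?A. a - m i)"
      by (subst sum.reindex) (auto intro: inj_on_subset[OF inj])
    also have "\<dots> \<le> (\<Sum>a\<in>K i. a - m i)"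
      using fK fin by (intro sum_mono2) auto
    also have "card ?A * m i \<le> 2 * m i" by simp
    finally show ?thesis by simp
  qed
  have lin: "lin_indep_family n (SIGMA i:UNIV. {1..card (K i)}) (\<lambda>(i, l). E i (f i l))"
  proof -
    have c1: "\<forall>j. \<forall>l\<in>{1..card (K j)}. 1 \<le> f j l \<and> f j l \<le> 2 * n"
    proof (intro allI ballI conjI)
      fix j l assume l: "l \<in> {1..card (K j)}"
      show "1 \<le> f j l" using fin[OF l] K by (meson atLeastAtMost_iff subsetD)
      show "f j l \<le> 2 * n" using bit_le[OF fin[OF l]] Sle[of j] le by linarith
    qed
    have c2: "\<forall>j. \<forall>l\<in>{1..card (K j)}. \<forall>l'\<in>{1..card (K j)}. l < l' \<longrightarrow> f j l' < f j l"
      using dec by auto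
    have "(\<Sum>j\<in>UNIV. \<Sum>l=1..min (card (K j)) 2. f j l) \<le> (\<Sum>i\<in>UNIV. ?S i)"
      by (intro sum_mono top)
    then have c3: "(\<Sum>j\<in>UNIV. \<Sum>l=1..min (card (K j)) 2. f j l) \<le> 2 * n - t"
      using le by linarith
    have "\<forall>(\<nu> :: 'd \<Rightarrow> nat) (i :: 'd \<Rightarrow> nat \<Rightarrow> nat).
        (\<forall>j. \<forall>l\<in>{1..\<nu> j}. 1 \<le> i j l \<and> i j l \<le> 2 * n) \<and>
        (\<forall>j. \<forall>l\<in>{1..\<nu> j}. \<forall>l'\<in>{1..\<nu> j}. l < l' \<longrightarrow> i j l' < i j l) \<and>
        (\<Sum>j\<in>UNIV. \<Sum>l=1..min (\<nu> j) 2. i j l) \<le> 2 * n - t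
        \<longrightarrow> lin_indep_family n (SIGMA j:UNIV. {1..\<nu> j}) (\<lambda>(j, l). E j (i j l))"
      using net unfolding order_digital_net_def by (elim conjE)
    from this[rule_format, of "\<lambda>i. card (K i)" f] c1 c2 c3 show ?thesis by blast
  qed
  have "(\<Sum>(i, l)\<in>(SIGMA i:UNIV. {1..card (K i)}). 1 * (case (i, l) of (i, l) \<Rightarrow> E i (f i l)) col) = 0"
    if "col \<in> {1..n}" for col
  proof -
    have "(\<Sum>(i, l)\<in>(SIGMA i:UNIV. {1..card (K i)}). 1 * (case (i, l) of (i, l) \<Rightarrow> E i (f i l)) col) =
      (\<Sum>i\<in>UNIV. \<Sum>l=1..card (K i). E i (f i l) col)"
      by (subst sum.Sigma, simp, simp, rule sum.cong) (auto simp only: mult_1 split: prod.splits)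
    also have "\<dots> = (\<Sum>i\<in>UNIV. \<Sum>b\<in>K i. E i b col)"
      by (intro sum.cong refl sum.reindex_bij_betw[OF f])
    finally show ?thesis using dual that by (simp add: dual_def)
  qed
  then have "\<forall>col\<in>{1..n}. (\<Sum>a\<in>(SIGMA i:UNIV. {1..card (K i)}). 1 * (case a of (i, l) \<Rightarrow> E i (f i l)) col) = 0"
    by (simp add: case_prod_beta)
  \<comment> \<open>Duality says that the combination with all coefficients 1 vanishes.\<close>
  with lin have "\<forall>a\<in>(SIGMA i:UNIV. {1..card (K i)}). (1::bit) = 0"
    unfolding lin_indep_family_def by (elim allE[of _ "\<lambda>_. 1"]) simp
  moreover have "(i0, 1) \<in> (SIGMA i:UNIV. {1..card (K i)})"
    using ne fK by (simp add: Suc_le_eq card_gt_0_iff)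
  ultimately show False by auto
qed

text \<open>The dual is a vector space over the field with two elements, and symmetric difference is
  its addition: common rows cancel in pairs.\<close>

lemma dual_symm_diff:
  assumes "dual E n K" "dual E n K'" and fin: "\<And>i. finite (K i)" "\<And>i. finite (K' i)"
  shows "dual E n (\<lambda>i. (K i - K' i) \<union> (K' i - K i))"
  unfolding dual_def
proof
  fix l assume l: "l \<in> {1..n}"
  have s2: "(x + z) + (y + z) = x + y" for x y z :: bit by (cases x; cases y; cases z) auto
  have "(\<Sum>b\<in>(K i - K' i) \<union> (K' i - K i). E i b l) = (\<Sum>b\<in>K i. E i b l) + (\<Sum>b\<in>K' i. E i b l)" for i
  proof -
    have 1: "(\<Sum>b\<in>K i. E i b l) = (\<Sum>b\<in>K i - K' i. E i b l) + (\<Sum>b\<in>K i \<inter> K' i. E i b l)"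
      using fin by (metis add.commute sum.Int_Diff)
    have 2: "(\<Sum>b\<in>K' i. E i b l) = (\<Sum>b\<in>K' i - K i. E i b l) + (\<Sum>b\<in>K i \<inter> K' i. E i b l)"
      using fin by (metis add.commute sum.Int_Diff Int_commute)
    have 3: "(\<Sum>b\<in>(K i - K' i) \<union> (K' i - K i). E i b l) = (\<Sum>b\<in>K i - K' i. E i b l) + (\<Sum>b\<in>K' i - K i. E i b l)"
      using fin by (intro sum.union_disjoint) auto
    show ?thesis unfolding 1 2 3 s2 ..
  qed
  then have "(\<Sum>i\<in>UNIV. \<Sum>b\<in>(K i - K' i) \<union> (K' i - K i). E i b l) =
      (\<Sum>i\<in>UNIV. \<Sum>b\<in>K i. E i b l) + (\<Sum>i\<in>UNIV. \<Sum>b\<in>K' i. E i b l)"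
    by (simp only: sum.distrib)
  then show "(\<Sum>i\<in>UNIV. \<Sum>b\<in>(K i - K' i) \<union> (K' i - K i). E i b l) = 0"
    using assms(1,2) l by (simp add: dual_def)
qed

definition dual_sets :: "('d::finite \<Rightarrow> nat \<Rightarrow> nat \<Rightarrow> bit) \<Rightarrow> nat \<Rightarrow> nat \<Rightarrow> ('d \<Rightarrow> nat set) set" where
  "dual_sets E n B = {K. (\<forall>i. K i \<subseteq> {1..B}) \<and> dual E n K}"

lemma PiE_UNIV: "PiE UNIV A = {K. \<forall>i. K i \<in> A i}"
  by (auto simp: PiE_def)

lemma finite_dual_sets: "finite (dual_sets E n B)"
proof -
  have "dual_sets E n B \<subseteq> PiE UNIV (\<lambda>_. Pow {1..B})"
    by (auto simp: PiE_UNIV dual_sets_def)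
  then show ?thesis by (rule finite_subset) (auto intro: finite_PiE)
qed

text \<open>By linear independence, a dual set is determined by its bits beyond the levels \<open>lev i\<close>.\<close>

lemma dual_sum_bound:
  fixes E :: "'d::finite \<Rightarrow> nat \<Rightarrow> nat \<Rightarrow> bit" and w :: "'d \<Rightarrow> nat \<Rightarrow> real"
  assumes seq: "order_digital_seq 2 t E"
    and lev: "t + 2 * (\<Sum>i\<in>UNIV. lev i) \<le> 2 * n \<or> (\<forall>i. lev i = 0)"
    and w: "\<And>i a. 0 \<le> w i a" "\<And>i a. a \<le> lev i \<Longrightarrow> w i a \<le> 1"
  shows "(\<Sum>K\<in>dual_sets E n B. \<Prod>i\<in>UNIV. \<Prod>a\<in>K i. w i a) \<le> (\<Prod>i\<in>UNIV. \<Prod>a\<in>{lev i<..B}. 1 + w i a)"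
proof -
  let ?D = "dual_sets E n B"
  define up where "up = (\<lambda>K i. K i \<inter> {lev i<..} :: nat set)"
  have fK: "finite (K i)" if "K \<in> ?D" for K i
    using that finite_subset[of "K i" "{1..B}"] by (auto simp: dual_sets_def)
  \<comment> \<open>Two dual families with the same high bits differ by a nonempty dual family of
    low bits. \<open>dual_large\<close> with \<open>m = lev\<close> excludes it if the levels are
    small; if all levels are 0, there are no low bits at all.\<close>
  have inj: "inj_on up ?D"
  proof (rule inj_onI, rule ccontr)
    fix K K' assume K: "K \<in> ?D" "K' \<in> ?D" and eq: "up K = up K'" and "K \<noteq> K'"
    define S where "S = (\<lambda>i. (K i - K' i) \<union> (K' i - K i))"
    have S: "S i \<subseteq> {1..B}" for i using K by (auto simp: S_def dual_sets_def)
    have Slev: "a \<le> lev i" if "a \<in> S i" for a i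
    proof (rule ccontr)
      assume "\<not> a \<le> lev i"
      moreover have "a \<in> up K i \<longleftrightarrow> a \<in> up K' i"
        unfolding eq ..
      ultimately have "a \<in> K i \<longleftrightarrow> a \<in> K' i" by (simp add: up_def)
      then show False using that by (auto simp: S_def)
    qed
    have dS: "dual E n S" unfolding S_def
      using K fK by (intro dual_symm_diff) (auto simp: dual_sets_def)
    obtain i0 where i0: "S i0 \<noteq> {}"
    proof -
      obtain i where "K i \<noteq> K' i" using \<open>K \<noteq> K'\<close> by (metis ext)
      then have "S i \<noteq> {}" by (auto simp: S_def)
      then show ?thesis using that by blast
    qed
    have "2 * n < t + (\<Sum>i\<in>UNIV. 2 * lev i + (\<Sum>a\<in>S i. a - lev i))"
      by (rule dual_large[OF seq S dS i0])
    moreover have "(\<Sum>a\<in>S i. a - lev i) = 0" for i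
      using Slev by (intro sum.neutral) auto
    ultimately have "2 * n < t + 2 * (\<Sum>i\<in>UNIV. lev i)"
      by (simp add: sum_distrib_left)
    with lev have "\<forall>i. lev i = 0" by auto
    moreover obtain a where "a \<in> S i0" using i0 by blast
    ultimately have "a \<le> 0" "1 \<le> a" using Slev S[of i0] by fastforce+
    then show False by simp
  qed
  have img: "up ` ?D \<subseteq> PiE UNIV (\<lambda>i. Pow {lev i<..B})"
    by (auto simp: PiE_UNIV dual_sets_def up_def) fastforce
  \<comment> \<open>Low bits have weight at most 1 and are dropped. By injectivity the sum then runs
    over distinct families of high bits and may be enlarged to all of them, where it
    factors.\<close>
  have "(\<Sum>K\<in>?D. \<Prod>i\<in>UNIV. \<Prod>a\<in>K i. w i a) \<le> (\<Sum>K\<in>?D. \<Prod>i\<in>UNIV. \<Prod>a\<in>up K i. w i a)"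
  proof (rule sum_mono, rule prod_mono, rule conjI)
    fix K i assume K: "K \<in> ?D"
    show "0 \<le> (\<Prod>a\<in>K i. w i a)" using w(1) by (intro prod_nonneg) auto
    have "(\<Prod>a\<in>K i. w i a) = (\<Prod>a\<in>up K i. w i a) * (\<Prod>a\<in>K i - {lev i<..}. w i a)"
      unfolding up_def using prod.Int_Diff[OF fK[OF K]] by blast
    also have "\<dots> \<le> (\<Prod>a\<in>up K i. w i a) * 1"
      using w by (intro mult_left_mono prod_le_1 prod_nonneg) auto
    finally show "(\<Prod>a\<in>K i. w i a) \<le> (\<Prod>a\<in>up K i. w i a)" by simp
  qed
  also have "\<dots> = (\<Sum>A\<in>up ` ?D. \<Prod>i\<in>UNIV. \<Prod>a\<in>A i. w i a)"
    using inj by (simp add: sum.reindex)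
  also have "\<dots> \<le> (\<Sum>A\<in>PiE UNIV (\<lambda>i. Pow {lev i<..B}). \<Prod>i\<in>UNIV. \<Prod>a\<in>A i. w i a)"
    using w img by (intro sum_mono2 prod_nonneg) (auto intro: finite_PiE)
  also have "\<dots> = (\<Prod>i\<in>UNIV. \<Sum>A\<in>Pow {lev i<..B}. \<Prod>a\<in>A. w i a)"
    by (rule prod_sum_PiE[symmetric]) auto
  also have "\<dots> = (\<Prod>i\<in>UNIV. \<Prod>a\<in>{lev i<..B}. 1 + w i a)"
    by (simp add: sum_Pow_prod)
  finally show ?thesis .
qed


section \<open>Sums over digitally shifted blocks\<close>

definition digit_set :: "('d \<Rightarrow> nat \<Rightarrow> nat \<Rightarrow> bit) \<Rightarrow> nat \<Rightarrow> nat \<Rightarrow> 'd \<Rightarrow> nat set" where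
  "digit_set E B k i = {b \<in> {1..B}. digital_digit (E i) k b = 1}"

text \<open>Here the triangular shape of the matrices enters: \<open>k\<close> has at most
  \<open>k\<close> binary digits, so no digit of the point beyond the \<open>2 * k\<close>-th is
  set, and a finite precision \<open>B\<close> represents the point exactly.\<close>

lemma digital_seq_bitval:
  assumes E: "\<And>i l k. \<lbrakk>1 \<le> l; 2 * l < k\<rbrakk> \<Longrightarrow> E i k l = 0" and B: "2 * k \<le> B"
  shows "digital_seq E k $ i = bitval (digit_set E B k i)"
proof -
  let ?x = "\<lambda>b. digital_digit (E i) k b"
  have z: "?x b = 0" if "b > B" for b
  proof -
    have "E i b l * binary_vec k l = 0" if "l \<in> {1..k}" for l
      using E[of l b i] that \<open>b > B\<close> B by auto
    then show ?thesis unfolding digital_digit_def by (rule sum.neutral[rule_format])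
  qed
  have "digital_seq E k $ i = (\<Sum>j. of_bit (?x (Suc j)) / 2 ^ Suc j)"
    by (simp add: digital_seq_def)
  also have "\<dots> = (\<Sum>j<B. of_bit (?x (Suc j)) / 2 ^ Suc j)"
    by (rule suminf_finite) (auto simp: z)
  also have "\<dots> = (\<Sum>b=1..B. of_bit (?x b) / 2 ^ b)"
    by (simp add: sum.atLeast1_atMost_eq)
  also have "\<dots> = (\<Sum>b\<in>{1..B}. if ?x b = 1 then 1 / 2 ^ b else 0)"
    by (intro sum.cong refl) (simp split: bit.split)
  also have "\<dots> = (\<Sum>b\<in>digit_set E B k i. 1 / 2 ^ b)"
    by (subst sum.inter_filter[symmetric]) (auto simp: digit_set_def)
  finally show ?thesis by (simp add: bitval_def)
qed

text \<open>Each factor is expanded by \<open>walsh_inversion\<close> and the product multiplied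
  out; only the inner character sums still depend on the points.\<close>

lemma block_sum_expand:
  fixes v :: "'d::finite \<Rightarrow> real \<Rightarrow> complex"
  shows "(\<Sum>c<2 ^ n. \<Prod>i\<in>UNIV. v i (bitval (digit_set E B (a * 2 ^ n + c) i))) =
    (\<Sum>K\<in>{K. \<forall>i. K i \<subseteq> {1..B}}. (\<Prod>i\<in>UNIV. walsh_coeff (v i) B (K i)) *
       (\<Sum>c<2 ^ n. \<Prod>i\<in>UNIV. \<Prod>b\<in>K i. bit_sign (digital_digit (E i) (a * 2 ^ n + c) b)))"
proof -
  let ?X = "\<lambda>c i. digit_set E B (a * 2 ^ n + c) i"
  let ?\<K> = "{K :: 'd \<Rightarrow> nat set. \<forall>i. K i \<subseteq> {1..B}}"
  have K: "?\<K> = PiE UNIV (\<lambda>_. Pow {1..B})" by (simp add: PiE_UNIV)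
  have "(\<Prod>i\<in>UNIV. v i (bitval (?X c i))) =
     (\<Sum>K\<in>?\<K>. (\<Prod>i\<in>UNIV. walsh_coeff (v i) B (K i)) *
        (\<Prod>i\<in>UNIV. \<Prod>b\<in>K i. bit_sign (digital_digit (E i) (a * 2 ^ n + c) b)))" for c
  proof -
    have "(\<Prod>i\<in>UNIV. v i (bitval (?X c i))) =
        (\<Prod>i\<in>UNIV. \<Sum>K\<in>Pow {1..B}. walsh_coeff (v i) B K * walsh K (?X c i))"
      by (intro prod.cong refl walsh_inversion) (auto simp: digit_set_def)
    also have "\<dots> = (\<Sum>K\<in>?\<K>. \<Prod>i\<in>UNIV. walsh_coeff (v i) B (K i) * walsh (K i) (?X c i))"
      unfolding K by (rule prod_sum_PiE) auto
    also have "\<dots> = (\<Sum>K\<in>?\<K>. (\<Prod>i\<in>UNIV. walsh_coeff (v i) B (K i)) *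
        (\<Prod>i\<in>UNIV. \<Prod>b\<in>K i. bit_sign (digital_digit (E i) (a * 2 ^ n + c) b)))"
    proof (intro sum.cong refl)
      fix K assume K: "K \<in> ?\<K>"
      have "walsh (K i) (?X c i) = (\<Prod>b\<in>K i. bit_sign (digital_digit (E i) (a * 2 ^ n + c) b))" for i
      proof -
        have Ki: "K i \<subseteq> {1..B}" using K by simp
        then have "finite (K i)" using finite_subset by blast
        then show ?thesis using Ki
          by (subst walsh_prod, simp) (intro prod.cong, auto simp: bit_sign_def digit_set_def)
      qed
      then show "(\<Prod>i\<in>UNIV. walsh_coeff (v i) B (K i) * walsh (K i) (?X c i)) =
         (\<Prod>i\<in>UNIV. walsh_coeff (v i) B (K i)) *
        (\<Prod>i\<in>UNIV. \<Prod>b\<in>K i. bit_sign (digital_digit (E i) (a * 2 ^ n + c) b))"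
        by (simp add: prod.distrib)
    qed
    finally show ?thesis .
  qed
  then show ?thesis
    by (simp only: sum_distrib_left) (rule sum.swap)
qed

lemma finite_bit_families: "finite {K :: 'd::finite \<Rightarrow> nat set. \<forall>i. K i \<subseteq> {1..B}}"
proof -
  have "{K :: 'd \<Rightarrow> nat set. \<forall>i. K i \<subseteq> {1..B}} = PiE UNIV (\<lambda>_. Pow {1..B})" by (simp add: PiE_UNIV)
  then show ?thesis by (simp add: finite_PiE)
qed

lemma norm_dual_expand_le:
  assumes "\<K> \<subseteq> {K. \<forall>i. K i \<subseteq> {1..B}}"
  shows "norm (\<Sum>K\<in>\<K>. (\<Prod>i\<in>UNIV. walsh_coeff (v i) B (K i)) *
       (\<Sum>c<2 ^ n. \<Prod>i\<in>UNIV. \<Prod>b\<in>K i. bit_sign (digital_digit (E i) (a * 2 ^ n + c) b)))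
    \<le> 2 ^ n * (\<Sum>K\<in>\<K> \<inter> dual_sets E n B. \<Prod>i\<in>UNIV. norm (walsh_coeff (v i) B (K i)))"
proof -
  have fin: "finite \<K>" using assms finite_bit_families finite_subset by blast
  have "norm (\<Sum>K\<in>\<K>. (\<Prod>i\<in>UNIV. walsh_coeff (v i) B (K i)) *
       (\<Sum>c<2 ^ n. \<Prod>i\<in>UNIV. \<Prod>b\<in>K i. bit_sign (digital_digit (E i) (a * 2 ^ n + c) b))) \<le>
    (\<Sum>K\<in>\<K>. (\<Prod>i\<in>UNIV. norm (walsh_coeff (v i) B (K i))) * (if dual E n K then 2 ^ n else 0))"
    by (rule order_trans[OF norm_sum]) (simp only: norm_mult norm_block_char_sum prod_norm order_refl)
  also have "\<dots> = (\<Sum>K\<in>\<K>. if K \<in> dual_sets E n B then 2 ^ n * (\<Prod>i\<in>UNIV. norm (walsh_coeff (v i) B (K i))) else 0)"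
    using assms by (intro sum.cong refl) (auto simp: dual_sets_def)
  also have "\<dots> = 2 ^ n * (\<Sum>K\<in>\<K> \<inter> dual_sets E n B. \<Prod>i\<in>UNIV. norm (walsh_coeff (v i) B (K i)))"
    unfolding sum.inter_restrict[OF fin] sum_distrib_left by (intro sum.cong) auto
  finally show ?thesis .
qed

lemma norm_block_sum_le:
  fixes v :: "'d::finite \<Rightarrow> real \<Rightarrow> complex"
  shows "norm (\<Sum>c<2 ^ n. \<Prod>i\<in>UNIV. v i (bitval (digit_set E B (a * 2 ^ n + c) i))) \<le>
    2 ^ n * (\<Sum>K\<in>dual_sets E n B. \<Prod>i\<in>UNIV. norm (walsh_coeff (v i) B (K i)))"
proof -
  have "{K. \<forall>i. K i \<subseteq> {1..B}} \<inter> dual_sets E n B = dual_sets E n B"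
    by (auto simp: dual_sets_def)
  then show ?thesis
    unfolding block_sum_expand using norm_dual_expand_le[OF order_refl, where v = v and B = B and n = n and E = E and a = a] by simp
qed

text \<open>The family of empty sets is the constant Walsh function, with character sum
  \<open>2 ^ n\<close>; its term is the one subtracted.\<close>

lemma norm_block_error_le:
  fixes v :: "'d::finite \<Rightarrow> real \<Rightarrow> complex"
  shows "norm ((\<Sum>c<2 ^ n. \<Prod>i\<in>UNIV. v i (bitval (digit_set E B (a * 2 ^ n + c) i)))
      - 2 ^ n * (\<Prod>i\<in>UNIV. walsh_coeff (v i) B {})) \<le>
    2 ^ n * (\<Sum>K\<in>dual_sets E n B - {\<lambda>_. {}}. \<Prod>i\<in>UNIV. norm (walsh_coeff (v i) B (K i)))"
proof -
  let ?\<K> = "{K :: 'd \<Rightarrow> nat set. \<forall>i. K i \<subseteq> {1..B}}"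
  let ?T = "\<lambda>K. (\<Prod>i\<in>UNIV. walsh_coeff (v i) B (K i)) *
       (\<Sum>c<2 ^ n. \<Prod>i\<in>UNIV. \<Prod>b\<in>K i. bit_sign (digital_digit (E i) (a * 2 ^ n + c) b))"
  have "(\<Sum>K\<in>?\<K>. ?T K) = ?T (\<lambda>_. {}) + (\<Sum>K\<in>?\<K> - {\<lambda>_. {}}. ?T K)"
    by (rule sum.remove[OF finite_bit_families]) auto
  then have "(\<Sum>c<2 ^ n. \<Prod>i\<in>UNIV. v i (bitval (digit_set E B (a * 2 ^ n + c) i)))
      - 2 ^ n * (\<Prod>i\<in>UNIV. walsh_coeff (v i) B {}) = (\<Sum>K\<in>?\<K> - {\<lambda>_. {}}. ?T K)"
    unfolding block_sum_expand by simp
  moreover have "(?\<K> - {\<lambda>_. {}}) \<inter> dual_sets E n B = dual_sets E n B - {\<lambda>_. {}}"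
    by (auto simp: dual_sets_def)
  ultimately show ?thesis
    using norm_dual_expand_le[of "?\<K> - {\<lambda>_. {}}" B, where v = v and n = n and E = E and a = a] by auto
qed

text \<open>Compared with \<^const>\<open>bit_weight\<close>, a factor \<open>2 powr (3/4 * (a - m))\<close> has been spent.\<close>

definition soft_weight :: "nat \<Rightarrow> nat \<Rightarrow> real" where
  "soft_weight m a = (if a \<le> m then 1 else 32 * (2 powr (- 1/4)) ^ (a - m))"

text \<open>8 is the 4 of \<open>walsh_coeff_bound\<close> times the mean 2 of the kernels. The
  exponential bounds the product of \<open>1 + 32 * q ^ u\<close> for
  \<open>q = 2 powr (- 1/4)\<close>.\<close>

definition walsh_const :: real where
  "walsh_const = 8 * exp (32 / (1 - 2 powr (- 1/4)))"

lemma soft_weight_eq: "bit_weight m a * 2 powr (3/4 * real (a - m)) = soft_weight m a"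
proof (cases "a \<le> m")
  case False
  then obtain u where a: "a = m + u" using less_imp_le nat_le_iff_add by (metis linear)
  have "32 * 2 ^ m / 2 ^ a * 2 powr (3/4 * real u) = 32 * (2 powr (- real u) * 2 powr (3/4 * real u))"
    by (simp add: a power_add powr_minus powr_realpow divide_simps)
  also have "\<dots> = 32 * (2 powr (- 1/4)) ^ u"
    by (simp flip: powr_add powr_realpow) (simp add: powr_powr)
  finally show ?thesis using False a by (simp add: bit_weight_def soft_weight_def)
qed (simp add: bit_weight_def soft_weight_def)

lemma bit_weight_nonneg: "0 \<le> bit_weight m a"
  by (simp add: bit_weight_def)

lemma soft_weight_nonneg: "0 \<le> soft_weight m a"
  by (simp add: soft_weight_def)

lemma bit_weight_le_soft: "bit_weight m a \<le> soft_weight m a"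
  unfolding soft_weight_eq[symmetric]
  using mult_left_mono[OF ge_one_powr_ge_zero[of 2 "3/4 * real (a - m)"] bit_weight_nonneg[of m a]]
  by simp

lemma prod_geometric_le:
  fixes q c :: real
  assumes "0 \<le> q" "q < 1" "0 \<le> c"
  shows "(\<Prod>a\<in>{m<..B}. 1 + c * q ^ (a - m)) \<le> exp (c / (1 - q))"
proof -
  have "(\<Sum>a\<in>{m<..B}. q ^ (a - m)) = (\<Sum>u\<in>{1..B - m}. q ^ u)"
    by (rule sum.reindex_bij_witness[where i = "\<lambda>u. u + m" and j = "\<lambda>a. a - m"]) auto
  also have "\<dots> \<le> (\<Sum>u. q ^ u)"
    using assms by (intro sum_le_suminf summable_geometric) auto
  also have "\<dots> = 1 / (1 - q)"
    using assms by (intro suminf_geometric) auto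
  finally have S: "(\<Sum>a\<in>{m<..B}. q ^ (a - m)) \<le> 1 / (1 - q)" .
  have "(\<Prod>a\<in>{m<..B}. 1 + c * q ^ (a - m)) \<le> (\<Prod>a\<in>{m<..B}. exp (c * q ^ (a - m)))"
    using assms by (intro prod_mono conjI exp_ge_add_one_self) auto
  also have "\<dots> = exp (c * (\<Sum>a\<in>{m<..B}. q ^ (a - m)))"
    by (simp add: exp_sum sum_distrib_left)
  also have "\<dots> \<le> exp (c * (1 / (1 - q)))"
    using S assms by (simp add: mult_left_mono del: times_divide_eq_right)
  finally show ?thesis by simp
qed

text \<open>Bits in \<open>{l<..m}\<close> have weight 1 and cost a factor 2 each; the bits beyond
  \<open>m\<close> give a product bounded by a geometric series.\<close>

lemma prod_soft_weight_le:
  assumes "l \<le> m"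
  shows "(\<Prod>a\<in>{l<..B}. 1 + soft_weight m a) \<le> 2 ^ (m - l) * exp (32 / (1 - 2 powr (- 1/4)))"
proof -
  let ?q = "2 powr (- 1/4) :: real"
  have q: "0 \<le> ?q" "?q < 1" using powr_less_mono[of "-1/4" 0 "2::real"] by auto
  have "(\<Prod>a\<in>{l<..B}. 1 + soft_weight m a) \<le> (\<Prod>a\<in>{l<..m} \<union> {m<..B}. 1 + soft_weight m a)"
    by (intro prod_mono2) (auto intro: add_nonneg_nonneg soft_weight_nonneg simp: soft_weight_nonneg)
  also have "\<dots> = (\<Prod>a\<in>{l<..m}. 1 + soft_weight m a) * (\<Prod>a\<in>{m<..B}. 1 + soft_weight m a)"
    by (rule prod.union_disjoint) auto
  also have "(\<Prod>a\<in>{l<..m}. 1 + soft_weight m a) = (\<Prod>a\<in>{l<..m}. 2)"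
    by (intro prod.cong) (auto simp: soft_weight_def)
  also have "\<dots> = 2 ^ (m - l)" by simp
  also have "(\<Prod>a\<in>{m<..B}. 1 + soft_weight m a) = (\<Prod>a\<in>{m<..B}. 1 + 32 * ?q ^ (a - m))"
    by (intro prod.cong) (auto simp: soft_weight_def)
  also have "2 ^ (m - l) * \<dots> \<le> 2 ^ (m - l) * exp (32 / (1 - ?q))"
    using q by (intro mult_left_mono prod_geometric_le) auto
  finally show ?thesis .
qed

text \<open>Supplies levels for \<open>block_sum_bound\<close>: degrees that the net cannot resolve
  are lowered to a prescribed total.\<close>

lemma bounded_composition:
  fixes m :: "'d::finite \<Rightarrow> nat"
  assumes "s \<le> (\<Sum>i\<in>UNIV. m i)"
  shows "\<exists>l. (\<forall>i. l i \<le> m i) \<and> (\<Sum>i\<in>UNIV. l i) = s"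
  using assms
proof (induction s)
  case 0
  show ?case by (intro exI[of _ "\<lambda>_. 0"]) auto
next
  case (Suc s)
  then obtain l where l: "\<forall>i. l i \<le> m i" "(\<Sum>i\<in>UNIV. l i) = s" by auto
  have "\<exists>i. l i < m i"
  proof (rule ccontr)
    assume "\<not> (\<exists>i. l i < m i)"
    then have "(\<Sum>i\<in>UNIV. m i) \<le> (\<Sum>i\<in>UNIV. l i)" by (intro sum_mono) (auto simp: not_less)
    then show False using l Suc.prems by simp
  qed
  then obtain i where i: "l i < m i" by blast
  have "(\<Sum>k\<in>UNIV. (l(i := Suc (l i))) k) = Suc s"
    using l(2) by (subst sum.remove[of _ i]) (auto simp: sum.remove[of UNIV i l])
  then show ?case using l i by (intro exI[of _ "l(i := Suc (l i))"]) auto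
qed

lemma prod_walsh_coeff_le:
  fixes v :: "'d::finite \<Rightarrow> real \<Rightarrow> complex"
  assumes "\<And>i. m i \<le> B" "\<And>i. band (2 ^ m i) (v i)" "\<And>i. grid_bound (m i) (v i) 2"
    "\<And>i. K i \<subseteq> {1..B}"
  shows "(\<Prod>i\<in>UNIV. norm (walsh_coeff (v i) B (K i))) \<le>
    8 ^ CARD('d) * (\<Prod>i\<in>UNIV. \<Prod>a\<in>K i. bit_weight (m i) a)"
proof -
  have "(\<Prod>i\<in>UNIV. norm (walsh_coeff (v i) B (K i))) \<le>
      (\<Prod>i\<in>UNIV. (4 * 2) * (\<Prod>a\<in>K i. bit_weight (m i) a))"
    by (intro prod_mono conjI walsh_coeff_bound assms) auto
  then show ?thesis by (simp add: prod.distrib)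
qed

text \<open>If \<open>2 ^ n\<close> points are too few for the degrees \<open>m\<close>, a dual
  family is determined only by its bits beyond lower levels \<open>l\<close>. Each of the missing
  \<open>?s - ?M\<close> bits at most doubles the sum.\<close>

lemma block_sum_bound:
  fixes v :: "'d::finite \<Rightarrow> real \<Rightarrow> complex" and m :: "'d \<Rightarrow> nat"
  assumes seq: "order_digital_seq 2 t E"
    and v: "\<And>i. m i \<le> B" "\<And>i. band (2 ^ m i) (v i)" "\<And>i. grid_bound (m i) (v i) 2"
  shows "norm (\<Sum>c<2 ^ n. \<Prod>i\<in>UNIV. v i (bitval (digit_set E B (a * 2 ^ n + c) i))) \<le>
    2 ^ n * walsh_const ^ CARD('d) * 2 ^ ((\<Sum>i\<in>UNIV. m i) - (n - (t + 1) div 2))"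
proof -
  let ?s = "\<Sum>i\<in>UNIV. m i" and ?M = "n - (t + 1) div 2"
  let ?e = "exp (32 / (1 - 2 powr (- 1/4))) :: real"
  obtain l where l: "\<And>i. l i \<le> m i" "(\<Sum>i\<in>UNIV. l i) = min ?s ?M"
    using bounded_composition[of "min ?s ?M" m] by auto
  \<comment> \<open>For \<open>n\<close> below half of \<open>t\<close> truncated subtraction makes
    \<open>?M\<close> zero, which is the second alternative of
    \<open>dual_sum_bound\<close>.\<close>
  have lev: "t + 2 * (\<Sum>i\<in>UNIV. l i) \<le> 2 * n \<or> (\<forall>i. l i = 0)"
  proof (cases "(t + 1) div 2 \<le> n")
    case True
    then have "t + 2 * ?M \<le> 2 * n" by linarith
    then show ?thesis unfolding l(2) by (meson add_left_mono min.cobounded2 mult_le_mono2 order_trans)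
  next
    case False
    then have "(\<Sum>i\<in>UNIV. l i) = 0" using l(2) by simp
    then show ?thesis by simp
  qed
  have "(\<Sum>K\<in>dual_sets E n B. \<Prod>i\<in>UNIV. norm (walsh_coeff (v i) B (K i))) \<le>
      (\<Sum>K\<in>dual_sets E n B. 8 ^ CARD('d) * (\<Prod>i\<in>UNIV. \<Prod>a\<in>K i. soft_weight (m i) a))"
  proof (intro sum_mono)
    fix K assume "K \<in> dual_sets E n B"
    then have "(\<Prod>i\<in>UNIV. norm (walsh_coeff (v i) B (K i))) \<le>
       8 ^ CARD('d) * (\<Prod>i\<in>UNIV. \<Prod>a\<in>K i. bit_weight (m i) a)"
      using v by (intro prod_walsh_coeff_le) (auto simp: dual_sets_def)
    also have "\<dots> \<le> 8 ^ CARD('d) * (\<Prod>i\<in>UNIV. \<Prod>a\<in>K i. soft_weight (m i) a)"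
      by (intro mult_left_mono prod_mono conjI prod_nonneg bit_weight_le_soft) (auto simp: bit_weight_nonneg)
    finally show "(\<Prod>i\<in>UNIV. norm (walsh_coeff (v i) B (K i))) \<le> 
       8 ^ CARD('d) * (\<Prod>i\<in>UNIV. \<Prod>a\<in>K i. soft_weight (m i) a)" .
  qed
  also have "\<dots> = 8 ^ CARD('d) * (\<Sum>K\<in>dual_sets E n B. \<Prod>i\<in>UNIV. \<Prod>a\<in>K i. soft_weight (m i) a)"
    by (simp add: sum_distrib_left)
  also have "\<dots> \<le> 8 ^ CARD('d) * (\<Prod>i\<in>UNIV. \<Prod>a\<in>{l i<..B}. 1 + soft_weight (m i) a)"
    using l(1) by (intro mult_left_mono dual_sum_bound[OF seq lev] soft_weight_nonneg)
      (auto simp: soft_weight_def intro: order_trans)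
  also have "\<dots> \<le> 8 ^ CARD('d) * (\<Prod>i\<in>UNIV. 2 ^ (m i - l i) * ?e)"
    using l(1) by (intro mult_left_mono prod_mono conjI prod_soft_weight_le prod_nonneg)
      (auto intro!: add_nonneg_nonneg simp: soft_weight_nonneg)
  also have "\<dots> = walsh_const ^ CARD('d) * 2 ^ (\<Sum>i\<in>UNIV. m i - l i)"
    by (simp add: prod.distrib walsh_const_def power_mult_distrib power_sum)
  also have "(\<Sum>i\<in>UNIV. m i - l i) = ?s - ?M"
    using l by (subst sum_subtractf_nat) (auto simp: min_def)
  finally have "(\<Sum>K\<in>dual_sets E n B. \<Prod>i\<in>UNIV. norm (walsh_coeff (v i) B (K i))) \<le>
      walsh_const ^ CARD('d) * 2 ^ (?s - ?M)" .
  then have "2 ^ n * (\<Sum>K\<in>dual_sets E n B. \<Prod>i\<in>UNIV. norm (walsh_coeff (v i) B (K i))) \<le>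
      2 ^ n * (walsh_const ^ CARD('d) * 2 ^ (?s - ?M))"
    by (rule mult_left_mono) simp
  then show ?thesis
    using norm_block_sum_le[where v = v and B = B and n = n and E = E and a = a] by (simp only: mult.assoc)
qed

text \<open>A nonempty dual family has total excess \<open>?u\<close> above
  \<open>2 * n - t - 2 * ?s\<close> by \<open>dual_large\<close>. Three quarters of its decay are
  extracted as the common factor \<open>p\<close>; the rest is summed by
  \<open>dual_sum_bound\<close> with \<open>lev = m\<close>.\<close>

lemma block_error_bound:
  fixes v :: "'d::finite \<Rightarrow> real \<Rightarrow> complex" and m :: "'d \<Rightarrow> nat"
  assumes seq: "order_digital_seq 2 t E"
    and v: "\<And>i. m i \<le> B" "\<And>i. band (2 ^ m i) (v i)" "\<And>i. grid_bound (m i) (v i) 2"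
    and n: "t + 2 * (\<Sum>i\<in>UNIV. m i) \<le> 2 * n"
  shows "norm ((\<Sum>c<2 ^ n. \<Prod>i\<in>UNIV. v i (bitval (digit_set E B (a * 2 ^ n + c) i)))
      - 2 ^ n * (\<Prod>i\<in>UNIV. walsh_coeff (v i) B {})) \<le>
    2 ^ n * walsh_const ^ CARD('d) * 2 powr (- 3/4 * (2 * real n - real t - 2 * real (\<Sum>i\<in>UNIV. m i)))"
proof -
  let ?s = "\<Sum>i\<in>UNIV. m i"
  let ?e = "exp (32 / (1 - 2 powr (- 1/4))) :: real"
  let ?D = "dual_sets E n B - {\<lambda>_. {}}"
  define p where "p = 2 powr (- 3/4 * (2 * real n - real t - 2 * real ?s))"
  have p: "p \<ge> 0" by (simp add: p_def)
  have "(\<Sum>K\<in>?D. \<Prod>i\<in>UNIV. norm (walsh_coeff (v i) B (K i))) \<le>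
      (\<Sum>K\<in>?D. 8 ^ CARD('d) * (p * (\<Prod>i\<in>UNIV. \<Prod>a\<in>K i. soft_weight (m i) a)))"
  proof (intro sum_mono)
    fix K assume K: "K \<in> ?D"
    then have "K \<noteq> (\<lambda>_. {})" by simp
    then obtain i0 where i0: "K i0 \<noteq> {}" by (metis ext)
    have KB: "K i \<subseteq> {1..B}" for i using K by (auto simp: dual_sets_def)
    have dK: "dual E n K" using K by (simp add: dual_sets_def)
    have fK: "finite (K i)" for i using KB finite_subset by blast
    let ?w = "\<Prod>i\<in>UNIV. \<Prod>a\<in>K i. bit_weight (m i) a"
    let ?u = "\<Sum>i\<in>UNIV. \<Sum>a\<in>K i. a - m i"
    have "2 * n < t + (\<Sum>i\<in>UNIV. 2 * m i + (\<Sum>a\<in>K i. a - m i))"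
      by (rule dual_large[OF seq KB dK i0])
    then have "2 * n < t + (2 * ?s + ?u)"
      by (simp add: sum.distrib sum_distrib_left)
    then have "real (2 * n) < real (t + (2 * ?s + ?u))" by (simp only: of_nat_less_iff)
    then have "0 \<le> 3/4 * real ?u + (- 3/4 * (2 * real n - real t - 2 * real ?s))" by simp
    then have "1 \<le> 2 powr (3/4 * real ?u + (- 3/4 * (2 * real n - real t - 2 * real ?s)))"
      by (intro ge_one_powr_ge_zero) auto
    also have "\<dots> = p * 2 powr (3/4 * real ?u)"
      by (simp only: powr_add p_def mult.commute)
    \<comment> \<open>Multiplying by this factor is allowed in an upper bound; it turns
      \<open>bit_weight\<close> into \<open>soft_weight\<close> at the price
      \<open>p\<close>.\<close>
    finally have one: "1 \<le> p * 2 powr (3/4 * real ?u)" .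
    have wn: "0 \<le> ?w" by (intro prod_nonneg ballI bit_weight_nonneg)
    have "(\<Prod>i\<in>UNIV. \<Prod>a\<in>K i. soft_weight (m i) a) =
        (\<Prod>i\<in>UNIV. \<Prod>a\<in>K i. bit_weight (m i) a * 2 powr (3/4 * real (a - m i)))"
      by (simp only: soft_weight_eq)
    also have "\<dots> = ?w * 2 powr (\<Sum>i\<in>UNIV. \<Sum>a\<in>K i. 3/4 * real (a - m i))"
      using fK by (simp add: prod.distrib powr_sum)
    also have "(\<Sum>i\<in>UNIV. \<Sum>a\<in>K i. 3/4 * real (a - m i)) = 3/4 * real ?u"
      by (simp add: sum_distrib_left)
    finally have soft: "(\<Prod>i\<in>UNIV. \<Prod>a\<in>K i. soft_weight (m i) a) = ?w * 2 powr (3/4 * real ?u)" .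
    have "(\<Prod>i\<in>UNIV. norm (walsh_coeff (v i) B (K i))) \<le> 8 ^ CARD('d) * (?w * 1)"
      unfolding mult_1_right using v KB by (intro prod_walsh_coeff_le) auto
    also have "\<dots> \<le> 8 ^ CARD('d) * (?w * (p * 2 powr (3/4 * real ?u)))"
      using one wn by (intro mult_left_mono) auto
    finally show "(\<Prod>i\<in>UNIV. norm (walsh_coeff (v i) B (K i))) \<le>
        8 ^ CARD('d) * (p * (\<Prod>i\<in>UNIV. \<Prod>a\<in>K i. soft_weight (m i) a))"
      unfolding soft by (simp only: mult_ac)
  qed
  also have "\<dots> \<le> (\<Sum>K\<in>dual_sets E n B. 8 ^ CARD('d) * (p * (\<Prod>i\<in>UNIV. \<Prod>a\<in>K i. soft_weight (m i) a)))"
    using p by (intro sum_mono2 finite_dual_sets mult_nonneg_nonneg prod_nonneg ballI soft_weight_nonneg) auto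
  also have "\<dots> = 8 ^ CARD('d) * p * (\<Sum>K\<in>dual_sets E n B. \<Prod>i\<in>UNIV. \<Prod>a\<in>K i. soft_weight (m i) a)"
    by (simp only: sum_distrib_left mult.assoc)
  also have "\<dots> \<le> 8 ^ CARD('d) * p * (\<Prod>i\<in>UNIV. \<Prod>a\<in>{m i<..B}. 1 + soft_weight (m i) a)"
    using p n by (intro mult_left_mono dual_sum_bound[OF seq] soft_weight_nonneg)
      (auto simp: soft_weight_def)
  also have "\<dots> \<le> 8 ^ CARD('d) * p * (\<Prod>i\<in>(UNIV :: 'd set). 2 ^ (m i - m i) * ?e)"
    using p by (intro mult_left_mono prod_mono conjI prod_soft_weight_le prod_nonneg)
      (auto intro!: add_nonneg_nonneg simp: soft_weight_nonneg)
  also have "\<dots> = walsh_const ^ CARD('d) * p"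
    by (simp add: walsh_const_def power_mult_distrib)
  finally have "(\<Sum>K\<in>?D. \<Prod>i\<in>UNIV. norm (walsh_coeff (v i) B (K i))) \<le> walsh_const ^ CARD('d) * p" .
  then have "2 ^ n * (\<Sum>K\<in>?D. \<Prod>i\<in>UNIV. norm (walsh_coeff (v i) B (K i))) \<le> 2 ^ n * (walsh_const ^ CARD('d) * p)"
    by (rule mult_left_mono) simp
  then show ?thesis
    using norm_block_error_le[where v = v and B = B and n = n and E = E and a = a] unfolding p_def by (simp only: mult.assoc)
qed


section \<open>Sampling in several dimensions\<close>

definition freq_box :: "('d::finite \<Rightarrow> nat) \<Rightarrow> (int ^ 'd) set" where
  "freq_box b = {k. \<forall>i. \<bar>k $ i\<bar> \<le> int (b i)}"

definition tpolyd :: "('d::finite \<Rightarrow> nat) \<Rightarrow> (int ^ 'd \<Rightarrow> complex) \<Rightarrow> real ^ 'd \<Rightarrow> complex" where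
  "tpolyd b a x = (\<Sum>k\<in>freq_box b. a k * (\<Prod>i\<in>UNIV. ex (of_int (k $ i) * x $ i)))"

definition grid :: "('d::finite \<Rightarrow> nat) \<Rightarrow> ('d \<Rightarrow> nat) set" where
  "grid n = PiE UNIV (\<lambda>i. {..<n i})"

definition gpt :: "('d::finite \<Rightarrow> nat) \<Rightarrow> real ^ 'd \<Rightarrow> ('d \<Rightarrow> nat) \<Rightarrow> real ^ 'd" where
  "gpt n y z = (\<chi> i. y $ i + real (z i) / real (n i))"

lemma finite_freq_box [simp]: "finite (freq_box b)"
proof -
  have "freq_box b \<subseteq> vec_lambda ` PiE UNIV (\<lambda>i. {- int (b i)..int (b i)})"
  proof
    fix k assume "k \<in> freq_box b"
    then have "($) k \<in> PiE UNIV (\<lambda>i. {- int (b i)..int (b i)})"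
      by (auto simp: freq_box_def PiE_UNIV abs_le_iff) (smt (verit))
    moreover have "k = vec_lambda (($) k)" by simp
    ultimately show "k \<in> vec_lambda ` PiE UNIV (\<lambda>i. {- int (b i)..int (b i)})" by blast
  qed
  then show ?thesis by (rule finite_subset) (auto intro!: finite_imageI finite_PiE)
qed

lemma finite_grid [simp]: "finite (grid n)"
  by (simp add: grid_def finite_PiE)

lemma card_grid: "card (grid n) = (\<Prod>i\<in>UNIV. n i)"
  by (simp add: grid_def card_PiE)

lemma sum_grid_prod:
  fixes f :: "'d::finite \<Rightarrow> nat \<Rightarrow> 'a::comm_semiring_1"
  shows "(\<Sum>z\<in>grid n. \<Prod>i\<in>UNIV. f i (z i)) = (\<Prod>i\<in>UNIV. \<Sum>z<n i. f i z)"
  unfolding grid_def by (rule prod_sum_PiE[symmetric]) auto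

lemma tpolyd_reproduce:
  fixes b :: "'d::finite \<Rightarrow> nat"
  assumes b: "\<And>i. b i > 0"
  defines "n \<equiv> \<lambda>i. 4 * b i"
  shows "of_nat (\<Prod>i\<in>UNIV. n i) * tpolyd b a x =
    (\<Sum>z\<in>grid n. tpolyd b a (gpt n y z) * (\<Prod>i\<in>UNIV. vp_kernel (b i) (x $ i - gpt n y z $ i)))"
proof -
  let ?w = "\<lambda>i z. y $ i + real z / real (n i)"
  have k: "(\<Sum>z\<in>grid n. (\<Prod>i\<in>UNIV. ex (of_int (k $ i) * ?w i (z i))) * (\<Prod>i\<in>UNIV. vp_kernel (b i) (x $ i - ?w i (z i))))
     = of_nat (\<Prod>i\<in>UNIV. n i) * (\<Prod>i\<in>UNIV. ex (of_int (k $ i) * x $ i))" if "k \<in> freq_box b" for k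
  proof -
    have "(\<Sum>z\<in>grid n. (\<Prod>i\<in>UNIV. ex (of_int (k $ i) * ?w i (z i))) * (\<Prod>i\<in>UNIV. vp_kernel (b i) (x $ i - ?w i (z i))))
      = (\<Prod>i\<in>UNIV. \<Sum>z<n i. ex (of_int (k $ i) * ?w i z) * vp_kernel (b i) (x $ i - ?w i z))"
      unfolding prod.distrib[symmetric] by (rule sum_grid_prod)
    also have "\<dots> = (\<Prod>i\<in>UNIV. of_nat (n i) * ex (of_int (k $ i) * x $ i))"
    proof (rule prod.cong[OF refl])
      fix i
      have "\<bar>k $ i\<bar> \<le> int (b i)" using that by (simp add: freq_box_def)
      then show "(\<Sum>z<n i. ex (of_int (k $ i) * ?w i z) * vp_kernel (b i) (x $ i - ?w i z)) =
          of_nat (n i) * ex (of_int (k $ i) * x $ i)"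
        unfolding n_def by (rule vp_reproduces_ex[OF b])
    qed
    finally show ?thesis by (simp add: prod.distrib)
  qed
  have "(\<Sum>z\<in>grid n. tpolyd b a (gpt n y z) * (\<Prod>i\<in>UNIV. vp_kernel (b i) (x $ i - gpt n y z $ i))) =
    (\<Sum>k\<in>freq_box b. a k * (\<Sum>z\<in>grid n. (\<Prod>i\<in>UNIV. ex (of_int (k $ i) * ?w i (z i))) * (\<Prod>i\<in>UNIV. vp_kernel (b i) (x $ i - ?w i (z i)))))"
    unfolding tpolyd_def gpt_def sum_distrib_right sum_distrib_left vec_lambda_beta
    by (subst sum.swap) (simp only: mult.assoc)
  also have "\<dots> = (\<Sum>k\<in>freq_box b. a k * (of_nat (\<Prod>i\<in>UNIV. n i) * (\<Prod>i\<in>UNIV. ex (of_int (k $ i) * x $ i))))"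
    by (intro sum.cong refl) (simp only: k)
  also have "\<dots> = of_nat (\<Prod>i\<in>UNIV. n i) * tpolyd b a x"
    unfolding tpolyd_def sum_distrib_left by (intro sum.cong refl) (simp only: mult_ac)
  finally show ?thesis by simp
qed

text \<open>A frequency survives the grid sum only if each coordinate is divisible by
  \<open>n i\<close>; in the box only 0 is.\<close>

lemma tpolyd_mean:
  fixes b :: "'d::finite \<Rightarrow> nat"
  assumes b: "\<And>i. b i < n i"
  shows "(\<Sum>z\<in>grid n. tpolyd b a (gpt n y z)) = of_nat (\<Prod>i\<in>UNIV. n i) * a 0"
proof -
  let ?w = "\<lambda>i z. y $ i + real z / real (n i)"
  have k: "(\<Sum>z\<in>grid n. \<Prod>i\<in>UNIV. ex (of_int (k $ i) * ?w i (z i))) =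
     (if k = 0 then of_nat (\<Prod>i\<in>UNIV. n i) else 0)" if "k \<in> freq_box b" for k
  proof -
    have n: "n i > 0" for i using b[of i] by simp
    have "(\<Sum>z\<in>grid n. \<Prod>i\<in>UNIV. ex (of_int (k $ i) * ?w i (z i))) =
      (\<Prod>i\<in>UNIV. \<Sum>z<n i. ex (of_int (k $ i) * ?w i z))"
      by (rule sum_grid_prod)
    also have "\<dots> = (\<Prod>i\<in>UNIV. if int (n i) dvd k $ i then of_nat (n i) * ex (of_int (k $ i) * y $ i) else 0)"
      by (simp only: sum_ex_grid_shift[OF n])
    also have "\<dots> = (\<Prod>i\<in>UNIV. if k $ i = 0 then of_nat (n i) else 0)"
    proof (rule prod.cong[OF refl])
      fix i
      have "\<bar>k $ i\<bar> < int (n i)" using that b[of i] unfolding freq_box_def by (metis (mono_tags, lifting) mem_Collect_eq of_nat_less_iff order_le_less_trans)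
      then have "int (n i) dvd k $ i \<longleftrightarrow> k $ i = 0"
        using zdvd_imp_le[of "int (n i)" "\<bar>k $ i\<bar>"] by (cases "k $ i = 0") auto
      then show "(if int (n i) dvd k $ i then of_nat (n i) * ex (of_int (k $ i) * y $ i) else 0) =
          (if k $ i = 0 then of_nat (n i) else 0)" by auto
    qed
    also have "\<dots> = (if k = 0 then of_nat (\<Prod>i\<in>UNIV. n i) else 0)"
    proof (cases "k = 0")
      case False
      then obtain i where "k $ i \<noteq> 0" by (auto simp: vec_eq_iff)
      then show ?thesis using False by (auto intro!: prod_zero)
    qed simp
    finally show ?thesis .
  qed
  have "(\<Sum>z\<in>grid n. tpolyd b a (gpt n y z)) =
     (\<Sum>k\<in>freq_box b. a k * (\<Sum>z\<in>grid n. \<Prod>i\<in>UNIV. ex (of_int (k $ i) * ?w i (z i))))"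
    unfolding tpolyd_def gpt_def sum_distrib_left vec_lambda_beta by (rule sum.swap)
  also have "\<dots> = (\<Sum>k\<in>freq_box b. if k = 0 then a 0 * of_nat (\<Prod>i\<in>UNIV. n i) else 0)"
    by (intro sum.cong refl) (simp only: k, auto)
  also have "\<dots> = a 0 * of_nat (\<Prod>i\<in>UNIV. n i)"
    by (subst sum.delta, simp, simp add: freq_box_def)
  finally show ?thesis by simp
qed

text \<open>Exactness matters: at precision \<open>B\<close> the constant Walsh coefficient of the
  kernel is 1 and not merely close to 1, so the main term of a block sum is
  \<open>2 ^ n\<close>.\<close>

lemma vp_kernel_mean:
  assumes b: "b > 0" and n: "3 * b \<le> n"
  shows "(\<Sum>z<n. vp_kernel b (y + real z / real n)) = of_nat n"
proof -
  have n0: "n > 0" using assms by simp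
  let ?w = "\<lambda>z. y + real z / real n"
  have "(\<Sum>z<n. vp_kernel b (?w z)) =
     (\<Sum>z<n. \<Sum>l'\<in>right_freqs b. \<Sum>l\<in>left_freqs b. ex (of_int (l + l') * ?w z)) / of_nat b"
    unfolding vp_kernel_def dirichlet_def tpoly_def sum_product sum_divide_distrib[symmetric]
    by (subst sum.swap) (simp only: ex_add of_int_add distrib_right mult_1)
  also have "\<dots> = (\<Sum>l'\<in>right_freqs b. \<Sum>l\<in>left_freqs b. \<Sum>z<n. ex (of_int (l + l') * ?w z)) / of_nat b"
    by (subst sum.swap, rule arg_cong2[where f = "(/)"], rule sum.cong, simp, rule sum.swap, simp)
  also have "(\<Sum>l'\<in>right_freqs b. \<Sum>l\<in>left_freqs b. \<Sum>z<n. ex (of_int (l + l') * ?w z)) =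
     (\<Sum>l'\<in>right_freqs b. of_nat n)"
  proof (rule sum.cong[OF refl])
    fix l' assume l': "l' \<in> right_freqs b"
    have dv: "int n dvd (l + l') \<longleftrightarrow> l = - l'" if "l \<in> left_freqs b" for l
    proof
      assume d: "int n dvd (l + l')"
      have "\<bar>l + l'\<bar> < int n" using that l' b n by (auto simp: left_freqs_def right_freqs_def)
      with d have "l + l' = 0"
        using zdvd_imp_le[of "int n" "\<bar>l + l'\<bar>"] by (cases "l + l' = 0") auto
      then show "l = - l'" by simp
    qed auto
    have "(\<Sum>l\<in>left_freqs b. \<Sum>z<n. ex (of_int (l + l') * ?w z)) =
        (\<Sum>l\<in>left_freqs b. if l = - l' then of_nat n else 0)"
    proof (intro sum.cong refl)
      fix l assume l: "l \<in> left_freqs b"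
      show "(\<Sum>z<n. ex (of_int (l + l') * ?w z)) = (if l = - l' then of_nat n else 0)"
        unfolding sum_ex_grid_shift[OF n0] dv[OF l] by auto
    qed
    also have "- l' \<in> left_freqs b" using l' by (auto simp: left_freqs_def right_freqs_def)
    then have "(\<Sum>l\<in>left_freqs b. if l = - l' then of_nat n else 0) = (of_nat n :: complex)"
      by (subst sum.delta) auto
    finally show "(\<Sum>l\<in>left_freqs b. \<Sum>z<n. ex (of_int (l + l') * ?w z)) = of_nat n" .
  qed
  finally show ?thesis using b by simp
qed

lemma band_sub: "band b v \<Longrightarrow> band b (\<lambda>x. v (x - s))"
  using band_shift[of b v "- s"] by simp

text \<open>The shift by 2 occurs because products from the two windows have frequencies below
  \<open>4 * 2 ^ p\<close>; the bound 2 is \<open>vp_majorant_mean\<close>.\<close>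

lemma grid_bound_vp_majorant: "grid_bound (p + 2) (\<lambda>x. complex_of_real (vp_majorant (2 ^ p) (x - s))) 2"
  unfolding grid_bound_def
proof
  fix y
  define n :: nat where "n = 4 * 2 ^ (p + 2)"
  have "(\<Sum>z<n. vp_majorant (2 ^ p) ((y - s) + real z / real n)) = 2 * real n"
    by (rule vp_majorant_mean) (auto simp: n_def)
  moreover have "norm (complex_of_real (vp_majorant (2 ^ p) (y + real z / real n - s))) =
      vp_majorant (2 ^ p) ((y - s) + real z / real n)" for z
    by (simp add: vp_majorant_nonneg algebra_simps)
  ultimately show "(\<Sum>z<4 * 2 ^ (p + 2). norm (complex_of_real (vp_majorant (2 ^ p) (y + real z / real (4 * 2 ^ (p + 2)) - s))))
    \<le> real (4 * 2 ^ (p + 2)) * 2"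
    unfolding n_def[symmetric] by simp
qed

lemma grid_bound_mono:
  assumes "grid_bound m v \<Lambda>" "\<And>x. norm (u x) \<le> norm (v x)"
  shows "grid_bound m u \<Lambda>"
  using assms unfolding grid_bound_def by (meson order_trans sum_mono)

lemma grid_bound_vp_kernel: "grid_bound (p + 2) (\<lambda>x. vp_kernel (2 ^ p) (x - s)) 2"
  by (rule grid_bound_mono[OF grid_bound_vp_majorant[of p s]])
    (simp add: vp_majorant_nonneg norm_vp_kernel_le)

lemma vp_majorant_block:
  fixes E :: "'d::finite \<Rightarrow> nat \<Rightarrow> nat \<Rightarrow> bit"
  assumes seq: "order_digital_seq 2 t E"
    and E: "\<And>i l k. \<lbrakk>1 \<le> l; 2 * l < k\<rbrakk> \<Longrightarrow> E i k l = 0"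
  shows "(\<Sum>c<2 ^ n. \<Prod>i\<in>UNIV. vp_majorant (2 ^ p i) (digital_seq E (a * 2 ^ n + c) $ i - s i)) \<le>
    2 ^ n * walsh_const ^ CARD('d) * 2 ^ ((\<Sum>i\<in>UNIV. p i + 2) - (n - (t + 1) div 2))"
proof -
  \<comment> \<open>The first summand covers all digits of the points of the block, the second keeps
    the degrees below the precision.\<close>
  define B where "B = 2 * ((a + 1) * 2 ^ n) + (\<Sum>i\<in>UNIV. p i + 2)"
  let ?v = "\<lambda>i x. complex_of_real (vp_majorant (2 ^ p i) (x - s i))"
  have mB: "p i + 2 \<le> B" for i
    using member_le_sum[of i UNIV "\<lambda>i. p i + 2"] by (simp add: B_def)
  have dig: "digital_seq E (a * 2 ^ n + c) $ i = bitval (digit_set E B (a * 2 ^ n + c) i)"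
    if "c < 2 ^ n" for c i
    by (rule digital_seq_bitval[OF E]) (use that in \<open>auto simp: B_def\<close>)
  have "complex_of_real (\<Sum>c<2 ^ n. \<Prod>i\<in>UNIV. vp_majorant (2 ^ p i) (digital_seq E (a * 2 ^ n + c) $ i - s i)) =
      (\<Sum>c<2 ^ n. \<Prod>i\<in>UNIV. ?v i (bitval (digit_set E B (a * 2 ^ n + c) i)))"
    by (simp add: dig)
  from arg_cong[OF this, of norm] have "\<bar>\<Sum>c<2 ^ n. \<Prod>i\<in>UNIV. vp_majorant (2 ^ p i) (digital_seq E (a * 2 ^ n + c) $ i - s i)\<bar> =
      norm (\<Sum>c<2 ^ n. \<Prod>i\<in>UNIV. ?v i (bitval (digit_set E B (a * 2 ^ n + c) i)))"
    by (simp only: norm_of_real)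
  also have "\<dots> \<le> 2 ^ n * walsh_const ^ CARD('d) * 2 ^ ((\<Sum>i\<in>UNIV. p i + 2) - (n - (t + 1) div 2))"
    by (intro block_sum_bound[OF seq mB] band_sub[OF band_vp_majorant] grid_bound_vp_majorant)
      (simp add: power_add)
  finally show ?thesis by simp
qed

lemma vp_kernel_block_error:
  fixes E :: "'d::finite \<Rightarrow> nat \<Rightarrow> nat \<Rightarrow> bit"
  assumes seq: "order_digital_seq 2 t E"
    and E: "\<And>i l k. \<lbrakk>1 \<le> l; 2 * l < k\<rbrakk> \<Longrightarrow> E i k l = 0"
    and n: "t + 2 * (\<Sum>i\<in>UNIV. p i + 2) \<le> 2 * n"
  shows "norm ((\<Sum>c<2 ^ n. \<Prod>i\<in>UNIV. vp_kernel (2 ^ p i) (digital_seq E (a * 2 ^ n + c) $ i - s i)) - 2 ^ n) \<le>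
    2 ^ n * walsh_const ^ CARD('d) * 2 powr (- 3/4 * (2 * real n - real t - 2 * real (\<Sum>i\<in>UNIV. p i + 2)))"
proof -
  define B where "B = 2 * ((a + 1) * 2 ^ n) + (\<Sum>i\<in>UNIV. p i + 2)"
  let ?v = "\<lambda>i x. vp_kernel (2 ^ p i) (x - s i)"
  have mB: "p i + 2 \<le> B" for i
    using member_le_sum[of i UNIV "\<lambda>i. p i + 2"] by (simp add: B_def)
  have dig: "digital_seq E (a * 2 ^ n + c) $ i = bitval (digit_set E B (a * 2 ^ n + c) i)"
    if "c < 2 ^ n" for c i
    by (rule digital_seq_bitval[OF E]) (use that in \<open>auto simp: B_def\<close>)
  have co: "walsh_coeff (?v i) B {} = 1" for i
  proof -
    have "(2::nat) ^ (p i + 2) \<le> 2 ^ B" using mB[of i] by (intro power_increasing) auto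
    then have "3 * (2::nat) ^ p i \<le> 2 ^ B" by (simp add: power_add)
    then have "(\<Sum>c<2 ^ B. vp_kernel (2 ^ p i) (- s i + real c / real (2 ^ B))) = of_nat (2 ^ B)"
      by (intro vp_kernel_mean) auto
    then show ?thesis by (simp add: walsh_coeff_empty add.commute)
  qed
  have "norm ((\<Sum>c<2 ^ n. \<Prod>i\<in>UNIV. ?v i (bitval (digit_set E B (a * 2 ^ n + c) i)))
      - 2 ^ n * (\<Prod>i\<in>(UNIV :: 'd set). walsh_coeff (?v i) B {})) \<le>
    2 ^ n * walsh_const ^ CARD('d) * 2 powr (- 3/4 * (2 * real n - real t - 2 * real (\<Sum>i\<in>UNIV. p i + 2)))"
    by (intro block_error_bound[OF seq mB] band_sub[OF band_vp_kernel] grid_bound_vp_kernel n)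
      (simp add: power_add)
  then show ?thesis by (simp add: co dig)
qed

text \<open>The \<open>p\<close>-th power mean with \<open>1 / p = \<rho>\<close>; it is the maximum if \<open>\<rho> = 0\<close>.\<close>

definition pmean_le :: "real \<Rightarrow> 'a set \<Rightarrow> ('a \<Rightarrow> real) \<Rightarrow> real \<Rightarrow> bool" where
  "pmean_le \<rho> Z A \<Lambda> \<longleftrightarrow>
     (if \<rho> = 0 then \<forall>z\<in>Z. A z \<le> \<Lambda>
      else (\<Sum>z\<in>Z. A z powr (1 / \<rho>)) \<le> real (card Z) * \<Lambda> powr (1 / \<rho>))"

lemma le_threshold:
  fixes a \<theta> P :: real
  assumes "a \<ge> 0" "\<theta> > 0" "P \<ge> 1"
  shows "a \<le> \<theta> + \<theta> powr (1 - P) * a powr P"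
proof (cases "a \<le> \<theta>")
  case False
  then have "a > \<theta>" "a > 0" using assms by auto
  then have "a powr (1 - P) \<le> \<theta> powr (1 - P)"
    using assms by (intro powr_mono2') auto
  then have "a powr (1 - P) * a powr P \<le> \<theta> powr (1 - P) * a powr P"
    by (intro mult_right_mono) auto
  moreover have "a powr (1 - P) * a powr P = a"
    using \<open>a > 0\<close> by (simp flip: powr_add)
  ultimately show ?thesis using assms by linarith
next
  case True
  have "0 \<le> \<theta> powr (1 - P) * a powr P" by simp
  then show ?thesis using True by linarith
qed

text \<open>Hoelder's inequality up to a factor \<open>2\<close>, by cutting \<open>A\<close> off at height \<open>\<Lambda> * X powr \<rho>\<close>.\<close>

lemma weighted_sum_le:
  fixes A u :: "'a \<Rightarrow> real"
  assumes Z: "finite Z" "Z \<noteq> {}" and \<rho>: "0 \<le> \<rho>" "\<rho> \<le> 1"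
    and A: "\<And>z. z \<in> Z \<Longrightarrow> 0 \<le> A z" and u: "\<And>z. z \<in> Z \<Longrightarrow> 0 \<le> u z"
    and X: "X \<ge> 1" and \<Lambda>: "\<Lambda> \<ge> 0" "pmean_le \<rho> Z A \<Lambda>"
    and S: "(\<Sum>z\<in>Z. u z) \<le> S" and uX: "\<And>z. z \<in> Z \<Longrightarrow> u z \<le> S * X / real (card Z)"
  shows "(\<Sum>z\<in>Z. A z * u z) \<le> 2 * S * X powr \<rho> * \<Lambda>"
proof -
  have S0: "0 \<le> S" using S sum_nonneg[of Z u] u by fastforce
  have c0: "real (card Z) > 0" using Z by (simp add: card_gt_0_iff)
  show ?thesis
  proof (cases "\<rho> = 0")
    case True
    then have "(\<Sum>z\<in>Z. A z * u z) \<le> (\<Sum>z\<in>Z. \<Lambda> * u z)"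
      using \<Lambda> u by (intro sum_mono mult_right_mono) (auto simp: pmean_le_def)
    also have "\<dots> \<le> \<Lambda> * S"
      using S \<Lambda> by (simp add: sum_distrib_left[symmetric] mult_left_mono)
    also have "\<dots> \<le> 2 * S * X powr \<rho> * \<Lambda>"
      using True X S0 \<Lambda> by simp
    finally show ?thesis .
  next
    case False
    define P where "P = 1 / \<rho>"
    have P: "P \<ge> 1" "\<rho> = 1 / P" using \<rho> False by (auto simp: P_def)
    have m: "(\<Sum>z\<in>Z. A z powr P) \<le> real (card Z) * \<Lambda> powr P"
      using \<Lambda>(2) False by (simp add: pmean_le_def P_def)
    show ?thesis
    proof (cases "\<Lambda> = 0")
      case True
      then have "(\<Sum>z\<in>Z. A z powr P) = 0"
        using m by (intro antisym sum_nonneg) auto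
      then have "A z = 0" if "z \<in> Z" for z
        using Z that by (subst (asm) sum_nonneg_eq_0_iff) auto
      then show ?thesis using True by simp
    next
      case False
      \<comment> \<open>At this height \<open>\<theta> powr P = \<Lambda> powr P * X\<close>, so the
        bounds below and above the cut agree; this is the factor 2.\<close>
      define \<theta> where "\<theta> = \<Lambda> * X powr \<rho>"
      have \<Lambda>0: "\<Lambda> > 0" using False \<Lambda> by simp
      have \<theta>: "\<theta> > 0" using \<Lambda>0 X by (simp add: \<theta>_def)
      have "(\<Sum>z\<in>Z. A z * u z) \<le> (\<Sum>z\<in>Z. \<theta> * u z + \<theta> powr (1 - P) * (A z powr P * (S * X / real (card Z))))"
      proof (intro sum_mono)
        fix z assume z: "z \<in> Z"
        have "A z * u z \<le> (\<theta> + \<theta> powr (1 - P) * A z powr P) * u z"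
          using A u z \<theta> P by (intro mult_right_mono le_threshold) auto
        also have "\<dots> = \<theta> * u z + \<theta> powr (1 - P) * (A z powr P * u z)"
          by (simp add: algebra_simps)
        also have "\<dots> \<le> \<theta> * u z + \<theta> powr (1 - P) * (A z powr P * (S * X / real (card Z)))"
          using uX[OF z] by (intro add_left_mono mult_left_mono) auto
        finally show "A z * u z \<le> \<theta> * u z + \<theta> powr (1 - P) * (A z powr P * (S * X / real (card Z)))" .
      qed
      also have "\<dots> = \<theta> * (\<Sum>z\<in>Z. u z) + \<theta> powr (1 - P) * ((\<Sum>z\<in>Z. A z powr P) * (S * X / real (card Z)))"
        by (simp only: sum.distrib sum_distrib_left sum_distrib_right)
      also have "\<dots> \<le> \<theta> * S + \<theta> powr (1 - P) * ((real (card Z) * \<Lambda> powr P) * (S * X / real (card Z)))"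
        using S m \<theta> S0 X by (intro add_mono mult_left_mono mult_right_mono) auto
      also have "\<theta> powr (1 - P) * ((real (card Z) * \<Lambda> powr P) * (S * X / real (card Z))) =
          S * (\<theta> powr (1 - P) * (\<Lambda> powr P * X))"
        using c0 by simp
      also have "\<theta> powr (1 - P) * (\<Lambda> powr P * X) = \<theta>"
      proof -
        have "\<rho> * (1 - P) + 1 = \<rho>" using P by (simp add: field_simps)
        then have "X powr (\<rho> * (1 - P)) * X = X powr \<rho>"
          using X by (metis less_eq_real_def less_le_trans powr_add powr_one zero_less_one)
        moreover have "\<Lambda> powr (1 - P) * \<Lambda> powr P = \<Lambda>"
          using \<Lambda>0 by (simp flip: powr_add)
        moreover have "\<theta> powr (1 - P) = \<Lambda> powr (1 - P) * X powr (\<rho> * (1 - P))"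
          using \<Lambda>0 X by (simp add: \<theta>_def powr_mult powr_powr)
        ultimately show ?thesis by (simp add: \<theta>_def) (metis (no_types, opaque_lifting) mult.assoc mult.left_commute)
      qed
      finally show ?thesis by (simp add: \<theta>_def mult_ac)
    qed
  qed
qed

text \<open>Stripping the binary digits of \<open>N div 2 ^ h\<close> from the bottom: an odd
  quotient splits off one block of length \<open>2 ^ h\<close>. Every block starts at a multiple of
  its length, as \<open>digital_digit_block\<close> requires.\<close>

lemma dyadic_split:
  fixes H :: "nat \<Rightarrow> complex"
  assumes "N < 2 ^ (h + u)"
    and "\<And>n a. \<lbrakk>h \<le> n; n < h + u\<rbrakk> \<Longrightarrow> norm (\<Sum>c<2 ^ n. H (a * 2 ^ n + c)) \<le> D n"
  shows "norm (\<Sum>k<N div 2 ^ h * 2 ^ h. H k) \<le> (\<Sum>n\<in>{h..<h + u}. D n)"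
  using assms
proof (induction u arbitrary: h)
  case 0
  then show ?case by simp
next
  case (Suc u)
  have D0: "D n \<ge> 0" if "h \<le> n" "n < h + Suc u" for n
    using Suc.prems(2)[OF that, of 0] norm_ge_zero order_trans by blast
  have IH: "norm (\<Sum>k<N div 2 ^ Suc h * 2 ^ Suc h. H k) \<le> (\<Sum>n\<in>{Suc h..<Suc h + u}. D n)"
    by (rule Suc.IH) (use Suc.prems in auto)
  let ?q = "N div 2 ^ h"
  have q: "N div 2 ^ Suc h = ?q div 2" by (simp add: div_mult2_eq[symmetric] mult.commute)
  have step: "norm (\<Sum>k<?q * 2 ^ h. H k) \<le> norm (\<Sum>k<N div 2 ^ Suc h * 2 ^ Suc h. H k) + D h"
  proof (cases "even ?q")
    case True
    then have "?q * 2 ^ h = N div 2 ^ Suc h * 2 ^ Suc h" unfolding q by (auto elim!: evenE)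
    then show ?thesis using D0[of h] by (simp only:) simp
  next
    case False
    then obtain e where e: "?q = 2 * e + 1" by (auto elim!: oddE)
    have "{..<?q * 2 ^ h} = {0..<(2 * e) * 2 ^ h + 2 ^ h}" unfolding e by (auto simp: algebra_simps)
    then have "(\<Sum>k<?q * 2 ^ h. H k) = (\<Sum>k=0..<(2 * e) * 2 ^ h. H k) + (\<Sum>k=(2 * e) * 2 ^ h..<(2 * e) * 2 ^ h + 2 ^ h. H k)"
      by (simp only:) (subst sum.atLeastLessThan_concat, auto)
    also have "(\<Sum>k=(2 * e) * 2 ^ h..<(2 * e) * 2 ^ h + 2 ^ h. H k) = (\<Sum>c<2 ^ h. H ((2 * e) * 2 ^ h + c))"
      using sum.shift_bounds_nat_ivl[of H 0 "(2 * e) * 2 ^ h" "2 ^ h"]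
      by (simp add: lessThan_atLeast0 add.commute)
    also have "(\<Sum>k=0..<(2 * e) * 2 ^ h. H k) = (\<Sum>k<N div 2 ^ Suc h * 2 ^ Suc h. H k)"
      unfolding q e by (simp add: lessThan_atLeast0 mult_ac)
    finally have "norm (\<Sum>k<?q * 2 ^ h. H k) \<le> norm (\<Sum>k<N div 2 ^ Suc h * 2 ^ Suc h. H k)
        + norm (\<Sum>c<2 ^ h. H ((2 * e) * 2 ^ h + c))"
      by (simp only: norm_triangle_ineq)
    also have "norm (\<Sum>c<2 ^ h. H ((2 * e) * 2 ^ h + c)) \<le> D h"
      by (rule Suc.prems(2)) auto
    finally show ?thesis by simp
  qed
  have "{h..<h + Suc u} = insert h {Suc h..<Suc h + u}" by auto
  then show ?case using step IH by simp
qed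


section \<open>Integration error for trigonometric polynomials\<close>

text \<open>4 comes from the part estimated without cancellation, the fraction from the geometric
  series of the nets that do cancel.\<close>

definition err_const :: "nat \<Rightarrow> real" where
  "err_const d = walsh_const ^ d * (4 + 2 / (1 - 2 powr (- 1/2)))"

text \<open>The polynomial is controlled only through a power mean of its values on one shifted
  grid, with \<open>\<rho>\<close> in the role of \<open>1 / p\<close>. All estimates below, even
  the supremum bound, are derived from these samples.\<close>

locale sampled_tpoly =
  fixes p :: "'d::finite \<Rightarrow> nat" and a :: "int ^ 'd \<Rightarrow> complex" and y :: "real ^ 'd"
    and \<rho> \<Lambda> :: real
  assumes \<rho>: "0 \<le> \<rho>" "\<rho> \<le> 1" and \<Lambda>: "0 \<le> \<Lambda>"
    and sampled: "pmean_le \<rho> (grid (\<lambda>i. 4 * 2 ^ p i))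
      (\<lambda>z. norm (tpolyd (\<lambda>i. 2 ^ p i) a (gpt (\<lambda>i. 4 * 2 ^ p i) y z))) \<Lambda>"
begin

abbreviation "deg \<equiv> (\<lambda>i. 2 ^ p i) :: 'd \<Rightarrow> nat"
abbreviation "res \<equiv> (\<lambda>i. 4 * 2 ^ p i) :: 'd \<Rightarrow> nat"
abbreviation "g \<equiv> tpolyd deg a"
abbreviation "pt \<equiv> gpt res y"
abbreviation "V \<equiv> real (\<Prod>i\<in>UNIV. res i)"
abbreviation "lvl \<equiv> (\<Sum>i\<in>UNIV. p i + 2)"

lemma V_pos: "V > 0"
  by (simp add: prod_pos)

lemma prod_scale: "(\<Prod>i\<in>(UNIV :: 'd set). c * real (res i)) = c ^ CARD('d) * V"
  by (subst prod.distrib) (simp only: prod_constant of_nat_prod)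

lemma card_res: "real (card (grid res)) = V"
  by (simp add: card_grid)

lemma grid_nonempty: "grid res \<noteq> {}"
  using V_pos card_res by (metis card.empty less_irrefl of_nat_0)

lemma reproduce: "of_nat (\<Prod>i\<in>UNIV. res i) * g x =
    (\<Sum>z\<in>grid res. g (pt z) * (\<Prod>i\<in>UNIV. vp_kernel (deg i) (x $ i - pt z $ i)))"
  by (rule tpolyd_reproduce) simp

lemma mean: "(\<Sum>z\<in>grid res. g (pt z)) = of_nat (\<Prod>i\<in>UNIV. res i) * a 0"
  by (rule tpolyd_mean) simp

lemma norm_g_le: "V * norm (g x) \<le>
    (\<Sum>z\<in>grid res. norm (g (pt z)) * (\<Prod>i\<in>UNIV. vp_majorant (deg i) (x $ i - pt z $ i)))"
proof -
  have "V * norm (g x) = norm (of_nat (\<Prod>i\<in>UNIV. res i) * g x)"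
    by (simp only: norm_mult norm_of_nat)
  also have "\<dots> \<le> (\<Sum>z\<in>grid res. norm (g (pt z)) * (\<Prod>i\<in>UNIV. norm (vp_kernel (deg i) (x $ i - pt z $ i))))"
    unfolding reproduce by (rule order_trans[OF norm_sum]) (simp add: norm_mult prod_norm)
  also have "\<dots> \<le> (\<Sum>z\<in>grid res. norm (g (pt z)) * (\<Prod>i\<in>UNIV. vp_majorant (deg i) (x $ i - pt z $ i)))"
    by (intro sum_mono mult_left_mono prod_mono conjI norm_vp_kernel_le) auto
  finally show ?thesis .
qed

lemma majorant_grid_sum:
  "(\<Sum>z\<in>grid res. \<Prod>i\<in>UNIV. vp_majorant (deg i) (x $ i - pt z $ i)) = 2 ^ CARD('d) * V"
proof -
  have refl': "(\<Sum>z<n. vp_majorant b (s - (y' + real z / real n))) = (\<Sum>z<n. vp_majorant b (y' - s + real z / real n))"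
    for n b s y'
  proof (intro sum.cong refl)
    fix z
    from vp_majorant_minus[of b "y' - s + real z / real n"]
    show "vp_majorant b (s - (y' + real z / real n)) = vp_majorant b (y' - s + real z / real n)"
      by (simp add: algebra_simps)
  qed
  have "(\<Sum>z\<in>grid res. \<Prod>i\<in>UNIV. vp_majorant (deg i) (x $ i - pt z $ i)) =
      (\<Prod>i\<in>UNIV. \<Sum>z<res i. vp_majorant (deg i) (x $ i - (y $ i + real z / real (res i))))"
    unfolding gpt_def vec_lambda_beta by (rule sum_grid_prod)
  also have "\<dots> = (\<Prod>i\<in>UNIV. 2 * real (res i))"
    unfolding refl' by (intro prod.cong refl vp_majorant_mean) auto
  also have "\<dots> = 2 ^ CARD('d) * V"
    by (rule prod_scale)
  finally show ?thesis .
qed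

text \<open>A Nikolskii inequality: the weights are the majorants at one point, whose maximum may
  exceed their mean by a factor of order \<open>V\<close>, and Hoelder's inequality charges this
  with power \<open>\<rho>\<close>.\<close>

lemma sup_bound: "norm (g x) \<le> 2 * 5 ^ CARD('d) * V powr \<rho> * \<Lambda>"
proof -
  let ?u = "\<lambda>z. \<Prod>i\<in>UNIV. vp_majorant (deg i) (x $ i - pt z $ i)"
  have u_le: "?u z \<le> 5 ^ CARD('d) * V * V / real (card (grid res))" for z
  proof -
    have "?u z \<le> (\<Prod>i\<in>(UNIV :: 'd set). 5 * real (res i))"
    proof (intro prod_mono conjI vp_majorant_nonneg)
      fix i
      have "vp_majorant (deg i) (x $ i - pt z $ i) \<le> 5 * real (deg i)"
        by (rule vp_majorant_le) simp
      also have "\<dots> \<le> 5 * real (res i)" by simp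
      finally show "vp_majorant (deg i) (x $ i - pt z $ i) \<le> 5 * real (res i)" .
    qed
    also have "\<dots> = 5 ^ CARD('d) * V" by (rule prod_scale)
    finally show ?thesis using V_pos unfolding card_res by simp
  qed
  have "V * norm (g x) \<le> 2 * (5 ^ CARD('d) * V) * V powr \<rho> * \<Lambda>"
  proof (rule order_trans[OF norm_g_le], rule weighted_sum_le[OF _ _ \<rho>])
    show "(\<Sum>z\<in>grid res. ?u z) \<le> 5 ^ CARD('d) * V"
      unfolding majorant_grid_sum using V_pos by (intro mult_right_mono power_mono) auto
    have "0 < (\<Prod>i\<in>UNIV. res i)" by (intro prod_pos) auto
    then have "1 \<le> (\<Prod>i\<in>UNIV. res i)" by (simp only: Suc_le_eq One_nat_def)
    then have "real 1 \<le> V" by (simp only: of_nat_le_iff)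
    then show "1 \<le> V" by (simp only: of_nat_1)
  qed (use \<Lambda> sampled grid_nonempty u_le in \<open>auto intro!: prod_nonneg vp_majorant_nonneg\<close>)
  also have "\<dots> = V * (2 * 5 ^ CARD('d) * V powr \<rho> * \<Lambda>)" by simp
  finally show ?thesis using V_pos by (rule mult_left_le_imp_le)
qed

lemma mean_bound: "(\<Sum>z\<in>grid res. norm (g (pt z))) \<le> 2 * V * \<Lambda>"
  using weighted_sum_le[of "grid res" \<rho> "\<lambda>z. norm (g (pt z))" "\<lambda>_. 1" 1 \<Lambda> V] \<rho> \<Lambda> sampled
    grid_nonempty card_res V_pos by simp

lemma coeff_bound: "norm (a 0) \<le> 2 * \<Lambda>"
proof -
  have "V * norm (a 0) = norm (\<Sum>z\<in>grid res. g (pt z))"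
    unfolding mean by (simp only: norm_mult norm_of_nat)
  also have "\<dots> \<le> 2 * V * \<Lambda>"
    by (rule order_trans[OF norm_sum mean_bound])
  finally have "V * norm (a 0) \<le> V * (2 * \<Lambda>)" by (simp only: mult_ac)
  then show ?thesis using V_pos by (rule mult_left_le_imp_le)
qed

context
  fixes t :: nat and E :: "'d \<Rightarrow> nat \<Rightarrow> nat \<Rightarrow> bit"
  assumes seq: "order_digital_seq 2 t E"
    and E: "\<And>i l k. \<lbrakk>1 \<le> l; 2 * l < k\<rbrakk> \<Longrightarrow> E i k l = 0"
begin

abbreviation "T \<equiv> (t + 1) div 2"

lemma walsh_const_ge: "walsh_const ^ CARD('d) \<ge> 2 ^ CARD('d)"
proof -
  have "(1::real) \<le> exp (32 / (1 - 2 powr (- 1/4)))"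
    using powr_less_mono[of "-1/4" 0 "2::real"] by simp
  then have "2 \<le> walsh_const" unfolding walsh_const_def by linarith
  then show ?thesis by (intro power_mono) auto
qed

lemma walsh_const_ge_1: "walsh_const ^ CARD('d) \<ge> 1"
  using walsh_const_ge one_le_power[of "2::real" "CARD('d)"] by linarith

text \<open>The weight of a grid point is the majorant summed over the block. Its total is exact by
  \<open>majorant_grid_sum\<close>; its maximum is inflated by \<open>?X\<close>, the missing
  resolution, and this enters only with power \<open>\<rho>\<close>.\<close>

lemma block_abs_bound:
  "(\<Sum>c<2 ^ n. norm (g (digital_seq E (q * 2 ^ n + c)))) \<le>
    2 * (2 ^ n * walsh_const ^ CARD('d)) * (2 ^ (lvl - (n - T))) powr \<rho> * \<Lambda>"
proof -
  let ?x = "\<lambda>c. digital_seq E (q * 2 ^ n + c)"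
  let ?u = "\<lambda>z. \<Sum>c<2 ^ n. \<Prod>i\<in>UNIV. vp_majorant (deg i) (?x c $ i - pt z $ i)"
  let ?X = "2 ^ (lvl - (n - T)) :: real"
  have "V * (\<Sum>c<2 ^ n. norm (g (?x c))) \<le>
     (\<Sum>c<2 ^ n. \<Sum>z\<in>grid res. norm (g (pt z)) * (\<Prod>i\<in>UNIV. vp_majorant (deg i) (?x c $ i - pt z $ i)))"
    unfolding sum_distrib_left by (intro sum_mono norm_g_le)
  also have "\<dots> = (\<Sum>z\<in>grid res. norm (g (pt z)) * ?u z)"
    unfolding sum_distrib_left by (rule sum.swap)
  also have "\<dots> \<le> 2 * (2 ^ n * walsh_const ^ CARD('d) * V) * ?X powr \<rho> * \<Lambda>"
  proof (rule weighted_sum_le[OF _ _ \<rho>])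
    have "(\<Sum>z\<in>grid res. ?u z) = (\<Sum>c<(2::nat) ^ n. 2 ^ CARD('d) * V)"
      by (subst sum.swap) (simp only: majorant_grid_sum)
    also have "\<dots> \<le> 2 ^ n * walsh_const ^ CARD('d) * V"
      using walsh_const_ge V_pos by (simp del: of_nat_prod add: mult_left_mono mult_right_mono)
    finally show "(\<Sum>z\<in>grid res. ?u z) \<le> 2 ^ n * walsh_const ^ CARD('d) * V" .
    fix z assume "z \<in> grid res"
    show "?u z \<le> 2 ^ n * walsh_const ^ CARD('d) * V * ?X / real (card (grid res))"
      using vp_majorant_block[OF seq E, where n = n and a = q and p = p and s = "\<lambda>i. pt z $ i"] V_pos
      unfolding card_res by (simp del: of_nat_prod)
  qed (use \<Lambda> sampled grid_nonempty in \<open>auto intro!: sum_nonneg prod_nonneg vp_majorant_nonneg\<close>)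
  also have "\<dots> = V * (2 * (2 ^ n * walsh_const ^ CARD('d)) * ?X powr \<rho> * \<Lambda>)" by (simp only: mult_ac)
  finally show ?thesis using V_pos by (rule mult_left_le_imp_le)
qed

text \<open>The mean of the samples is \<open>a 0\<close>, so the error is a combination of the
  errors for the kernels. These are bounded uniformly, and a first moment of the samples
  suffices.\<close>

lemma block_diff_bound:
  assumes n: "t + 2 * lvl \<le> 2 * n"
  shows "norm (\<Sum>c<2 ^ n. g (digital_seq E (q * 2 ^ n + c)) - a 0) \<le>
    2 ^ n * walsh_const ^ CARD('d) * 2 powr (- 3/4 * (2 * real n - real t - 2 * real lvl)) * (2 * \<Lambda>)"
proof -
  let ?x = "\<lambda>c. digital_seq E (q * 2 ^ n + c)"
  let ?v = "\<lambda>z c. \<Prod>i\<in>UNIV. vp_kernel (deg i) (?x c $ i - pt z $ i)"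
  let ?b = "2 ^ n * walsh_const ^ CARD('d) * 2 powr (- 3/4 * (2 * real n - real t - 2 * real lvl))"
  have "of_nat (\<Prod>i\<in>UNIV. res i) * (\<Sum>c<2 ^ n. g (?x c) - a 0) =
      (\<Sum>c<2 ^ n. (\<Sum>z\<in>grid res. g (pt z) * ?v z c) - (\<Sum>z\<in>grid res. g (pt z)))"
    unfolding mean reproduce[symmetric] sum_distrib_left right_diff_distrib ..
  also have "\<dots> = (\<Sum>z\<in>grid res. g (pt z) * ((\<Sum>c<2 ^ n. ?v z c) - 2 ^ n))"
  proof -
    have "(\<Sum>c<2 ^ n. (\<Sum>z\<in>grid res. g (pt z) * ?v z c) - (\<Sum>z\<in>grid res. g (pt z))) =
       (\<Sum>z\<in>grid res. \<Sum>c<2 ^ n. g (pt z) * ?v z c) - 2 ^ n * (\<Sum>z\<in>grid res. g (pt z))"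
      unfolding sum_subtractf by (subst sum.swap) simp
    also have "\<dots> = (\<Sum>z\<in>grid res. g (pt z) * ((\<Sum>c<2 ^ n. ?v z c) - 2 ^ n))"
      unfolding right_diff_distrib sum_subtractf sum_distrib_left by (simp add: mult.commute)
    finally show ?thesis .
  qed
  finally have eq: "of_nat (\<Prod>i\<in>UNIV. res i) * (\<Sum>c<2 ^ n. g (?x c) - a 0) =
    (\<Sum>z\<in>grid res. g (pt z) * ((\<Sum>c<2 ^ n. ?v z c) - 2 ^ n))" .
  have "V * norm (\<Sum>c<2 ^ n. g (?x c) - a 0) = norm (of_nat (\<Prod>i\<in>UNIV. res i) * (\<Sum>c<2 ^ n. g (?x c) - a 0))"
    by (simp only: norm_mult norm_of_nat)
  also have "\<dots> \<le> (\<Sum>z\<in>grid res. norm (g (pt z)) * norm ((\<Sum>c<2 ^ n. ?v z c) - 2 ^ n))"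
    unfolding eq by (rule order_trans[OF norm_sum]) (simp add: norm_mult)
  also have "\<dots> \<le> (\<Sum>z\<in>grid res. norm (g (pt z)) * ?b)"
    by (intro sum_mono mult_left_mono norm_ge_zero)
      (rule vp_kernel_block_error[OF seq E n, where s = "\<lambda>i. pt _ $ i"])
  also have "\<dots> = (\<Sum>z\<in>grid res. norm (g (pt z))) * ?b" by (rule sum_distrib_right[symmetric])
  also have "\<dots> \<le> (2 * V * \<Lambda>) * ?b"
    using walsh_const_ge_1 by (intro mult_right_mono mean_bound) auto
  finally have "V * norm (\<Sum>c<2 ^ n. g (?x c) - a 0) \<le> V * (?b * (2 * \<Lambda>))" by (simp only: mult_ac)
  then show ?thesis using V_pos by (rule mult_left_le_imp_le)
qed

text \<open>Without cancellation the interval may be enlarged to the aligned block containing it;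
  \<open>e\<close> bounds the missing resolution of that block.\<close>

lemma interval_abs_bound:
  assumes "{k0..<N} \<subseteq> {q * 2 ^ n..<q * 2 ^ n + 2 ^ n}" and n: "lvl - (n - T) \<le> e"
  shows "norm (\<Sum>k=k0..<N. g (digital_seq E k) - a 0) \<le> 2 ^ n * (4 * walsh_const ^ CARD('d)) * (2 ^ e) powr \<rho> * \<Lambda>"
proof -
  have "norm (\<Sum>k=k0..<N. g (digital_seq E k) - a 0) \<le>
     (\<Sum>k=k0..<N. norm (g (digital_seq E k)) + norm (a 0))"
    by (rule order_trans[OF norm_sum]) (intro sum_mono norm_triangle_ineq4)
  also have "\<dots> \<le> (\<Sum>k=q * 2 ^ n..<q * 2 ^ n + 2 ^ n. norm (g (digital_seq E k)) + norm (a 0))"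
    by (intro sum_mono2 assms) auto
  also have "\<dots> = (\<Sum>c<2 ^ n. norm (g (digital_seq E (q * 2 ^ n + c))) + norm (a 0))"
    using sum.shift_bounds_nat_ivl[of "\<lambda>k. norm (g (digital_seq E k)) + norm (a 0)" 0 "q * 2 ^ n" "2 ^ n"]
    by (simp add: lessThan_atLeast0 add.commute)
  also have "\<dots> = (\<Sum>c<2 ^ n. norm (g (digital_seq E (q * 2 ^ n + c)))) + 2 ^ n * norm (a 0)"
    by (simp add: sum.distrib)
  also have "\<dots> \<le> 2 * (2 ^ n * walsh_const ^ CARD('d)) * (2 ^ (lvl - (n - T))) powr \<rho> * \<Lambda> + 2 ^ n * (2 * \<Lambda>)"
    by (intro add_mono block_abs_bound mult_left_mono coeff_bound) auto
  also have "\<dots> \<le> 2 * (2 ^ n * walsh_const ^ CARD('d)) * (2 ^ e) powr \<rho> * \<Lambda> + 2 ^ n * (2 * (walsh_const ^ CARD('d) * (2 ^ e) powr \<rho> * \<Lambda>))"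
  proof (intro add_mono mult_right_mono mult_left_mono powr_mono2 power_increasing n)
    have "1 * 1 * \<Lambda> \<le> walsh_const ^ CARD('d) * (2 ^ e) powr \<rho> * \<Lambda>"
      using walsh_const_ge_1 \<rho> \<Lambda> by (intro mult_right_mono mult_mono ge_one_powr_ge_zero) auto
    then show "\<Lambda> \<le> walsh_const ^ CARD('d) * (2 ^ e) powr \<rho> * \<Lambda>" by simp
  qed (use \<rho> \<Lambda> walsh_const_ge_1 in auto)
  also have "\<dots> = 2 ^ n * (4 * walsh_const ^ CARD('d)) * (2 ^ e) powr \<rho> * \<Lambda>" by simp
  finally show ?thesis .
qed

lemma error_high:
  assumes "N \<le> 2 ^ L"
  shows "norm (\<Sum>k<N. g (digital_seq E k) - a 0) \<le> err_const CARD('d) * 2 ^ L * (2 ^ (lvl - (L - T))) powr \<rho> * \<Lambda>"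
proof -
  have q: "(2 powr (- 1/2) :: real) < 1" using powr_less_mono[of "-1/2" 0 "2::real"] by simp
  have "norm (\<Sum>k<N. g (digital_seq E k) - a 0) \<le> 2 ^ L * (4 * walsh_const ^ CARD('d)) * (2 ^ (lvl - (L - T))) powr \<rho> * \<Lambda>"
    using interval_abs_bound[of 0 N 0 L "lvl - (L - T)"] assms by (simp add: lessThan_atLeast0)
  also have "\<dots> \<le> 2 ^ L * err_const CARD('d) * (2 ^ (lvl - (L - T))) powr \<rho> * \<Lambda>"
    unfolding err_const_def using walsh_const_ge_1 q \<Lambda>
    by (intro mult_right_mono mult_left_mono) (auto simp: distrib_left)
  finally show ?thesis by (simp only: mult_ac)
qed

text \<open>\<open>h = lvl + T\<close> is the first level at which the net resolves the degrees. A
  larger block errs by \<open>2 ^ n * 2 powr (- 3/2 * (n - h))\<close>, that is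
  \<open>2 ^ h * 2 powr (- (n - h) / 2)\<close>, so all of them together cost a multiple of
  \<open>2 ^ h\<close>.\<close>

lemma error_low:
  assumes N: "N \<le> 2 ^ L" and low: "lvl + T < L"
  shows "norm (\<Sum>k<N. g (digital_seq E k) - a 0) \<le> err_const CARD('d) * 2 ^ (lvl + T) * \<Lambda>"
proof -
  define h where "h = lvl + T"
  define u where "u = Suc L - h"
  let ?H = "\<lambda>k. g (digital_seq E k) - a 0"
  let ?q = "2 powr (- 1/2) :: real"
  let ?D = "\<lambda>n. 2 ^ h * (2 * walsh_const ^ CARD('d) * \<Lambda>) * ?q ^ (n - h)"
  have q: "?q < 1" "0 \<le> ?q" using powr_less_mono[of "-1/2" 0 "2::real"] by auto
  have hu: "N < 2 ^ (h + u)"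
  proof -
    have "(2::nat) ^ L < 2 ^ (h + u)" using low by (intro power_strict_increasing) (auto simp: u_def h_def)
    then show ?thesis using N by linarith
  qed
  have Dn: "norm (\<Sum>c<2 ^ n. ?H (q' * 2 ^ n + c)) \<le> ?D n" if "h \<le> n" for n q'
  proof -
    have tT: "t \<le> 2 * T" by linarith
    then have le: "t + 2 * lvl \<le> 2 * n" using that unfolding h_def by linarith
    have r: "real n = real h + real (n - h)" using that by simp
    have th: "real t + 2 * real lvl \<le> 2 * real h"
    proof -
      have "t' + 2 * l \<le> 2 * (l + T')" if "t' \<le> 2 * T'" for t' l T' :: nat using that by simp
      from this[OF tT] have "t + 2 * lvl \<le> 2 * h" unfolding h_def .
      then have "real (t + 2 * lvl) \<le> real (2 * h)" by (simp only: of_nat_le_iff)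
      then show ?thesis by (simp only: of_nat_add of_nat_mult of_nat_numeral)
    qed
    have "norm (\<Sum>c<2 ^ n. ?H (q' * 2 ^ n + c)) \<le>
        2 ^ n * walsh_const ^ CARD('d) * 2 powr (- 3/4 * (2 * real n - real t - 2 * real lvl)) * (2 * \<Lambda>)"
      by (rule block_diff_bound[OF le])
    also have "\<dots> \<le> 2 ^ n * walsh_const ^ CARD('d) * 2 powr (- 3/2 * real (n - h)) * (2 * \<Lambda>)"
    proof (intro mult_right_mono mult_left_mono powr_mono)
      show "- 3 / 4 * (2 * real n - real t - 2 * real lvl) \<le> - 3 / 2 * real (n - h)"
      proof -
        have "- 3 / 4 * (2 * n' - t' - 2 * l) \<le> - 3 / 2 * u'"
          if "t' + 2 * l \<le> 2 * h'" "n' = h' + u'" for n' t' l u' h' :: real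
          using that by simp
        from this[OF th r] show ?thesis .
      qed
    qed (use walsh_const_ge_1 \<Lambda> in auto)
    also have "2 ^ n * walsh_const ^ CARD('d) * 2 powr (- 3/2 * real (n - h)) * (2 * \<Lambda>) = ?D n"
    proof -
      have 1: "(2::real) ^ n = 2 ^ h * 2 powr real (n - h)"
        using that by (subst powr_realpow) (simp_all flip: power_add)
      have "2 powr real (n - h) * 2 powr (- 3/2 * real (n - h)) = 2 powr (- 1/2 * real (n - h))"
        unfolding powr_add[symmetric] by (rule arg_cong[where f = "(powr) 2"]) simp
      also have "\<dots> = ?q ^ (n - h)"
        unfolding powr_powr[symmetric] by (rule powr_realpow) simp
      finally have 2: "2 powr real (n - h) * 2 powr (- 3/2 * real (n - h)) = ?q ^ (n - h)" .
      show ?thesis unfolding 1 2[symmetric] by (simp only: mult_ac)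
    qed
    finally show ?thesis .
  qed
  have "norm (\<Sum>k<N div 2 ^ h * 2 ^ h. ?H k) \<le> (\<Sum>n\<in>{h..<h + u}. ?D n)"
    by (rule dyadic_split[OF hu Dn])
  also have "\<dots> = 2 ^ h * (2 * walsh_const ^ CARD('d) * \<Lambda>) * (\<Sum>n\<in>{h..<h + u}. ?q ^ (n - h))"
    by (rule sum_distrib_left[symmetric])
  also have "(\<Sum>n\<in>{h..<h + u}. ?q ^ (n - h)) = (\<Sum>n<u. ?q ^ n)"
    by (rule sum.reindex_bij_witness[where i = "\<lambda>n. n + h" and j = "\<lambda>n. n - h"]) auto
  also have "2 ^ h * (2 * walsh_const ^ CARD('d) * \<Lambda>) * (\<Sum>n<u. ?q ^ n) \<le> 2 ^ h * (2 * walsh_const ^ CARD('d) * \<Lambda>) * (1 / (1 - ?q))"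
  proof (intro mult_left_mono)
    have "(\<Sum>n<u. ?q ^ n) \<le> (\<Sum>n. ?q ^ n)"
      using q by (intro sum_le_suminf summable_geometric) auto
    also have "\<dots> = 1 / (1 - ?q)" using q by (intro suminf_geometric) auto
    finally show "(\<Sum>n<u. ?q ^ n) \<le> 1 / (1 - ?q)" .
  qed (use walsh_const_ge_1 \<Lambda> in auto)
  finally have main: "norm (\<Sum>k<N div 2 ^ h * 2 ^ h. ?H k) \<le> 2 ^ h * (2 * walsh_const ^ CARD('d) * \<Lambda>) * (1 / (1 - ?q))" .
  \<comment> \<open>Fewer than \<open>2 ^ h\<close> terms remain. At level \<open>h\<close> no
    resolution is missing, so \<open>\<rho>\<close> drops out.\<close>
  have "norm (\<Sum>k=N div 2 ^ h * 2 ^ h..<N. ?H k) \<le> 2 ^ h * (4 * walsh_const ^ CARD('d)) * (2 ^ 0) powr \<rho> * \<Lambda>"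
  proof (rule interval_abs_bound)
    have "N < N div 2 ^ h * 2 ^ h + 2 ^ h"
    proof -
      have "N mod 2 ^ h < 2 ^ h" by simp
      then show ?thesis using div_mult_mod_eq[of N "2 ^ h"] by linarith
    qed
    then show "{N div 2 ^ h * 2 ^ h..<N} \<subseteq> {N div 2 ^ h * 2 ^ h..<N div 2 ^ h * 2 ^ h + 2 ^ h}" by auto
    show "lvl - (h - T) \<le> 0" by (simp add: h_def)
  qed
  then have tail: "norm (\<Sum>k=N div 2 ^ h * 2 ^ h..<N. ?H k) \<le> 2 ^ h * (4 * walsh_const ^ CARD('d)) * \<Lambda>" by simp
  have "(\<Sum>k<N. ?H k) = (\<Sum>k<N div 2 ^ h * 2 ^ h. ?H k) + (\<Sum>k=N div 2 ^ h * 2 ^ h..<N. ?H k)"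
    by (simp add: lessThan_atLeast0 sum.atLeastLessThan_concat)
  then have "norm (\<Sum>k<N. ?H k) \<le> 2 ^ h * (2 * walsh_const ^ CARD('d) * \<Lambda>) * (1 / (1 - ?q)) + 2 ^ h * (4 * walsh_const ^ CARD('d)) * \<Lambda>"
    by (simp only:) (rule order_trans[OF norm_triangle_ineq add_mono[OF main tail]])
  also have "\<dots> = err_const CARD('d) * 2 ^ h * \<Lambda>"
    unfolding err_const_def by (simp add: algebra_simps)
  finally show ?thesis unfolding h_def .
qed

end

end


section \<open>The torus as a union of cells\<close>

definition cube :: "(real ^ 'd::finite) set" where
  "cube = {x. \<forall>i. 0 \<le> x $ i \<and> x $ i < 1}"

definition cell :: "('d::finite \<Rightarrow> nat) \<Rightarrow> (real ^ 'd) set" where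
  "cell n = {x. \<forall>i. 0 \<le> x $ i \<and> x $ i < 1 / real (n i)}"

definition corner :: "('d::finite \<Rightarrow> nat) \<Rightarrow> ('d \<Rightarrow> nat) \<Rightarrow> real ^ 'd" where
  "corner n z = (\<chi> i. real (z i) / real (n i))"

lemma gpt_corner: "gpt n y z = corner n z + y"
  by (simp add: gpt_def corner_def vec_eq_iff)

lemma cube_measurable [measurable]: "cube \<in> sets borel"
  unfolding cube_def by measurable

lemma cell_measurable [measurable]: "cell n \<in> sets borel"
  unfolding cell_def by measurable

lemma torus_cube: "torus = restrict_space lborel cube"
  by (simp add: torus_def cube_def)

lemma emeasure_cube: "emeasure lborel (cube :: (real ^ 'd::finite) set) = 1"
proof -
  have p: "(\<Prod>b\<in>(Basis :: (real ^ 'd) set). (1 - 0) \<bullet> b) = 1"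
    by (rule prod.neutral) (auto simp: Basis_vec_def inner_axis)
  have le: "0 \<bullet> b \<le> 1 \<bullet> b" if "b \<in> Basis" for b :: "real ^ 'd"
    using that by (auto simp: Basis_vec_def inner_axis)
  have "emeasure lborel (box 0 (1 :: real ^ 'd)) = 1" "emeasure lborel (cbox 0 (1 :: real ^ 'd)) = 1"
    using emeasure_lborel_box[of 0 "1 :: real ^ 'd"] emeasure_lborel_cbox[of 0 "1 :: real ^ 'd"] le p
    by simp_all
  moreover have "box 0 1 \<subseteq> (cube :: (real ^ 'd) set)" "cube \<subseteq> cbox 0 (1 :: real ^ 'd)"
    by (auto simp: cube_def mem_box_cart less_imp_le)
  ultimately show ?thesis
    using emeasure_mono[of "box 0 1" "cube :: (real ^ 'd) set" lborel]
      emeasure_mono[of cube "cbox 0 (1 :: real ^ 'd)" lborel] by simp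
qed

lemma space_torus: "space torus = cube"
  by (simp add: torus_cube space_restrict_space)

lemma emeasure_torus: "emeasure (torus :: (real ^ 'd::finite) measure) cube = 1"
  by (simp add: torus_cube emeasure_restrict_space emeasure_cube)

lemma measurable_torus: "u \<in> borel_measurable borel \<Longrightarrow> u \<in> borel_measurable torus"
  unfolding torus_cube by (rule measurable_restrict_space1) simp

text \<open>The translated cell containing \<open>x\<close> is read off from the integer parts of
  \<open>n i * x $ i\<close>.\<close>

lemma cell_decomposition:
  fixes x :: "real ^ 'd::finite"
  assumes n: "\<And>i. n i > 0"
  shows "(\<Sum>z\<in>grid n. indicator (cell n) (x - corner n z) :: 'a::semiring_1) = indicator cube x"
proof -
  have iff: "x - corner n z \<in> cell n \<longleftrightarrow> (\<forall>i. \<lfloor>real (n i) * x $ i\<rfloor> = int (z i))" for z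
  proof -
    have "x - corner n z \<in> cell n \<longleftrightarrow> (\<forall>i. real (z i) \<le> real (n i) * x $ i \<and> real (n i) * x $ i < real (z i) + 1)"
    proof -
      have "(0 \<le> y - k / N \<and> y - k / N < 1 / N) \<longleftrightarrow> (k \<le> N * y \<and> N * y < k + 1)" if "N > 0" for y k N :: real
      proof -
        have "y - k / N = (N * y - k) / N" using that by (simp add: field_simps)
        then show ?thesis using that by (auto simp: zero_le_divide_iff divide_less_cancel)
      qed
      then show ?thesis unfolding cell_def corner_def using n by simp
    qed
    then show ?thesis by (simp add: floor_eq_iff)
  qed
  show ?thesis
  proof (cases "x \<in> cube")
    case True
    define z0 where "z0 = (\<lambda>i. nat \<lfloor>real (n i) * x $ i\<rfloor>)"
    have z0: "int (z0 i) = \<lfloor>real (n i) * x $ i\<rfloor>" for i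
      using True by (simp add: z0_def cube_def)
    have "z0 i < n i" for i
    proof -
      have "real (n i) * x $ i < real (n i)" using True n[of i] by (simp add: cube_def)
      then have "\<lfloor>real (n i) * x $ i\<rfloor> < int (n i)" by (simp add: floor_less_iff)
      then show ?thesis using z0[of i] by simp
    qed
    then have "z0 \<in> grid n" by (simp add: grid_def PiE_UNIV)
    moreover have "x - corner n z \<in> cell n \<longleftrightarrow> z = z0" for z
      unfolding iff z0[symmetric] by (auto simp: fun_eq_iff)
    ultimately show ?thesis using True
      by (simp add: indicator_def if_distrib cong: if_cong)
  next
    case False
    have "x - corner n z \<notin> cell n" if "z \<in> grid n" for z
    proof
      assume "x - corner n z \<in> cell n"
      then have fl: "\<lfloor>real (n i) * x $ i\<rfloor> = int (z i)" for i using iff by blast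
      have "0 \<le> x $ i \<and> x $ i < 1" for i
      proof
        have "0 \<le> real (n i) * x $ i" using fl[of i] by (metis of_nat_0_le_iff zero_le_floor)
        then show "0 \<le> x $ i" using n[of i] by (simp add: zero_le_mult_iff)
        have "int (z i) < int (n i)" using that by (simp add: grid_def PiE_UNIV)
        then have "\<lfloor>real (n i) * x $ i\<rfloor> < int (n i)" using fl[of i] by simp
        then have "real (n i) * x $ i < real (n i)" by (simp add: floor_less_iff)
        then show "x $ i < 1" using n[of i] by simp
      qed
      then show False using False by (simp add: cube_def)
    qed
    then show ?thesis using False by simp
  qed
qed

lemma nn_integral_lborel_shift:
  fixes u :: "real ^ 'd::finite \<Rightarrow> ennreal"
  assumes [measurable]: "u \<in> borel_measurable borel"
  shows "(\<integral>\<^sup>+x. u x \<partial>lborel) = (\<integral>\<^sup>+x. u (c + x) \<partial>lborel)"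
proof -
  have "(\<integral>\<^sup>+x. u x \<partial>lborel) = (\<integral>\<^sup>+x. u x \<partial>distr lborel borel ((+) c))"
    by (simp only: lborel_distr_plus)
  also have "\<dots> = (\<integral>\<^sup>+x. u (c + x) \<partial>lborel)"
    by (subst nn_integral_distr) auto
  finally show ?thesis .
qed

lemma torus_nn_integral_cells:
  fixes u :: "real ^ 'd::finite \<Rightarrow> ennreal"
  assumes [measurable]: "u \<in> borel_measurable borel" and n: "\<And>i. n i > 0"
  shows "(\<integral>\<^sup>+x. u x \<partial>torus) = (\<integral>\<^sup>+x. (\<Sum>z\<in>grid n. u (gpt n x z)) * indicator (cell n) x \<partial>lborel)"
proof -
  have "(\<integral>\<^sup>+x. u x \<partial>torus) = (\<integral>\<^sup>+x. u x * indicator cube x \<partial>lborel)"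
    unfolding torus_cube by (rule nn_integral_restrict_space) simp
  also have "\<dots> = (\<integral>\<^sup>+x. (\<Sum>z\<in>grid n. u x * indicator (cell n) (x - corner n z)) \<partial>lborel)"
    unfolding sum_distrib_left[symmetric] by (subst cell_decomposition[OF n]) (rule refl)
  also have "\<dots> = (\<Sum>z\<in>grid n. \<integral>\<^sup>+x. u x * indicator (cell n) (x - corner n z) \<partial>lborel)"
    by (rule nn_integral_sum) measurable
  also have "\<dots> = (\<Sum>z\<in>grid n. \<integral>\<^sup>+x. u (gpt n x z) * indicator (cell n) x \<partial>lborel)"
  proof (intro sum.cong refl)
    fix z
    show "(\<integral>\<^sup>+x. u x * indicator (cell n) (x - corner n z) \<partial>lborel) =
        (\<integral>\<^sup>+x. u (gpt n x z) * indicator (cell n) x \<partial>lborel)"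
      by (subst nn_integral_lborel_shift[of _ "corner n z"]) (measurable, simp add: gpt_corner)
  qed
  also have "\<dots> = (\<integral>\<^sup>+x. (\<Sum>z\<in>grid n. u (gpt n x z) * indicator (cell n) x) \<partial>lborel)"
    by (rule nn_integral_sum[symmetric]) (unfold gpt_corner, measurable)
  finally show ?thesis by (simp only: sum_distrib_right)
qed

lemma emeasure_cell:
  assumes n: "\<And>i. n i > 0"
  shows "of_nat (\<Prod>i\<in>UNIV. n i) * emeasure lborel (cell n) = 1"
proof -
  have "1 = (\<integral>\<^sup>+(x :: real ^ 'a). 1 \<partial>torus)"
    by (simp add: space_torus emeasure_torus)
  also have "\<dots> = of_nat (\<Prod>i\<in>UNIV. n i) * emeasure lborel (cell n)"
    by (subst torus_nn_integral_cells[OF _ n]) (simp_all add: card_grid nn_integral_cmult)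
  finally show ?thesis by simp
qed

text \<open>Averaging: folding the torus onto one cell writes the integral as a mean of grid sums
  over all shifts in the cell, so not every grid sum can exceed its mean.\<close>

lemma good_shift:
  fixes u :: "real ^ 'd::finite \<Rightarrow> ennreal"
  assumes u [measurable]: "u \<in> borel_measurable borel" and n: "\<And>i. n i > 0"
  shows "\<exists>y. (\<Sum>z\<in>grid n. u (gpt n y z)) \<le> of_nat (\<Prod>i\<in>UNIV. n i) * (\<integral>\<^sup>+x. u x \<partial>torus)"
proof (rule ccontr)
  let ?V = "of_nat (\<Prod>i\<in>UNIV. n i) :: ennreal" and ?I = "\<integral>\<^sup>+x. u x \<partial>torus"
  let ?s = "\<lambda>x. \<Sum>z\<in>grid n. u (gpt n x z)"
  assume "\<not> ?thesis"
  then have gt: "?V * ?I < ?s y" for y by (auto simp: not_le)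
  have fin: "?V * ?I \<noteq> \<infinity>" using gt[of 0] by (metis infinity_ennreal_def not_top_less order.strict_implies_not_eq top.not_eq_extremum)
  have V1: "?V * emeasure lborel (cell n) = 1" by (rule emeasure_cell[OF n])
  have const: "(\<integral>\<^sup>+x. ?V * ?I * indicator (cell n) x \<partial>lborel) = ?I"
  proof -
    have "(\<integral>\<^sup>+x. ?V * ?I * indicator (cell n) x \<partial>lborel) = ?V * ?I * emeasure lborel (cell n)"
      by (rule nn_integral_cmult_indicator) simp
    also have "\<dots> = ?I * (?V * emeasure lborel (cell n))" by (simp only: mult_ac)
    finally show ?thesis unfolding V1 by simp
  qed
  have I: "?I = (\<integral>\<^sup>+x. ?s x * indicator (cell n) x \<partial>lborel)"
    by (rule torus_nn_integral_cells[OF u n])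
  have V0: "1 \<le> ?V"
  proof -
    have "0 < (\<Prod>i\<in>UNIV. n i)" using n by (intro prod_pos) auto
    then have "1 \<le> (\<Prod>i\<in>UNIV. n i)" by linarith
    then have "of_nat 1 \<le> ?V" by (simp only: of_nat_le_iff)
    then show ?thesis by simp
  qed
  have I_fin: "?I \<noteq> \<infinity>"
  proof
    assume "?I = \<infinity>"
    moreover have "?V \<noteq> 0" using V0 by (metis not_one_le_zero)
    ultimately show False using fin unfolding infinity_ennreal_def ennreal_mult_eq_top_iff by blast
  qed
  have ms: "?s \<in> borel_measurable borel" unfolding gpt_corner by measurable
  have "(\<integral>\<^sup>+x. ?V * ?I * indicator (cell n) x \<partial>lborel) < (\<integral>\<^sup>+x. ?s x * indicator (cell n) x \<partial>lborel)"
  proof (rule nn_integral_less)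
    show "(\<lambda>x. ?V * ?I * indicator (cell n) x) \<in> borel_measurable lborel" by measurable
    show "(\<lambda>x. ?s x * indicator (cell n) x) \<in> borel_measurable lborel" using ms by measurable
    show "(\<integral>\<^sup>+x. ?V * ?I * indicator (cell n) x \<partial>lborel) \<noteq> \<infinity>" unfolding const by (rule I_fin)
    show "AE x in lborel. ?V * ?I * indicator (cell n) x \<le> ?s x * indicator (cell n) x"
      by (intro AE_I2 mult_right_mono less_imp_le[OF gt]) simp
    show "\<not> (AE x in lborel. ?s x * indicator (cell n) x \<le> ?V * ?I * indicator (cell n) x)"
    proof
      assume "AE x in lborel. ?s x * indicator (cell n) x \<le> ?V * ?I * indicator (cell n) x"
      \<comment> \<open>The grid sum is strictly larger everywhere, so the integrals could agree
        only if the cell were a null set.\<close>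
      then have "AE x in lborel. x \<notin> cell n"
      proof (rule AE_mp, intro AE_I2 impI)
        fix x assume "?s x * indicator (cell n) x \<le> ?V * ?I * indicator (cell n) x"
        then show "x \<notin> cell n" using gt[of x] by (auto simp: indicator_def not_le[symmetric])
      qed
      then have "emeasure lborel (cell n) = 0"
        by (subst (asm) AE_iff_measurable[OF _ refl]) auto
      then show False using V1 by simp
    qed
  qed
  then show False unfolding const I[symmetric] by simp
qed

lemma continuous_tpolyd: "continuous_on UNIV (tpolyd b a)"
proof -
  have "continuous_on UNIV (\<lambda>x. ex (c * x $ i))" for c and i :: 'a
    unfolding ex_def cis_conv_exp by (intro continuous_intros)
  then show ?thesis
    unfolding tpolyd_def by (intro continuous_intros)
qed

lemma measurable_tpolyd [measurable]: "tpolyd b a \<in> borel_measurable borel"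
  by (rule borel_measurable_continuous_onI[OF continuous_tpolyd])

lemma ennreal_powr_le_imp:
  assumes "ennreal_powr I (1 / P) \<le> ennreal \<Lambda>" "P > 0" "\<Lambda> \<ge> 0"
  shows "I \<le> ennreal (\<Lambda> powr P)"
proof -
  have fin: "I \<noteq> \<infinity>" using assms(1) by (auto simp: ennreal_powr_def top_unique)
  then have "enn2real I powr (1 / P) \<le> \<Lambda>"
    using assms by (simp add: ennreal_powr_def)
  then have "(enn2real I powr (1 / P)) powr P \<le> \<Lambda> powr P"
    using assms by (intro powr_mono2) auto
  then have "enn2real I \<le> \<Lambda> powr P"
    using assms by (simp add: powr_powr)
  then show ?thesis using fin
    by (metis ennreal_enn2real_if ennreal_leI infinity_ennreal_def)
qed

lemma recip_eq:
  assumes "1 \<le> p" "p \<noteq> \<infinity>" shows "recip p = 1 / enn2real p" "enn2real p \<ge> 1"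
proof -
  obtain x where x: "p = ennreal x" "x \<ge> 0" using assms(2) by (cases p) auto
  then have "x \<ge> 1" using assms(1) by (metis ennreal_1 ennreal_le_iff)
  then show "recip p = 1 / enn2real p" "enn2real p \<ge> 1"
    using x by (simp_all add: recip_def divide_ennreal flip: ennreal_1)
qed

lemma recip_top [simp]: "recip top = 0"
  by (simp add: recip_def)

lemma recip_bounds:
  assumes "1 \<le> p" shows "0 \<le> recip p" "recip p \<le> 1"
proof -
  show "0 \<le> recip p" by (simp add: recip_def)
  show "recip p \<le> 1"
  proof (cases "p = \<infinity>")
    case False
    then show ?thesis using recip_eq[OF assms False] by simp
  qed simp
qed

lemma sampled_exists:
  fixes a :: "int ^ 'd::finite \<Rightarrow> complex"
  assumes p: "1 \<le> p" and L: "Lp_norm p torus (tpolyd b a) \<le> ennreal \<Lambda>" and \<Lambda>: "\<Lambda> \<ge> 0"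
    and n: "\<And>i. n i > 0"
  shows "\<exists>y. pmean_le (recip p) (grid n) (\<lambda>z. norm (tpolyd b a (gpt n y z))) \<Lambda>"
proof (cases "p = \<infinity>")
  case True
  \<comment> \<open>For \<open>p = \<infinity>\<close> the averaging is applied to the excess over
    \<open>\<Lambda>\<close>, truncated at 0 by \<open>ennreal\<close>. Its integral vanishes, so on
    some grid all excesses vanish.\<close>
  let ?u = "\<lambda>x. ennreal (norm (tpolyd b a x) - \<Lambda>)"
  have m: "(\<lambda>x. ennreal (norm (tpolyd b a x))) \<in> borel_measurable torus"
    by (rule measurable_torus) measurable
  have "AE x in torus. ennreal (norm (tpolyd b a x)) \<le> esssup torus (\<lambda>x. ennreal (norm (tpolyd b a x)))"
    by (rule esssup_AE)
  then have "AE x in torus. ?u x = 0"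
  proof (rule AE_mp, intro AE_I2 impI)
    fix x assume "ennreal (norm (tpolyd b a x)) \<le> esssup torus (\<lambda>x. ennreal (norm (tpolyd b a x)))"
    then have "ennreal (norm (tpolyd b a x)) \<le> ennreal \<Lambda>"
      using L True by (auto simp: Lp_norm_def)
    then show "?u x = 0" using \<Lambda> by (simp add: ennreal_eq_0_iff)
  qed
  then have "(\<integral>\<^sup>+x. ?u x \<partial>torus) = 0"
    by (subst nn_integral_0_iff_AE) (auto intro!: measurable_torus)
  moreover obtain y where "(\<Sum>z\<in>grid n. ?u (gpt n y z)) \<le> of_nat (\<Prod>i\<in>UNIV. n i) * (\<integral>\<^sup>+x. ?u x \<partial>torus)"
    using good_shift[of ?u n] n by auto
  ultimately have "(\<Sum>z\<in>grid n. ?u (gpt n y z)) = 0" by simp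
  then have "\<forall>z\<in>grid n. norm (tpolyd b a (gpt n y z)) \<le> \<Lambda>"
    by (subst (asm) sum_eq_0_iff) (auto simp: ennreal_eq_0_iff)
  then show ?thesis using True by (auto simp: pmean_le_def)
next
  case False
  let ?P = "enn2real p"
  have P: "recip p = 1 / ?P" "?P \<ge> 1" using recip_eq[OF p False] by auto
  let ?u = "\<lambda>x. ennreal (norm (tpolyd b a x) powr ?P)"
  have "(\<integral>\<^sup>+x. ?u x \<partial>torus) \<le> ennreal (\<Lambda> powr ?P)"
    using L False P \<Lambda> by (intro ennreal_powr_le_imp) (auto simp: Lp_norm_def)
  moreover obtain y where "(\<Sum>z\<in>grid n. ?u (gpt n y z)) \<le> of_nat (\<Prod>i\<in>UNIV. n i) * (\<integral>\<^sup>+x. ?u x \<partial>torus)"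
    using good_shift[of ?u n] n by auto
  ultimately have "(\<Sum>z\<in>grid n. ?u (gpt n y z)) \<le> of_nat (\<Prod>i\<in>UNIV. n i) * ennreal (\<Lambda> powr ?P)"
    by (meson mult_left_mono order_trans zero_le)
  also have "\<dots> = ennreal (real (card (grid n)) * \<Lambda> powr ?P)"
    by (simp add: card_grid ennreal_mult ennreal_of_nat_eq_real_of_nat del: of_nat_prod)
  finally have "(\<Sum>z\<in>grid n. norm (tpolyd b a (gpt n y z)) powr ?P) \<le> real (card (grid n)) * \<Lambda> powr ?P"
    by (simp add: sum_nonneg)
  then show ?thesis using P by (auto simp: pmean_le_def)
qed


section \<open>Fejer means\<close>

lemma finite_measure_torus: "finite_measure (torus :: (real ^ 'd::finite) measure)"
  by (rule finite_measureI) (simp add: space_torus emeasure_torus)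

lemma integrable_torus_continuous:
  fixes u :: "real ^ 'd::finite \<Rightarrow> 'b::{banach, second_countable_topology}"
  assumes u: "continuous_on UNIV u"
  shows "integrable torus u"
proof -
  interpret finite_measure "torus :: (real ^ 'd) measure" by (rule finite_measure_torus)
  have "compact (u ` cbox 0 1)"
    using u by (intro compact_continuous_image) (auto intro: continuous_on_subset)
  then have "bounded (u ` cbox 0 1)" by (rule compact_imp_bounded)
  then obtain M where M: "\<And>x. x \<in> cbox 0 1 \<Longrightarrow> norm (u x) \<le> M"
    unfolding bounded_iff by blast
  have "cube \<subseteq> cbox 0 (1 :: real ^ 'd)"
    by (auto simp: cube_def mem_box_cart less_imp_le)
  then have "AE x in torus. norm (u x) \<le> M"
    using M by (intro AE_I2) (auto simp: space_torus)
  then show ?thesis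
    using u by (intro integrable_const_bound measurable_torus borel_measurable_continuous_onI)
qed

lemma measure_cell:
  assumes n: "\<And>i. n i > 0"
  shows "real (\<Prod>i\<in>UNIV. n i) * measure lborel (cell n) = 1"
proof -
  have "enn2real (of_nat (\<Prod>i\<in>UNIV. n i) * emeasure lborel (cell n)) = 1"
    unfolding emeasure_cell[OF n] by simp
  then show ?thesis
    by (simp add: enn2real_mult measure_def ennreal_of_nat_eq_real_of_nat del: of_nat_prod)
qed

text \<open>Folding onto a cell evaluates the integral as soon as the grid sums are constant.
  Integrals of characters and Fejer kernels are thereby reduced to finite sums, without iterated
  integration.\<close>

lemma torus_integral_periodic_sum:
  fixes u :: "real ^ 'd::finite \<Rightarrow> 'b::{banach, second_countable_topology}"
  assumes u: "continuous_on UNIV u" and n: "\<And>i. n i > 0"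
    and c: "\<And>x. (\<Sum>z\<in>grid n. u (gpt n x z)) = real (\<Prod>i\<in>UNIV. n i) *\<^sub>R c"
  shows "(LINT x|torus. u x) = c"
proof -
  have [measurable]: "u \<in> borel_measurable borel" using u by (rule borel_measurable_continuous_onI)
  have iu: "integrable lborel (\<lambda>x. indicator cube x *\<^sub>R u x)"
    using integrable_torus_continuous[OF u] unfolding torus_cube by (subst (asm) integrable_restrict_space) auto
  have iz: "integrable lborel (\<lambda>x. indicator (cell n) (x - corner n z) *\<^sub>R u x)" if z: "z \<in> grid n" for z
  proof (rule Bochner_Integration.integrable_bound[OF iu])
    have "indicator (cell n) (x - corner n z) \<le> (indicator cube x :: real)" for x :: "real ^ 'd"
    proof -
      have "indicator (cell n) (x - corner n z) \<le> (\<Sum>z\<in>grid n. indicator (cell n) (x - corner n z) :: real)"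
        using z by (rule member_le_sum[where f = "\<lambda>z. indicator (cell n) (x - corner n z)"]) auto
      then show ?thesis unfolding cell_decomposition[OF n] .
    qed
    then show "AE x in lborel. norm (indicator (cell n) (x - corner n z) *\<^sub>R u x) \<le> norm (indicator cube x *\<^sub>R u x)"
      by (intro AE_I2) (auto intro!: mult_right_mono)
  qed measurable
  have sh: "(LINT x|lborel. indicator (cell n) (x - corner n z) *\<^sub>R u x) =
      (LINT x|lborel. indicator (cell n) x *\<^sub>R u (gpt n x z))" for z
  proof -
    have "(LINT x|lborel. indicator (cell n) (x - corner n z) *\<^sub>R u x) =
        (LINT x|distr lborel borel ((+) (corner n z)). indicator (cell n) (x - corner n z) *\<^sub>R u x)"
      by (simp only: lborel_distr_plus)
    also have "\<dots> = (LINT x|lborel. indicator (cell n) (corner n z + x - corner n z) *\<^sub>R u (corner n z + x))"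
      by (rule integral_distr) measurable
    finally show ?thesis by (simp add: gpt_corner)
  qed
  have iz': "integrable lborel (\<lambda>x. indicator (cell n) x *\<^sub>R u (gpt n x z))" if z: "z \<in> grid n" for z
  proof -
    have "integrable (distr lborel borel ((+) (corner n z))) (\<lambda>x. indicator (cell n) (x - corner n z) *\<^sub>R u x)"
      using iz[OF z] by (simp only: lborel_distr_plus)
    then have "integrable lborel (\<lambda>x. indicator (cell n) (corner n z + x - corner n z) *\<^sub>R u (corner n z + x))"
      by (rule integrable_distr[rotated]) measurable
    then show ?thesis by (simp add: gpt_corner)
  qed
  have "(LINT x|torus. u x) = (LINT x|lborel. indicator cube x *\<^sub>R u x)"
    unfolding torus_cube by (rule integral_restrict_space) simp
  also have "\<dots> = (LINT x|lborel. (\<Sum>z\<in>grid n. indicator (cell n) (x - corner n z) *\<^sub>R u x))"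
    unfolding scaleR_sum_left[symmetric] by (subst cell_decomposition[OF n]) (rule refl)
  also have "\<dots> = (\<Sum>z\<in>grid n. LINT x|lborel. indicator (cell n) x *\<^sub>R u (gpt n x z))"
    by (subst Bochner_Integration.integral_sum) (auto simp: iz sh)
  also have "\<dots> = (LINT x|lborel. (\<Sum>z\<in>grid n. indicator (cell n) x *\<^sub>R u (gpt n x z)))"
    by (subst Bochner_Integration.integral_sum) (auto simp: iz')
  also have "\<dots> = (LINT x|lborel. indicator (cell n) x *\<^sub>R (real (\<Prod>i\<in>UNIV. n i) *\<^sub>R c))"
    unfolding scaleR_sum_right[symmetric] c ..
  also have "\<dots> = measure lborel (cell n) *\<^sub>R (real (\<Prod>i\<in>UNIV. n i) *\<^sub>R c)"
  proof -
    have "emeasure lborel (cell n) < \<infinity>"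
    proof -
      have "1 \<le> (\<Prod>i\<in>UNIV. n i)" using n by (simp add: Suc_le_eq prod_pos)
      then have "of_nat 1 * emeasure lborel (cell n) \<le> of_nat (\<Prod>i\<in>UNIV. n i) * emeasure lborel (cell n)"
        by (intro mult_right_mono) (simp_all only: of_nat_le_iff zero_le)
      then have "emeasure lborel (cell n) \<le> 1"
        unfolding emeasure_cell[OF n] by simp
      then show ?thesis by (simp add: le_less_trans[OF _ ennreal_one_less_top])
    qed
    then show ?thesis by (subst integral_scaleR_left) (auto intro: integrable_real_indicator)
  qed
  also have "\<dots> = c"
    using measure_cell[of n] n by (simp add: mult.commute del: of_nat_prod)
  finally show ?thesis .
qed

section \<open>Orthogonality of characters\<close>

lemma character_prod: "character k x = (\<Prod>i\<in>UNIV. ex (of_int (k $ i) * x $ i))"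
proof -
  have "character k x = ex (\<Sum>i\<in>UNIV. of_int (k $ i) * x $ i)"
    by (simp add: character_def ex_def cis_conv_exp mult_ac)
  then show ?thesis by (simp add: ex_sum)
qed

lemma character_add: "character k x * character l x = character (k + l) x"
  by (simp add: character_prod prod.distrib[symmetric] ex_add[symmetric] distrib_right)

lemma continuous_character: "continuous_on UNIV (character k)"
  unfolding character_def by (intro continuous_intros)

lemma integral_character: "(LINT x|torus. character k x) = (if k = 0 then 1 else 0)"
proof -
  define b where "b = (\<lambda>i. nat \<bar>k $ i\<bar>)"
  define a :: "int ^ 'a \<Rightarrow> complex" where "a = (\<lambda>l. if l = k then 1 else 0)"
  have kb: "k \<in> freq_box b" by (simp add: freq_box_def b_def)
  have eq: "tpolyd b a = character k"
  proof
    fix x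
    have "tpolyd b a x = (\<Sum>l\<in>freq_box b. if l = k then character k x else 0)"
      unfolding tpolyd_def character_prod by (intro sum.cong) (auto simp: a_def)
    also have "\<dots> = character k x" using kb by (subst sum.delta) auto
    finally show "tpolyd b a x = character k x" .
  qed
  have "(LINT x|torus. tpolyd b a x) = a 0"
    by (rule torus_integral_periodic_sum[OF continuous_tpolyd, of "\<lambda>i. b i + 1"])
      (auto simp: tpolyd_mean scaleR_conv_of_real)
  then show ?thesis unfolding eq by (auto simp: a_def)
qed

lemma tpolyd_character: "tpolyd b a x = (\<Sum>k\<in>freq_box b. a k * character k x)"
  by (simp add: tpolyd_def character_prod)

lemma integrable_character [simp]: "integrable torus (character k)"
  by (rule integrable_torus_continuous[OF continuous_character])

lemma integral_tpolyd_character: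
  "(LINT x|torus. tpolyd b a x * character (- k) x) = (if k \<in> freq_box b then a k else 0)"
proof -
  have "(LINT x|torus. tpolyd b a x * character (- k) x) =
      (LINT x|torus. (\<Sum>l\<in>freq_box b. a l * character (l - k) x))"
    by (simp add: tpolyd_character sum_distrib_right mult.assoc character_add)
  also have "\<dots> = (\<Sum>l\<in>freq_box b. a l * (if l - k = 0 then 1 else 0))"
    by (subst Bochner_Integration.integral_sum) (auto simp: integral_character)
  also have "\<dots> = (\<Sum>l\<in>freq_box b. if l = k then a k else 0)"
    by (intro sum.cong) auto
  also have "\<dots> = (if k \<in> freq_box b then a k else 0)"
    by (subst sum.delta) auto
  finally show ?thesis .
qed

text \<open>Nonnegative, of mean 1 and of degree below \<open>b\<close>: it serves to identify the
  pointwise limit of the dyadic series.\<close>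

definition fejer :: "nat \<Rightarrow> real \<Rightarrow> real" where
  "fejer b x = (norm (dirichlet {0..<int b} x))\<^sup>2 / real b"

lemma fejer_nonneg: "0 \<le> fejer b x"
  by (simp add: fejer_def)

lemma fejer_minus: "fejer b (- x) = fejer b x"
  by (simp add: fejer_def norm_dirichlet_minus)

lemma fejer_mean:
  assumes "b > 0" shows "(\<Sum>z<b. fejer b (x - (y + real z / real b))) = real b"
proof -
  have "fejer b (x - (y + real z / real b)) = fejer b (y - x + real z / real b)" for z
    using fejer_minus[of b "y - x + real z / real b"] by (simp add: algebra_simps)
  then have "(\<Sum>z<b. fejer b (x - (y + real z / real b))) = (\<Sum>z<b. fejer b (y - x + real z / real b))"
    by simp
  also have "\<dots> = real b"
    unfolding fejer_def sum_divide_distrib[symmetric] dirichlet_def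
    by (subst parseval_grid[OF assms, of _ 0]) (use assms in auto)
  finally show ?thesis .
qed

text \<open>The Dirichlet kernel times \<open>ex x - 1\<close> telescopes to
  \<open>ex x ^ b - 1\<close>, whose modulus is at most 2.\<close>

lemma fejer_tail: 
  assumes "b > 0" shows "fejer b x * (norm (ex x - 1))\<^sup>2 \<le> 4 / real b"
proof -
  have "dirichlet {0..<int b} x = (\<Sum>l<b. ex x ^ l)"
    unfolding dirichlet_def tpoly_def
    by (rule sum.reindex_bij_witness[where i = int and j = nat]) (auto simp: ex_power)
  then have "dirichlet {0..<int b} x * (ex x - 1) = ex x ^ b - 1"
    by (simp add: power_diff_1_eq mult.commute)
  then have "(norm (dirichlet {0..<int b} x))\<^sup>2 * (norm (ex x - 1))\<^sup>2 = (norm (ex x ^ b - 1))\<^sup>2"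
    by (metis norm_mult power_mult_distrib)
  also have "\<dots> \<le> 2\<^sup>2"
    using norm_triangle_ineq4[of "ex x ^ b" 1] by (intro power_mono) (auto simp: norm_power)
  finally show ?thesis using assms by (simp add: fejer_def divide_simps)
qed

lemma continuous_fejer: "continuous_on UNIV (\<lambda>y :: real ^ 'd::finite. fejer b (x $ i - y $ i))"
  unfolding fejer_def dirichlet_def tpoly_def ex_def cis_conv_exp
  by (cases "b = 0") (auto intro!: continuous_intros)

lemma band_fejer: "band b (\<lambda>x. complex_of_real (fejer b x))"
proof -
  have "(\<lambda>x. complex_of_real (fejer b x)) =
      (\<lambda>x. (1 / of_nat b) * (\<Sum>l\<in>{0..<int b}. \<Sum>l'\<in>{0..<int b}. 1 * ex (of_int (l - l') * x)))"
    by (intro ext) (simp only: fejer_def of_real_divide norm_dirichlet_sq, simp)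
  moreover have "band b \<dots>" by (intro band_cmult band_double_sum) auto
  ultimately show ?thesis by simp
qed

definition fejerd :: "nat \<Rightarrow> real ^ 'd::finite \<Rightarrow> real ^ 'd \<Rightarrow> real" where
  "fejerd b x y = (\<Prod>i\<in>UNIV. fejer b (x $ i - y $ i))"

lemma fejerd_nonneg: "0 \<le> fejerd b x y"
  by (simp add: fejerd_def prod_nonneg fejer_nonneg)

lemma continuous_fejerd: "continuous_on UNIV (fejerd b x)"
  unfolding fejerd_def by (intro continuous_on_prod continuous_fejer)

text \<open>The set \<open>I\<close> allows a coordinate to be left out, as
  \<open>integral_fejerd_tail\<close> does.\<close>

lemma integral_fejer_prod:
  fixes x :: "real ^ 'd::finite"
  assumes b: "b > 0"
  shows "(LINT y|torus. (\<Prod>i\<in>UNIV. if i \<in> I then fejer b (x $ i - y $ i) else 1)) = 1"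
proof (rule torus_integral_periodic_sum[where n = "\<lambda>_. b"])
  show "continuous_on UNIV (\<lambda>y. \<Prod>i\<in>UNIV. if i \<in> I then fejer b (x $ i - y $ i) else 1)"
  proof (intro continuous_on_prod)
    fix i
    show "continuous_on UNIV (\<lambda>y :: real ^ 'd. if i \<in> I then fejer b (x $ i - y $ i) else 1)"
      by (cases "i \<in> I") (auto intro: continuous_fejer)
  qed
  fix y :: "real ^ 'd"
  have "(\<Sum>z\<in>grid (\<lambda>_. b). \<Prod>i\<in>UNIV. if i \<in> I then fejer b (x $ i - gpt (\<lambda>_. b) y z $ i) else 1) =
      (\<Prod>i\<in>UNIV. \<Sum>z<b. if i \<in> I then fejer b (x $ i - (y $ i + real z / real b)) else 1)"
    unfolding gpt_def vec_lambda_beta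
    by (rule sum_grid_prod[of "\<lambda>i z. if i \<in> I then fejer b (x $ i - (y $ i + real z / real b)) else 1"])
  also have "\<dots> = (\<Prod>i\<in>(UNIV :: 'd set). real b)"
  proof (intro prod.cong refl)
    fix i
    show "(\<Sum>z<b. if i \<in> I then fejer b (x $ i - (y $ i + real z / real b)) else 1) = real b"
      by (cases "i \<in> I") (simp_all add: fejer_mean[OF b])
  qed
  finally show "(\<Sum>z\<in>grid (\<lambda>_. b). \<Prod>i\<in>UNIV. if i \<in> I then fejer b (x $ i - gpt (\<lambda>_. b) y z $ i) else 1) =
     real (\<Prod>i\<in>(UNIV :: 'd set). b) *\<^sub>R 1" by simp
qed (use b in auto)

lemma integral_fejerd: "b > 0 \<Longrightarrow> (LINT y|torus. fejerd b x y) = 1"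
  using integral_fejer_prod[of b UNIV x] by (simp add: fejerd_def)

lemma integral_fejerd_tail:
  fixes x :: "real ^ 'd::finite"
  assumes b: "b > 0"
  shows "(LINT y|torus. fejerd b x y * (norm (ex (x $ i - y $ i) - 1))\<^sup>2) \<le> 4 / real b"
proof -
  let ?r = "\<lambda>y. \<Prod>j\<in>UNIV. if j \<in> - {i} then fejer b (x $ j - y $ j) else 1"
  have r: "fejerd b x y = fejer b (x $ i - y $ i) * ?r y" for y
  proof -
    have "fejerd b x y = fejer b (x $ i - y $ i) * (\<Prod>j\<in>UNIV - {i}. fejer b (x $ j - y $ j))"
      unfolding fejerd_def by (rule prod.remove) auto
    also have "(\<Prod>j\<in>UNIV - {i}. fejer b (x $ j - y $ j)) = ?r y"
      by (rule prod.mono_neutral_cong_left) auto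
    finally show ?thesis .
  qed
  have cr: "continuous_on UNIV ?r"
  proof (intro continuous_on_prod)
    fix j
    show "continuous_on UNIV (\<lambda>y :: real ^ 'd. if j \<in> - {i} then fejer b (x $ j - y $ j) else 1)"
      by (cases "j \<in> - {i}") (auto intro: continuous_fejer)
  qed
  have ce: "continuous_on UNIV (\<lambda>y :: real ^ 'd. (norm (ex (x $ i - y $ i) - 1))\<^sup>2)"
    unfolding ex_def cis_conv_exp by (intro continuous_intros)
  have "(LINT y|torus. fejerd b x y * (norm (ex (x $ i - y $ i) - 1))\<^sup>2) \<le> (LINT y|torus. (4 / real b) * ?r y)"
  proof (rule integral_mono)
    show "integrable torus (\<lambda>y. fejerd b x y * (norm (ex (x $ i - y $ i) - 1))\<^sup>2)"
      by (intro integrable_torus_continuous continuous_on_mult continuous_fejerd ce)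
    show "integrable torus (\<lambda>y. 4 / real b * ?r y)"
      by (intro integrable_torus_continuous continuous_on_mult cr continuous_on_const)
    fix y
    have "0 \<le> ?r y" by (intro prod_nonneg) (auto simp: fejer_nonneg)
    then have "(fejer b (x $ i - y $ i) * (norm (ex (x $ i - y $ i) - 1))\<^sup>2) * ?r y \<le> (4 / real b) * ?r y"
      by (intro mult_right_mono fejer_tail b)
    then show "fejerd b x y * (norm (ex (x $ i - y $ i) - 1))\<^sup>2 \<le> 4 / real b * ?r y"
      unfolding r by (simp only: mult_ac)
  qed
  also have "\<dots> = 4 / real b"
    using integral_fejer_prod[OF b, of "- {i}" x] by (simp only: integral_mult_right_zero mult_1_right)
  finally show ?thesis .
qed

text \<open>The kernel has frequencies in the box only, so a Fejer mean sees no other Fourier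
  coefficient of \<open>u\<close>.\<close>

lemma fejerd_orthogonal:
  fixes u :: "real ^ 'd::finite \<Rightarrow> complex"
  assumes u: "continuous_on UNIV u"
    and orth: "\<And>k. k \<in> freq_box (\<lambda>_. b) \<Longrightarrow> (LINT y|torus. u y * character (- k) y) = 0"
  shows "(LINT y|torus. u y * complex_of_real (fejerd b x y)) = 0"
proof -
  obtain a where a: "(\<lambda>x. complex_of_real (fejer b x)) = tpoly {- int b..int b} a"
    using band_fejer[of b] unfolding band_def by blast
  let ?P = "PiE (UNIV :: 'd set) (\<lambda>_. {- int b..int b})"
  have f: "complex_of_real (fejerd b x y) =
     (\<Sum>k\<in>?P. (\<Prod>i\<in>UNIV. a (k i) * ex (of_int (k i) * x $ i)) * character (- (\<chi> i. k i)) y)" for y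
  proof -
    have "complex_of_real (fejerd b x y) =
        (\<Prod>i\<in>UNIV. \<Sum>l\<in>{- int b..int b}. a l * ex (of_int l * (x $ i - y $ i)))"
      unfolding fejerd_def of_real_prod using fun_cong[OF a] by (simp add: tpoly_def)
    also have "\<dots> = (\<Sum>k\<in>?P. \<Prod>i\<in>UNIV. a (k i) * ex (of_int (k i) * (x $ i - y $ i)))"
      by (rule prod_sum_PiE) auto
    also have "\<dots> = (\<Sum>k\<in>?P. (\<Prod>i\<in>UNIV. a (k i) * ex (of_int (k i) * x $ i)) * character (- (\<chi> i. k i)) y)"
      unfolding character_prod prod.distrib[symmetric]
      by (intro sum.cong prod.cong refl) (simp add: ex_add[symmetric] algebra_simps)
    finally show ?thesis .
  qed
  have int: "integrable torus (\<lambda>y. u y * character k y)" for k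
    by (intro integrable_torus_continuous continuous_on_mult u continuous_character)
  have "(LINT y|torus. u y * complex_of_real (fejerd b x y)) =
     (LINT y|torus. (\<Sum>k\<in>?P. (\<Prod>i\<in>UNIV. a (k i) * ex (of_int (k i) * x $ i)) * (u y * character (- (\<chi> i. k i)) y)))"
    unfolding f sum_distrib_left by (simp only: mult_ac)
  also have "\<dots> = (\<Sum>k\<in>?P. (\<Prod>i\<in>UNIV. a (k i) * ex (of_int (k i) * x $ i)) * (LINT y|torus. u y * character (- (\<chi> i. k i)) y))"
    using int by (subst Bochner_Integration.integral_sum) auto
  also have "\<dots> = 0"
  proof (intro sum.neutral ballI)
    fix k assume "k \<in> ?P"
    then have "(\<chi> i. k i) \<in> freq_box (\<lambda>_. b)"
      by (auto simp: freq_box_def PiE_UNIV abs_le_iff) (smt (verit))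
    then show "(\<Prod>i\<in>UNIV. a (k i) * ex (of_int (k i) * x $ i)) * (LINT y|torus. u y * character (- (\<chi> i. k i)) y) = 0"
      by (simp add: orth)
  qed
  finally show ?thesis .
qed

lemma norm_fejerd_mean_le:
  assumes u: "continuous_on UNIV u" and \<epsilon>: "\<And>y. norm (u y) \<le> \<epsilon>" and b: "b > 0"
  shows "norm (LINT y|torus. u y * complex_of_real (fejerd b x y)) \<le> \<epsilon>"
proof -
  have cf: "continuous_on UNIV (\<lambda>y. complex_of_real (fejerd b x y))"
    by (intro continuous_on_of_real continuous_fejerd)
  have "norm (LINT y|torus. u y * complex_of_real (fejerd b x y)) \<le> (LINT y|torus. norm (u y * complex_of_real (fejerd b x y)))"
    by (rule integral_norm_bound)
  also have "\<dots> \<le> (LINT y|torus. \<epsilon> * fejerd b x y)"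
  proof (rule integral_mono)
    show "integrable torus (\<lambda>y. norm (u y * complex_of_real (fejerd b x y)))"
      by (intro integrable_torus_continuous continuous_on_norm continuous_on_mult u cf)
    show "integrable torus (\<lambda>y. \<epsilon> * fejerd b x y)"
      by (intro integrable_torus_continuous continuous_on_mult continuous_on_const continuous_fejerd)
    show "norm (u y * complex_of_real (fejerd b x y)) \<le> \<epsilon> * fejerd b x y" for y
      using \<epsilon>[of y] fejerd_nonneg[of b x y] by (simp add: norm_mult mult_right_mono)
  qed
  also have "\<dots> = \<epsilon>" using integral_fejerd[OF b, of x] by simp
  finally show ?thesis .
qed

lemma periodic_int_shift:
  fixes u :: "real ^ 'd::finite \<Rightarrow> 'b"
  assumes u: "periodic u"
  shows "u (x + (\<chi> i. of_int (k i))) = u x"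
proof -
  have nat: "u (x + real m *\<^sub>R axis i 1) = u x" for x m i
  proof (induction m)
    case (Suc m)
    have "u (x + real (Suc m) *\<^sub>R axis i 1) = u ((x + real m *\<^sub>R axis i 1) + axis i 1)"
      by (simp add: algebra_simps)
    also have "\<dots> = u (x + real m *\<^sub>R axis i 1)"
      using u by (simp only: periodic_def)
    finally show ?case using Suc.IH by simp
  qed simp
  have int: "u (x + of_int m *\<^sub>R axis i 1) = u x" for x m i
  proof (cases "m \<ge> 0")
    case True
    then show ?thesis using nat[of x "nat m" i] by simp
  next
    case False
    then show ?thesis using nat[of "x + of_int m *\<^sub>R axis i 1" "nat (- m)" i]
      by (simp add: algebra_simps flip: scaleR_add_left)
  qed
  have "u (x + (\<Sum>i\<in>I. of_int (k i) *\<^sub>R axis i 1)) = u x" if "finite I" for I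
    using that
  proof (induction I rule: finite_induct)
    case (insert i I)
    have "u (x + (\<Sum>i\<in>insert i I. of_int (k i) *\<^sub>R axis i 1)) =
        u ((x + (\<Sum>i\<in>I. of_int (k i) *\<^sub>R axis i 1)) + of_int (k i) *\<^sub>R axis i 1)"
      using insert by (simp add: algebra_simps)
    then show ?case using int insert.IH by simp
  qed simp
  moreover have "(\<Sum>i\<in>UNIV. of_int (k i) *\<^sub>R axis i 1) = ((\<chi> i. of_int (k i)) :: real ^ 'd)"
    by (simp add: vec_eq_iff axis_def sum_component if_distrib sum.delta cong: if_cong)
  ultimately show ?thesis using finite_class.finite_UNIV by fastforce
qed

text \<open>Close to \<open>x\<close> modulo 1 continuity gives \<open>\<epsilon>\<close>; elsewhere
  some \<open>norm (ex (x $ i - y $ i) - 1)\<close> is bounded below and \<open>C\<close> absorbs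
  the supremum. The quadratic remainder is what \<open>integral_fejerd_tail\<close> can
  integrate.\<close>

lemma periodic_local_bound:
  fixes u :: "real ^ 'd::finite \<Rightarrow> complex"
  assumes u: "continuous_on UNIV u" "periodic u" and \<epsilon>: "\<epsilon> > 0"
  shows "\<exists>C\<ge>0. \<forall>y\<in>cube. norm (u y - u x) \<le> \<epsilon> + C * (\<Sum>i\<in>UNIV. (norm (ex (x $ i - y $ i) - 1))\<^sup>2)"
proof -
  have "compact (u ` cbox 0 1)"
    using u(1) by (intro compact_continuous_image) (auto intro: continuous_on_subset)
  then have "bounded (u ` cbox 0 1)" by (rule compact_imp_bounded)
  then obtain M0 where M0: "\<And>y. y \<in> cbox 0 1 \<Longrightarrow> norm (u y) \<le> M0"
    unfolding bounded_iff by blast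
  define M where "M = M0 + norm (u x)"
  have M: "norm (u y - u x) \<le> M" if "y \<in> cube" for y
  proof -
    have "y \<in> cbox 0 1" using that by (auto simp: cube_def mem_box_cart less_imp_le)
    then show ?thesis using M0[of y] norm_triangle_ineq4[of "u y" "u x"] by (simp add: M_def)
  qed
  have "isCont u x" using u(1) by (simp add: continuous_on_eq_continuous_at)
  then obtain \<delta> where \<delta>: "\<delta> > 0" "\<And>y. norm (y - x) < \<delta> \<Longrightarrow> norm (u y - u x) < \<epsilon>"
    using \<epsilon> unfolding continuous_at_eps_delta dist_norm by blast
  \<comment> \<open>Coordinates within \<open>\<eta>\<close> keep the sum of their moduli below
    \<open>\<delta>\<close>; the bound 1/2 keeps \<open>pi * \<eta>\<close> where the sine
    increases.\<close>
  define \<eta> where "\<eta> = min (\<delta> / (2 * real CARD('d))) (1/2)"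
  have \<eta>: "0 < \<eta>" "\<eta> \<le> 1/2" "\<eta> * real CARD('d) < \<delta>"
  proof -
    show "0 < \<eta>" "\<eta> \<le> 1/2" using \<delta> by (auto simp: \<eta>_def)
    have "\<eta> * real CARD('d) \<le> \<delta> / (2 * real CARD('d)) * real CARD('d)"
      by (intro mult_right_mono) (auto simp: \<eta>_def)
    also have "\<dots> < \<delta>" using \<delta> by simp
    finally show "\<eta> * real CARD('d) < \<delta>" .
  qed
  \<comment> \<open>A lower bound for \<open>norm (ex w - 1)\<close> when
    \<open>\<eta> \<le> \<bar>w\<bar> \<le> 1/2\<close>.\<close>
  define s where "s = 2 * sin (pi * \<eta>)"
  have s: "s > 0" using \<eta> by (auto simp: s_def intro!: sin_gt_zero mult_pos_pos) 
  have M_nn: "M \<ge> 0"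
  proof -
    have "(0 :: real ^ 'd) \<in> cube" by (simp add: cube_def)
    then show ?thesis using M order_trans norm_ge_zero by blast
  qed
  show ?thesis
  proof (intro exI[of _ "M / s\<^sup>2"] conjI ballI)
    show "0 \<le> M / s\<^sup>2" using M_nn by simp
    fix y :: "real ^ 'd" assume y: "y \<in> cube"
    let ?t = "\<Sum>i\<in>UNIV. (norm (ex (x $ i - y $ i) - 1))\<^sup>2"
    have t0: "0 \<le> ?t" by (intro sum_nonneg) auto
    \<comment> \<open>Passes to the representative of \<open>y\<close> modulo 1 nearest to
      \<open>x\<close> in each coordinate.\<close>
    define k where "k = (\<lambda>i. round (x $ i - y $ i))"
    define y' where "y' = y + (\<chi> i. of_int (k i))"
    have uy: "u y' = u y" unfolding y'_def by (rule periodic_int_shift[OF u(2)])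
    show "norm (u y - u x) \<le> \<epsilon> + M / s\<^sup>2 * ?t"
    proof (cases "\<forall>i. \<bar>x $ i - y' $ i\<bar> \<le> \<eta>")
      case True
      have "norm (y' - x) \<le> (\<Sum>i\<in>UNIV. \<bar>(y' - x) $ i\<bar>)" by (rule norm_le_l1_cart)
      also have "\<dots> \<le> (\<Sum>i\<in>(UNIV :: 'd set). \<eta>)"
        using True by (intro sum_mono) (auto simp: abs_minus_commute)
      also have "\<dots> < \<delta>" using \<eta> by (simp add: mult.commute)
      finally have "norm (u y - u x) < \<epsilon>" using \<delta>(2) uy by metis
      moreover have "0 \<le> M / s\<^sup>2 * ?t" using M_nn t0 by simp
      ultimately show ?thesis by linarith
    next
      case False
      then obtain i where i: "\<eta> < \<bar>x $ i - y' $ i\<bar>" by (auto simp: not_le)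
      let ?w = "x $ i - y' $ i"
      have w: "?w = (x $ i - y $ i) - of_int (k i)" by (simp add: y'_def)
      have half: "\<bar>?w\<bar> \<le> 1/2"
        using of_int_round_abs_le[of "x $ i - y $ i"] by (simp add: w k_def abs_minus_commute)
      have "ex (x $ i - y $ i) = ex (?w + of_int (k i))" by (simp add: w)
      also have "\<dots> = ex ?w" by (simp only: ex_add ex_of_int mult_1_right)
      finally have "norm (ex (x $ i - y $ i) - 1) = 2 * \<bar>sin (pi * ?w)\<bar>" by (simp only: norm_ex_diff)
      also have "\<bar>sin (pi * ?w)\<bar> = \<bar>sin (pi * \<bar>?w\<bar>)\<bar>"
      proof -
        have "\<bar>sin (pi * v)\<bar> = \<bar>sin (pi * \<bar>v\<bar>)\<bar>" for v :: real by (cases "v \<ge> 0") auto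
        then show ?thesis .
      qed
      finally have eq: "norm (ex (x $ i - y $ i) - 1) = 2 * \<bar>sin (pi * \<bar>?w\<bar>)\<bar>" .
      have "sin (pi * \<eta>) \<le> \<bar>sin (pi * \<bar>?w\<bar>)\<bar>"
      proof -
        have "sin (pi * \<eta>) \<le> sin (pi * \<bar>?w\<bar>)"
        proof (rule sin_monotone_2pi_le)
          show "- (pi / 2) \<le> pi * \<eta>"
          proof -
            have "0 \<le> pi * \<eta>" using \<eta> by simp
            then show ?thesis using pi_gt_zero by linarith
          qed
          show "pi * \<eta> \<le> pi * \<bar>?w\<bar>" using i by simp
          show "pi * \<bar>?w\<bar> \<le> pi / 2" using mult_left_mono[OF half, of pi] by simp
        qed
        then show ?thesis by linarith
      qed
      then have "s \<le> norm (ex (x $ i - y $ i) - 1)" by (simp only: s_def eq)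
      then have "s\<^sup>2 \<le> (norm (ex (x $ i - y $ i) - 1))\<^sup>2" using s by (intro power_mono) auto
      also have "\<dots> \<le> ?t" by (rule member_le_sum) auto
      finally have "M / s\<^sup>2 * s\<^sup>2 \<le> M / s\<^sup>2 * ?t" using M_nn by (intro mult_left_mono) auto
      then have "M \<le> M / s\<^sup>2 * ?t" using s by simp
      then show ?thesis using M[OF y] \<epsilon> by linarith
    qed
  qed
qed

lemma fejerd_converges:
  fixes u :: "real ^ 'd::finite \<Rightarrow> complex"
  assumes u: "continuous_on UNIV u" "periodic u" and \<epsilon>: "\<epsilon> > 0"
  shows "\<exists>b0. \<forall>b\<ge>b0. norm ((LINT y|torus. u y * complex_of_real (fejerd b x y)) - u x) \<le> \<epsilon>"
proof -
  let ?e = "\<lambda>i y. (norm (ex (x $ i - y $ i) - 1))\<^sup>2"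
  obtain C where C: "C \<ge> 0" "\<And>y. y \<in> cube \<Longrightarrow> norm (u y - u x) \<le> \<epsilon> / 2 + C * (\<Sum>i\<in>UNIV. ?e i y)"
    using periodic_local_bound[OF u, of "\<epsilon> / 2" x] \<epsilon> by auto
  \<comment> \<open>Makes the tail \<open>C * CARD('d) * 4 / b\<close> at most
    \<open>\<epsilon> / 2\<close>.\<close>
  obtain b0 where b0: "8 * C * real CARD('d) / \<epsilon> < real b0" using reals_Archimedean2 by blast
  show ?thesis
  proof (intro exI[of _ "max 1 b0"] allI impI)
    fix b assume "max 1 b0 \<le> b"
    then have b: "b > 0" "b0 \<le> b" by auto
    let ?F = "fejerd b x"
    have cF: "continuous_on UNIV (\<lambda>y. complex_of_real (?F y))"
      by (intro continuous_on_of_real continuous_fejerd)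
    have ce: "continuous_on UNIV (\<lambda>y :: real ^ 'd. ?e i y)" for i
      unfolding ex_def cis_conv_exp by (intro continuous_intros)
    have i1: "integrable torus (\<lambda>y. u y * complex_of_real (?F y))"
      by (intro integrable_torus_continuous continuous_on_mult u cF)
    have i2: "integrable torus (\<lambda>y. complex_of_real (?F y))"
      by (intro integrable_torus_continuous cF)
    have i3: "integrable torus ?F" by (intro integrable_torus_continuous continuous_fejerd)
    have i4: "integrable torus (\<lambda>y. ?F y * ?e i y)" for i
      by (intro integrable_torus_continuous continuous_on_mult continuous_fejerd ce)
    have "(LINT y|torus. complex_of_real (?F y)) = 1"
      using integral_fejerd[OF b(1), of x] by simp
    then have "(LINT y|torus. u y * complex_of_real (?F y)) - u x =
       (LINT y|torus. u y * complex_of_real (?F y)) - (LINT y|torus. u x * complex_of_real (?F y))"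
      by simp
    also have "\<dots> = (LINT y|torus. (u y - u x) * complex_of_real (?F y))"
      using i1 i2 by (subst Bochner_Integration.integral_diff[symmetric]) (auto simp: left_diff_distrib)
    finally have "norm ((LINT y|torus. u y * complex_of_real (?F y)) - u x) \<le>
        (LINT y|torus. norm ((u y - u x) * complex_of_real (?F y)))"
      by (simp only: integral_norm_bound)
    also have "\<dots> \<le> (LINT y|torus. \<epsilon> / 2 * ?F y + C * (\<Sum>i\<in>UNIV. ?F y * ?e i y))"
    proof (rule integral_mono)
      show "integrable torus (\<lambda>y. norm ((u y - u x) * complex_of_real (?F y)))"
        by (intro integrable_torus_continuous continuous_on_norm continuous_on_mult continuous_on_diff
            continuous_on_const u cF)
      show "integrable torus (\<lambda>y. \<epsilon> / 2 * ?F y + C * (\<Sum>i\<in>UNIV. ?F y * ?e i y))"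
        using i3 i4 by auto
      fix y :: "real ^ 'd" assume "y \<in> space torus"
      then have "norm (u y - u x) * ?F y \<le> (\<epsilon> / 2 + C * (\<Sum>i\<in>UNIV. ?e i y)) * ?F y"
        by (intro mult_right_mono C fejerd_nonneg) (simp add: space_torus)
      also have "\<dots> = \<epsilon> / 2 * ?F y + C * (\<Sum>i\<in>UNIV. ?F y * ?e i y)"
        by (simp add: distrib_left sum_distrib_left mult_ac)
      finally show "norm ((u y - u x) * complex_of_real (?F y)) \<le> \<epsilon> / 2 * ?F y + C * (\<Sum>i\<in>UNIV. ?F y * ?e i y)"
        by (simp add: norm_mult fejerd_nonneg)
    qed
    also have "\<dots> = \<epsilon> / 2 + C * (\<Sum>i\<in>UNIV. LINT y|torus. ?F y * ?e i y)"
      using i3 i4 integral_fejerd[OF b(1), of x]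
      by (subst Bochner_Integration.integral_add) (auto simp: Bochner_Integration.integral_sum)
    also have "\<dots> \<le> \<epsilon> / 2 + C * (\<Sum>i\<in>(UNIV :: 'd set). 4 / real b)"
      by (intro add_left_mono mult_left_mono sum_mono integral_fejerd_tail C b)
    also have "\<dots> \<le> \<epsilon>"
    proof -
      have "8 * C * real CARD('d) / \<epsilon> < real b" using b0 b by linarith
      then have "8 * C * real CARD('d) \<le> \<epsilon> * real b" using \<epsilon> by (simp add: field_simps)
      then show ?thesis using b by (simp add: field_simps)
    qed
    finally show "norm ((LINT y|torus. u y * complex_of_real (?F y)) - u x) \<le> \<epsilon>" .
  qed
qed


section \<open>Dyadic decomposition in the Besov space\<close>

lemma cutoff_eq_1:
  assumes "admissible_cutoff \<phi>" "\<bar>x\<bar> \<le> 1" shows "\<phi> x = 1"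
proof -
  have "x \<in> {-1..1}" using assms(2) by auto
  moreover have "\<forall>x\<in>{-1..1}. \<phi> x = 1"
    by (rule assms(1)[unfolded admissible_cutoff_def, THEN conjunct2, THEN conjunct1])
  ultimately show ?thesis by blast
qed

lemma cutoff_support:
  assumes "admissible_cutoff \<phi>" "\<phi> x \<noteq> 0" shows "\<bar>x\<bar> \<le> 2"
proof -
  have "x \<in> closure {x. \<phi> x \<noteq> 0}" 
    by (rule subsetD[OF closure_subset]) (use assms(2) in simp)
  moreover have "closure {x. \<phi> x \<noteq> 0} \<subseteq> {-2..2}"
    by (rule assms(1)[unfolded admissible_cutoff_def, THEN conjunct2, THEN conjunct2])
  ultimately have "x \<in> {-2..2}" by blast
  then show ?thesis by auto
qed

lemma dyadic_cutoff_support: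
  assumes \<phi>: "admissible_cutoff \<phi>" and nz: "dyadic_cutoff \<phi> j x \<noteq> 0"
  shows "\<bar>x\<bar> \<le> 2 ^ (j + 1)"
proof (cases j)
  case 0
  then show ?thesis using cutoff_support[OF \<phi>, of x] nz by (simp add: dyadic_cutoff_def)
next
  case (Suc m)
  then consider "\<phi> (x / 2 ^ j) \<noteq> 0" | "\<phi> (x / 2 ^ m) \<noteq> 0"
    using nz by (cases "\<phi> (x / 2 ^ m) = 0") (auto simp: dyadic_cutoff_def)
  then show ?thesis
  proof cases
    case 1
    then have "\<bar>x / 2 ^ j\<bar> \<le> 2" by (rule cutoff_support[OF \<phi>])
    then show ?thesis by (simp add: abs_divide pos_divide_le_eq)
  next
    case 2
    then have "\<bar>x / 2 ^ m\<bar> \<le> 2" by (rule cutoff_support[OF \<phi>])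
    then have "\<bar>x\<bar> \<le> 2 * 2 ^ m" by (simp add: abs_divide pos_divide_le_eq)
    then show ?thesis using Suc by simp
  qed
qed

lemma sum_dyadic_cutoff: "(\<Sum>j\<le>n. dyadic_cutoff \<phi> j x) = \<phi> (x / 2 ^ n)"
  by (induction n) (auto simp: dyadic_cutoff_def)

definition block_coeff ::
    "(real \<Rightarrow> complex) \<Rightarrow> (real ^ 'd::finite \<Rightarrow> real) \<Rightarrow> nat ^ 'd \<Rightarrow> int ^ 'd \<Rightarrow> complex" where
  "block_coeff \<phi> f j k = (\<Prod>i\<in>UNIV. dyadic_cutoff \<phi> (j $ i) (of_int (k $ i))) * fourier_coeff f k"

lemma block_coeff_eq_0:
  assumes \<phi>: "admissible_cutoff \<phi>" and k: "k \<notin> freq_box (\<lambda>i. 2 ^ (j $ i + 1))"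
  shows "block_coeff \<phi> f j k = 0"
proof -
  obtain i where i: "\<not> \<bar>k $ i\<bar> \<le> int (2 ^ (j $ i + 1))"
    using k by (auto simp: freq_box_def)
  have "dyadic_cutoff \<phi> (j $ i) (of_int (k $ i)) = 0"
  proof (rule ccontr)
    assume "dyadic_cutoff \<phi> (j $ i) (of_int (k $ i)) \<noteq> 0"
    then have "\<bar>real_of_int (k $ i)\<bar> \<le> 2 ^ (j $ i + 1)" by (rule dyadic_cutoff_support[OF \<phi>])
    then have "real_of_int \<bar>k $ i\<bar> \<le> real_of_int (int (2 ^ (j $ i + 1)))" by simp
    then show False using i by (simp only: of_int_le_iff)
  qed
  then show ?thesis by (auto simp: block_coeff_def intro!: prod_zero)
qed

lemma dyadic_block_tpolyd:
  assumes \<phi>: "admissible_cutoff \<phi>"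
  shows "dyadic_block \<phi> j f = tpolyd (\<lambda>i. 2 ^ (j $ i + 1)) (block_coeff \<phi> f j)"
proof
  fix x
  have "dyadic_block \<phi> j f x = (\<Sum>\<^sub>\<infinity>k\<in>UNIV. block_coeff \<phi> f j k * character k x)"
    by (simp add: dyadic_block_def block_coeff_def)
  also have "\<dots> = (\<Sum>\<^sub>\<infinity>k\<in>freq_box (\<lambda>i. 2 ^ (j $ i + 1)). block_coeff \<phi> f j k * character k x)"
    by (rule infsum_cong_neutral) (auto simp: block_coeff_eq_0[OF \<phi>])
  also have "\<dots> = tpolyd (\<lambda>i. 2 ^ (j $ i + 1)) (block_coeff \<phi> f j) x"
    by (simp add: tpolyd_character)
  finally show "dyadic_block \<phi> j f x = tpolyd (\<lambda>i. 2 ^ (j $ i + 1)) (block_coeff \<phi> f j) x" .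
qed

text \<open>Partial sums over boxes, because the cutoffs then telescope separately in each
  coordinate.\<close>

definition idx_box :: "nat \<Rightarrow> (nat ^ 'd::finite) set" where
  "idx_box n = {j. \<forall>i. j $ i \<le> n}"

lemma bij_vec_PiE:
  "bij_betw (\<lambda>f. vec_lambda f :: 'a ^ 'd::finite) (PiE UNIV (\<lambda>_. A)) {j. \<forall>i. j $ i \<in> A}"
  by (rule bij_betw_byWitness[where f' = vec_nth]) (auto simp: PiE_UNIV)

lemma idx_box_PiE: "bij_betw (\<lambda>f. vec_lambda f :: nat ^ 'd::finite) (PiE UNIV (\<lambda>_. {..n})) (idx_box n)"
  using bij_vec_PiE[of "{..n}"] by (simp add: idx_box_def)

lemma finite_idx_box [simp]: "finite (idx_box n :: (nat ^ 'd::finite) set)"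
  using bij_betw_finite[OF idx_box_PiE[where 'd = 'd, of n]] by (simp add: finite_PiE)

lemma sum_block_coeff:
  assumes \<phi>: "admissible_cutoff \<phi>" and k: "\<And>i. \<bar>k $ i\<bar> \<le> 2 ^ n"
  shows "(\<Sum>j\<in>idx_box n. block_coeff \<phi> f j k) = fourier_coeff f k"
proof -
  have one: "\<phi> (of_int (k $ i) / 2 ^ n) = 1" for i
  proof (rule cutoff_eq_1[OF \<phi>])
    have "real_of_int \<bar>k $ i\<bar> \<le> real_of_int (2 ^ n)" using k[of i] by (simp only: of_int_le_iff)
    then show "\<bar>of_int (k $ i) / 2 ^ n\<bar> \<le> (1 :: real)" by (simp add: abs_divide)
  qed
  have "(\<Sum>j\<in>idx_box n. \<Prod>i\<in>UNIV. dyadic_cutoff \<phi> (j $ i) (of_int (k $ i))) =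
     (\<Sum>j\<in>PiE UNIV (\<lambda>_. {..n}). \<Prod>i\<in>UNIV. dyadic_cutoff \<phi> (j i) (of_int (k $ i)))"
    by (subst sum.reindex_bij_betw[OF idx_box_PiE, symmetric]) simp
  also have "\<dots> = (\<Prod>i\<in>UNIV. \<Sum>j\<le>n. dyadic_cutoff \<phi> j (of_int (k $ i)))"
    by (rule prod_sum_PiE[symmetric]) auto
  also have "\<dots> = 1" by (simp add: sum_dyadic_cutoff one)
  finally show ?thesis
    unfolding block_coeff_def sum_distrib_right[symmetric] by simp
qed

definition partial_sum :: "(real \<Rightarrow> complex) \<Rightarrow> (real ^ 'd::finite \<Rightarrow> real) \<Rightarrow> nat \<Rightarrow> real ^ 'd \<Rightarrow> complex" where
  "partial_sum \<phi> f n x = (\<Sum>j\<in>idx_box n. dyadic_block \<phi> j f x)"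

lemma continuous_partial_sum:
  assumes "admissible_cutoff \<phi>" shows "continuous_on UNIV (partial_sum \<phi> f n)"
  unfolding partial_sum_def dyadic_block_tpolyd[OF assms] by (intro continuous_on_sum continuous_tpolyd)

lemma partial_sum_coeff:
  assumes \<phi>: "admissible_cutoff \<phi>" and k: "\<And>i. \<bar>k $ i\<bar> \<le> 2 ^ n"
  shows "(LINT x|torus. partial_sum \<phi> f n x * character (- k) x) = fourier_coeff f k"
proof -
  have int: "integrable torus (\<lambda>x. tpolyd b a x * character (- k) x)" for b a
    by (intro integrable_torus_continuous continuous_on_mult continuous_tpolyd continuous_character)
  have "(LINT x|torus. partial_sum \<phi> f n x * character (- k) x) =
    (\<Sum>j\<in>idx_box n. if k \<in> freq_box (\<lambda>i. 2 ^ (j $ i + 1)) then block_coeff \<phi> f j k else 0)"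
    unfolding partial_sum_def dyadic_block_tpolyd[OF \<phi>] sum_distrib_right
    using int by (subst Bochner_Integration.integral_sum) (auto simp: integral_tpolyd_character)
  also have "\<dots> = (\<Sum>j\<in>idx_box n. block_coeff \<phi> f j k)"
    using block_coeff_eq_0[OF \<phi>] by (intro sum.cong) auto
  finally show ?thesis using sum_block_coeff[OF \<phi> k] by simp
qed

lemma character_shift: "character k (x + axis i 1) = character k x"
proof -
  have "ex (of_int (k $ l) * (x + axis i 1) $ l) = ex (of_int (k $ l) * x $ l)" for l
    by (cases "l = i") (auto simp: axis_def distrib_left ex_add)
  then show ?thesis by (simp add: character_prod)
qed

lemma periodic_partial_sum:
  assumes "admissible_cutoff \<phi>" shows "periodic (partial_sum \<phi> f n)"
  unfolding periodic_def partial_sum_def dyadic_block_tpolyd[OF assms] tpolyd_character character_shift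
  by simp

text \<open>The majorant makes the partial sums uniformly Cauchy, and Fejer means identify the
  limit: for \<open>b \<le> 2 ^ n\<close> the functions \<open>f\<close> and \<open>?S n\<close>
  share all Fourier coefficients in the box, hence the Fejer mean of order \<open>b\<close>.\<close>

lemma partial_sum_converges:
  fixes f :: "real ^ 'd::finite \<Rightarrow> real"
  assumes \<phi>: "admissible_cutoff \<phi>" and f: "continuous_on UNIV f" "periodic f"
    and M: "\<And>j x. norm (dyadic_block \<phi> j f x) \<le> M j"
    and cauchy: "\<And>\<epsilon>. \<epsilon> > 0 \<Longrightarrow> \<exists>m. \<forall>n\<ge>m. (\<Sum>j\<in>idx_box n - idx_box m. M j) \<le> \<epsilon>"
  shows "(\<lambda>n. partial_sum \<phi> f n x) \<longlonglongrightarrow> complex_of_real (f x)"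
proof (rule LIMSEQ_I)
  fix r :: real assume r: "r > 0"
  define \<epsilon> where "\<epsilon> = r / 4"
  have \<epsilon>: "\<epsilon> > 0" using r by (simp add: \<epsilon>_def)
  let ?S = "partial_sum \<phi> f" and ?f = "\<lambda>y. complex_of_real (f y)"
  let ?c = "\<lambda>u b. LINT y|torus. u y * complex_of_real (fejerd b x y)"
  have cS: "continuous_on UNIV (?S n)" for n by (rule continuous_partial_sum[OF \<phi>])
  have cf: "continuous_on UNIV ?f" by (intro continuous_on_of_real f)
  have pf: "periodic ?f" using f(2) by (simp add: periodic_def)
  have M0: "0 \<le> M j" for j using M[of j 0] norm_ge_zero order_trans by blast
  obtain m where m: "\<And>n. n \<ge> m \<Longrightarrow> (\<Sum>j\<in>idx_box n - idx_box m. M j) \<le> \<epsilon>"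
    using cauchy[OF \<epsilon>] by blast
  show "\<exists>no. \<forall>m'\<ge>no. norm (?S m' x - ?f x) < r"
  proof (intro exI[of _ m] allI impI)
    fix m' assume m': "m' \<ge> m"
    have diff: "norm (?S n y - ?S m' y) \<le> \<epsilon>" if n: "n \<ge> m'" for n y
    proof -
      have sub: "idx_box m' \<subseteq> idx_box n" using n by (auto simp: idx_box_def intro: order_trans)
      have "?S n y - ?S m' y = (\<Sum>j\<in>idx_box n - idx_box m'. dyadic_block \<phi> j f y)"
        unfolding partial_sum_def by (rule sum_diff[OF finite_idx_box sub, symmetric])
      then have "norm (?S n y - ?S m' y) \<le> (\<Sum>j\<in>idx_box n - idx_box m'. M j)"
        by (simp only:) (intro sum_norm_le M)
      also have "\<dots> \<le> (\<Sum>j\<in>idx_box n - idx_box m. M j)"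
      proof (intro sum_mono2)
        show "idx_box n - idx_box m' \<subseteq> idx_box n - idx_box m"
          using m' by (auto simp: idx_box_def intro: order_trans)
      qed (use M0 in auto)
      also have "\<dots> \<le> \<epsilon>" using m n m' by simp
      finally show ?thesis .
    qed
    obtain b1 where b1: "\<And>b. b \<ge> b1 \<Longrightarrow> norm (?c ?f b - ?f x) \<le> \<epsilon>"
      using fejerd_converges[OF cf pf \<epsilon>] by blast
    obtain b2 where b2: "\<And>b. b \<ge> b2 \<Longrightarrow> norm (?c (?S m') b - ?S m' x) \<le> \<epsilon>"
      using fejerd_converges[OF cS periodic_partial_sum[OF \<phi>] \<epsilon>] by blast
    \<comment> \<open>The order of choices matters: \<open>m'\<close> is fixed, then
      \<open>b\<close> makes both Fejer means at \<open>x\<close> accurate, and only then is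
      \<open>n\<close> taken with \<open>2 ^ n\<close> at least \<open>b\<close>.\<close>
    define b where "b = max 1 (max b1 b2)"
    define n where "n = max m' b"
    have b: "b > 0" "b \<ge> b1" "b \<ge> b2" by (auto simp: b_def)
    have n: "n \<ge> m'" "b \<le> 2 ^ n"
    proof -
      have "b < 2 ^ b" by simp
      also have "\<dots> \<le> 2 ^ n" by (intro power_increasing) (auto simp: n_def)
      finally show "b \<le> 2 ^ n" by simp
    qed (simp add: n_def)
    have cF: "continuous_on UNIV (\<lambda>y. complex_of_real (fejerd b x y))"
      by (intro continuous_on_of_real continuous_fejerd)
    have ic: "integrable torus (\<lambda>y. u y * complex_of_real (fejerd b x y))" if "continuous_on UNIV u" for u
      by (intro integrable_torus_continuous continuous_on_mult that cF)
    have "?c (\<lambda>y. ?f y - ?S n y) b = 0"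
    proof (rule fejerd_orthogonal)
      show "continuous_on UNIV (\<lambda>y. ?f y - ?S n y)" by (intro continuous_on_diff cf cS)
      fix k :: "int ^ 'd" assume k: "k \<in> freq_box (\<lambda>_. b)"
      have "\<bar>k $ i\<bar> \<le> 2 ^ n" for i
      proof -
        have "\<bar>k $ i\<bar> \<le> int b" using k by (simp add: freq_box_def)
        also have "\<dots> \<le> int (2 ^ n)" using n(2) by (simp only: of_nat_le_iff)
        finally show ?thesis by simp
      qed
      then have 1: "(LINT y|torus. ?S n y * character (- k) y) = fourier_coeff f k"
        by (rule partial_sum_coeff[OF \<phi>])
      have 2: "(LINT y|torus. ?f y * character (- k) y) = fourier_coeff f k"
        by (simp add: fourier_coeff_def)
      have "(LINT y|torus. (?f y - ?S n y) * character (- k) y) =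
          (LINT y|torus. ?f y * character (- k) y) - (LINT y|torus. ?S n y * character (- k) y)"
        unfolding left_diff_distrib
        by (intro Bochner_Integration.integral_diff integrable_torus_continuous continuous_on_mult cf cS continuous_character)
      then show "(LINT y|torus. (?f y - ?S n y) * character (- k) y) = 0" unfolding 1 2 by simp
    qed
    moreover have "?c (\<lambda>y. ?f y - ?S n y) b = ?c ?f b - ?c (?S n) b"
      unfolding left_diff_distrib by (intro Bochner_Integration.integral_diff ic cf cS)
    ultimately have eq: "?c ?f b = ?c (?S n) b" by simp
    have "norm (?c (\<lambda>y. ?S n y - ?S m' y) b) \<le> \<epsilon>"
      by (intro norm_fejerd_mean_le continuous_on_diff cS diff n b)
    moreover have "?c (\<lambda>y. ?S n y - ?S m' y) b = ?c (?S n) b - ?c (?S m') b"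
      unfolding left_diff_distrib by (intro Bochner_Integration.integral_diff ic cS)
    ultimately have d: "norm (?c ?f b - ?c (?S m') b) \<le> \<epsilon>" unfolding eq by simp
    have tri: "norm (v - w) \<le> norm (c - v) + norm (c' - w) + norm (c' - c)" for v w c c' :: complex
      using dist_triangle[of v w c] dist_triangle[of c w c'] by (simp add: dist_norm norm_minus_commute)
    have "norm (?S m' x - ?f x) \<le> norm (?c (?S m') b - ?S m' x) + norm (?c ?f b - ?f x) + norm (?c ?f b - ?c (?S m') b)"
      by (rule tri)
    also have "\<dots> \<le> \<epsilon> + \<epsilon> + \<epsilon>"
      by (intro add_mono b1 b2 b d)
    also have "\<dots> < r" using r by (simp add: \<epsilon>_def)
    finally show "norm (?S m' x - ?f x) < r" .
  qed
qed

lemma integration_error_le: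
  fixes f :: "real ^ 'd::finite \<Rightarrow> real"
  assumes \<phi>: "admissible_cutoff \<phi>"
    and lim: "\<And>x. (\<lambda>n. partial_sum \<phi> f n x) \<longlonglongrightarrow> complex_of_real (f x)"
    and N: "N > 0"
    and bd: "\<And>n. (\<Sum>j\<in>idx_box n. norm (\<Sum>k<N. dyadic_block \<phi> j f (x k) - block_coeff \<phi> f j 0)) \<le> b"
  shows "\<bar>(LINT y|torus. f y) - (1 / real N) * (\<Sum>k<N. f (x k))\<bar> \<le> b / real N"
proof -
  let ?I = "LINT y|torus. f y"
  have I: "fourier_coeff f 0 = complex_of_real ?I"
    by (simp add: fourier_coeff_def character_def)
  have S: "(\<Sum>k<N. partial_sum \<phi> f n (x k) - complex_of_real ?I) =
      (\<Sum>j\<in>idx_box n. \<Sum>k<N. dyadic_block \<phi> j f (x k) - block_coeff \<phi> f j 0)" for n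
  proof -
    have "complex_of_real ?I = (\<Sum>j\<in>idx_box n. block_coeff \<phi> f j 0)"
      unfolding I[symmetric] by (rule sum_block_coeff[OF \<phi>, symmetric]) simp
    then have "partial_sum \<phi> f n (x k) - complex_of_real ?I =
        (\<Sum>j\<in>idx_box n. dyadic_block \<phi> j f (x k) - block_coeff \<phi> f j 0)" for k
      by (simp add: partial_sum_def sum_subtractf)
    then show ?thesis by (simp only:) (rule sum.swap)
  qed
  have "(\<lambda>n. \<Sum>k<N. partial_sum \<phi> f n (x k) - complex_of_real ?I) \<longlonglongrightarrow>
      (\<Sum>k<N. complex_of_real (f (x k)) - complex_of_real ?I)"
    by (intro tendsto_sum tendsto_diff lim tendsto_const)
  then have "(\<lambda>n. norm (\<Sum>k<N. partial_sum \<phi> f n (x k) - complex_of_real ?I)) \<longlonglongrightarrow>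
      norm (\<Sum>k<N. complex_of_real (f (x k)) - complex_of_real ?I)"
    by (rule tendsto_norm)
  moreover have "norm (\<Sum>k<N. partial_sum \<phi> f n (x k) - complex_of_real ?I) \<le> b" for n
    unfolding S by (rule order_trans[OF norm_sum bd])
  ultimately have "norm (\<Sum>k<N. complex_of_real (f (x k)) - complex_of_real ?I) \<le> b"
    by (intro LIMSEQ_le_const2) auto
  also have "(\<Sum>k<N. complex_of_real (f (x k)) - complex_of_real ?I) =
      complex_of_real ((\<Sum>k<N. f (x k)) - real N * ?I)"
    by (simp add: sum_subtractf)
  finally have "\<bar>(\<Sum>k<N. f (x k)) - real N * ?I\<bar> \<le> b" by (simp only: norm_of_real)
  moreover have "?I - (1 / real N) * (\<Sum>k<N. f (x k)) = - ((\<Sum>k<N. f (x k)) - real N * ?I) / real N"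
    using N by (simp add: field_simps)
  ultimately show ?thesis using N by (simp add: abs_divide divide_right_mono abs_minus_commute)
qed

text \<open>The weighted \<open>q\<close>-norm of the sequence \<open>\<Lambda>\<close> is at most
  1, so on \<open>S\<close> its \<open>q\<close>-th power mean is at most
  \<open>card S powr (- recip q)\<close>. Hoelder's inequality is then
  \<open>weighted_sum_le\<close> with unit weights.\<close>

lemma besov_unit_ball:
  fixes f :: "real ^ 'd::finite \<Rightarrow> real"
  assumes q: "1 \<le> q" and nrm: "besov_norm \<phi> r p q f \<le> 1"
  obtains \<Lambda> where "\<And>j. \<Lambda> j \<ge> 0" "\<And>j. Lp_norm p torus (dyadic_block \<phi> j f) = ennreal (\<Lambda> j)"
    "\<And>S. finite S \<Longrightarrow> S \<noteq> {} \<Longrightarrow>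
      (\<Sum>j\<in>S. 2 powr (r * real (\<Sum>i\<in>UNIV. j $ i)) * \<Lambda> j) \<le> 2 * real (card S) powr (1 - recip q)"
proof -
  define \<Lambda> where "\<Lambda> = (\<lambda>j. enn2real (Lp_norm p torus (dyadic_block \<phi> j f)))"
  let ?L = "\<lambda>j. Lp_norm p torus (dyadic_block \<phi> j f)"
  let ?w = "\<lambda>j :: nat ^ 'd. 2 powr (r * real (\<Sum>i\<in>UNIV. j $ i))"
  have \<Lambda>0: "\<Lambda> j \<ge> 0" for j by (simp add: \<Lambda>_def)
  have holder: "(\<Sum>j\<in>S. ?w j * \<Lambda> j) \<le> 2 * real (card S) powr (1 - recip q)"
    if S: "finite S" "S \<noteq> {}" and pm: "pmean_le (recip q) S (\<lambda>j. ?w j * \<Lambda> j) (real (card S) powr (- recip q))" for S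
  proof -
    have c: "real (card S) > 0" using S by (simp add: card_gt_0_iff)
    have "(\<Sum>j\<in>S. (?w j * \<Lambda> j) * 1) \<le> 2 * real (card S) * 1 powr recip q * real (card S) powr (- recip q)"
      by (rule weighted_sum_le[OF S recip_bounds[OF q]]) (use \<Lambda>0 pm c in auto)
    also have "\<dots> = 2 * real (card S) powr (1 - recip q)"
      using c by (simp add: powr_diff powr_minus divide_inverse)
    finally show ?thesis by simp
  qed
  show ?thesis
  proof (cases "q = \<infinity>")
    case True
    have le1: "ennreal (?w j) * ?L j \<le> 1" for j
    proof -
      have "ennreal (?w j) * ?L j \<le> (SUP j. ennreal (?w j) * ?L j)" by (rule SUP_upper) simp
      also have "\<dots> \<le> 1" using nrm True by (simp add: besov_norm_def)
      finally show ?thesis .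
    qed
    have fin: "?L j \<noteq> \<infinity>" for j
    proof
      assume "?L j = \<infinity>"
      then have "ennreal (?w j) * ?L j = \<infinity>" by (simp add: ennreal_mult_eq_top_iff)
      then show False using le1[of j] by (simp add: top_unique)
    qed
    have eq: "?L j = ennreal (\<Lambda> j)" for j
      using fin[of j] by (simp add: \<Lambda>_def less_top)
    have "?w j * \<Lambda> j \<le> 1" for j
      using le1[of j] \<Lambda>0[of j] unfolding eq by (simp flip: ennreal_mult ennreal_1)
    then show ?thesis
      using True \<Lambda>0 eq by (intro that[of \<Lambda>] holder) (auto simp: pmean_le_def)
  next
    case False
    define Q where "Q = enn2real q"
    have Q: "recip q = 1 / Q" "Q \<ge> 1" using recip_eq[OF q False] by (auto simp: Q_def)
    let ?t = "\<lambda>j :: nat ^ 'd. ennreal (2 powr (r * real (\<Sum>i\<in>UNIV. j $ i) * Q)) * ennreal_powr (?L j) Q"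
    have "ennreal_powr (\<Sum>\<^sub>\<infinity>j\<in>UNIV. ?t j) (1 / Q) \<le> ennreal 1"
      using nrm False Q by (simp add: besov_norm_def Q_def)
    then have "(\<Sum>\<^sub>\<infinity>j\<in>UNIV. ?t j) \<le> ennreal (1 powr Q)"
      by (rule ennreal_powr_le_imp) (use Q in auto)
    then have tot: "(\<Sum>\<^sub>\<infinity>j\<in>UNIV. ?t j) \<le> 1" by simp
    have fs: "(\<Sum>j\<in>S. ?t j) \<le> 1" if "finite S" for S
    proof -
      have "(\<Sum>j\<in>S. ?t j) = (\<Sum>\<^sub>\<infinity>j\<in>S. ?t j)" using that by simp
      also have "\<dots> \<le> (\<Sum>\<^sub>\<infinity>j\<in>UNIV. ?t j)"
        by (rule infsum_mono_neutral) (auto intro: nonneg_summable_on_complete)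
      finally show ?thesis using tot by simp
    qed
    have fin: "?L j \<noteq> \<infinity>" for j
    proof
      assume "?L j = \<infinity>"
      then have "?t j = \<infinity>" by (simp add: ennreal_powr_def ennreal_mult_eq_top_iff)
      then show False using fs[of "{j}"] by (simp add: top_unique)
    qed
    have eq: "?L j = ennreal (\<Lambda> j)" for j
      using fin[of j] by (simp add: \<Lambda>_def less_top)
    have t: "?t j = ennreal ((?w j * \<Lambda> j) powr Q)" for j
      using \<Lambda>0[of j] by (simp add: eq ennreal_powr_def powr_mult powr_powr ennreal_mult)
    have "pmean_le (recip q) S (\<lambda>j. ?w j * \<Lambda> j) (real (card S) powr (- recip q))" if S: "finite S" "S \<noteq> {}" for S
    proof -
      have c: "real (card S) > 0" using S by (simp add: card_gt_0_iff)
      have "(\<Sum>j\<in>S. (?w j * \<Lambda> j) powr Q) \<le> 1"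
        using fs[OF S(1)] unfolding t by (simp add: sum_nonneg flip: ennreal_1)
      also have "1 = real (card S) * (real (card S) powr (- (1 / Q))) powr Q"
      proof -
        have "(real (card S) powr (- (1 / Q))) powr Q = real (card S) powr (- 1)"
          unfolding powr_powr using Q by simp
        then show ?thesis using c by (simp add: powr_minus)
      qed
      finally show ?thesis using Q by (simp add: pmean_le_def)
    qed
    then show ?thesis
      using \<Lambda>0 eq by (intro that[of \<Lambda>] holder) auto
  qed
qed


section \<open>Summation over the dyadic blocks\<close>

abbreviation total :: "nat ^ 'd::finite \<Rightarrow> nat" where
  "total j \<equiv> (\<Sum>i\<in>UNIV. j $ i)"

lemma component_le_total: "j $ i \<le> total j"
  by (rule member_le_sum) auto

lemma card_idx_box: "card (idx_box n :: (nat ^ 'd::finite) set) = (n + 1) ^ CARD('d)"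
  using bij_betw_same_card[OF idx_box_PiE[where 'd = 'd, of n]] by (simp add: card_PiE)

lemma finite_shell: "finite {j :: nat ^ 'd::finite. total j = s}"
  by (rule finite_subset[OF _ finite_idx_box[of s]]) (auto simp: idx_box_def component_le_total)

text \<open>On a shell all coordinates but one determine the last. This is the source of
  \<open>d - 1\<close> in the exponent of the logarithm.\<close>

lemma card_shell: "card {j :: nat ^ 'd::finite. total j = s} \<le> (s + 1) ^ (CARD('d) - 1)"
proof -
  obtain i0 :: 'd where True by blast
  let ?A = "{j :: nat ^ 'd. total j = s}"
  let ?P = "PiE (UNIV - {i0}) (\<lambda>_. {..s})"
  let ?f = "\<lambda>j :: nat ^ 'd. restrict (\<lambda>i. j $ i) (UNIV - {i0})"
  have "inj_on ?f ?A"
  proof (rule inj_onI)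
    fix j j' assume j: "j \<in> ?A" "j' \<in> ?A" and eq: "?f j = ?f j'"
    have e: "j $ i = j' $ i" if "i \<noteq> i0" for i
      using fun_cong[OF eq, of i] that by simp
    have "total j = j $ i0 + (\<Sum>i\<in>UNIV - {i0}. j $ i)" "total j' = j' $ i0 + (\<Sum>i\<in>UNIV - {i0}. j' $ i)"
      by (simp_all add: sum.remove[of UNIV i0])
    moreover have "(\<Sum>i\<in>UNIV - {i0}. j $ i) = (\<Sum>i\<in>UNIV - {i0}. j' $ i)"
      by (intro sum.cong) (auto simp: e)
    ultimately have "j $ i0 = j' $ i0" using j by simp
    with e show "j = j'" by (metis vec_eq_iff)
  qed
  moreover have "?f ` ?A \<subseteq> ?P"
  proof (rule image_subsetI)
    fix j :: "nat ^ 'd" assume "j \<in> ?A"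
    then have "j $ i \<le> s" for i using component_le_total[of j i] by simp
    then show "?f j \<in> ?P" by auto
  qed
  ultimately have "card ?A \<le> card ?P" by (intro card_inj_on_le finite_PiE) auto
  also have "\<dots> = (s + 1) ^ (CARD('d) - 1)" by (simp add: card_PiE card_Diff_singleton)
  finally show ?thesis .
qed

section \<open>Sums of exponentials with polynomial factors\<close>

lemma poly_le_exponential:
  fixes \<kappa> \<epsilon> :: real
  assumes "\<kappa> \<ge> 0" "\<epsilon> > 0"
  shows "\<exists>K>0. \<forall>u::nat. (real u + 1) powr \<kappa> \<le> K * 2 powr (\<epsilon> * real u)"
proof -
  \<comment> \<open>Needed are \<open>\<delta> \<le> 1\<close> for the comparison with
    \<open>1 + \<delta> * u\<close>, and \<open>\<delta> * \<kappa> \<le> \<epsilon> * ln 2\<close>;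
    the \<open>+ 1\<close> avoids a division by 0.\<close>
  define \<delta> where "\<delta> = min 1 (\<epsilon> * ln 2 / (\<kappa> + 1))"
  have \<delta>: "\<delta> > 0" "\<delta> \<le> 1" using assms by (auto simp: \<delta>_def)
  have "\<delta> * \<kappa> \<le> \<epsilon> * ln 2 / (\<kappa> + 1) * (\<kappa> + 1)"
    using assms by (intro mult_mono) (auto simp: \<delta>_def)
  then have \<delta>\<kappa>: "\<delta> * \<kappa> \<le> \<epsilon> * ln 2" using assms by simp
  have "(real u + 1) powr \<kappa> \<le> (1 / \<delta>) powr \<kappa> * 2 powr (\<epsilon> * real u)" for u :: nat
  proof -
    have "\<delta> * (real u + 1) \<le> 1 + \<delta> * real u" using \<delta> by (simp add: algebra_simps)
    also have "\<dots> \<le> exp (\<delta> * real u)" by (rule exp_ge_add_one_self)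
    finally have "real u + 1 \<le> 1 / \<delta> * exp (\<delta> * real u)" using \<delta> by (simp add: field_simps)
    then have "(real u + 1) powr \<kappa> \<le> (1 / \<delta> * exp (\<delta> * real u)) powr \<kappa>"
      using assms by (intro powr_mono2) auto
    also have "\<dots> = (1 / \<delta>) powr \<kappa> * exp (\<delta> * \<kappa> * real u)"
      using \<delta> by (subst powr_mult) (auto simp: exp_powr_real mult_ac)
    also have "exp (\<delta> * \<kappa> * real u) \<le> exp (\<epsilon> * ln 2 * real u)"
      using \<delta>\<kappa> by (simp add: mult_right_mono)
    also have "exp (\<epsilon> * ln 2 * real u) = 2 powr (\<epsilon> * real u)"
      by (simp add: powr_def mult_ac)
    finally show ?thesis by (simp add: mult_left_mono)
  qed
  then show ?thesis using \<delta> by (intro exI[of _ "(1 / \<delta>) powr \<kappa>"]) auto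
qed

lemma powr_nat_mult: "2 powr (c * real n) = (2 powr c) ^ n"
  by (simp add: powr_realpow[symmetric] powr_powr)

text \<open>With \<open>s = M + u\<close> one has \<open>s + 1 \<le> (M + 1) * (u + 1)\<close>; half
  of the exponential decay absorbs the power of \<open>u + 1\<close> and the other half is
  summed.\<close>

lemma tail_sum_bound:
  fixes \<kappa> \<epsilon> :: real
  assumes \<kappa>: "\<kappa> \<ge> 0" and \<epsilon>: "\<epsilon> > 0"
  shows "\<exists>G>0. \<forall>M S. (\<Sum>s\<in>{M..S}. 2 powr (- \<epsilon> * real s) * (real s + 1) powr \<kappa>)
    \<le> G * 2 powr (- \<epsilon> * real M) * (real M + 1) powr \<kappa>"
proof -
  obtain K where K: "K > 0" "\<And>u::nat. (real u + 1) powr \<kappa> \<le> K * 2 powr (\<epsilon> / 2 * real u)"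
    using poly_le_exponential[OF \<kappa>, of "\<epsilon> / 2"] \<epsilon> by auto
  let ?q = "2 powr (- \<epsilon> / 2) :: real"
  have q: "0 < ?q" "?q < 1" using \<epsilon> powr_less_mono[of "- \<epsilon> / 2" 0 "2::real"] by auto
  have "(\<Sum>s\<in>{M..S}. 2 powr (- \<epsilon> * real s) * (real s + 1) powr \<kappa>)
    \<le> K / (1 - ?q) * 2 powr (- \<epsilon> * real M) * (real M + 1) powr \<kappa>" for M S :: nat
  proof -
    let ?c = "2 powr (- \<epsilon> * real M) * (real M + 1) powr \<kappa> * K"
    have "(\<Sum>s\<in>{M..S}. 2 powr (- \<epsilon> * real s) * (real s + 1) powr \<kappa>) \<le> (\<Sum>s\<in>{M..S}. ?c * ?q ^ (s - M))"
    proof (intro sum_mono)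
      fix s assume "s \<in> {M..S}"
      then obtain u where s: "s = M + u" using le_Suc_ex by auto
      have "(real s + 1) powr \<kappa> \<le> ((real M + 1) * (real u + 1)) powr \<kappa>"
        using \<kappa> unfolding s by (intro powr_mono2) (auto simp: algebra_simps)
      also have "\<dots> = (real M + 1) powr \<kappa> * (real u + 1) powr \<kappa>" by (simp add: powr_mult)
      also have "\<dots> \<le> (real M + 1) powr \<kappa> * (K * 2 powr (\<epsilon> / 2 * real u))"
        by (intro mult_left_mono K) auto
      finally have le: "(real s + 1) powr \<kappa> \<le> (real M + 1) powr \<kappa> * (K * 2 powr (\<epsilon> / 2 * real u))" .
      have pw: "2 powr (- \<epsilon> * real s) = 2 powr (- \<epsilon> * real M) * 2 powr (- \<epsilon> * real u)"
        unfolding s powr_add[symmetric] by (simp add: algebra_simps)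
      have "2 powr (- \<epsilon> * real s) * (real s + 1) powr \<kappa> \<le>
          2 powr (- \<epsilon> * real s) * ((real M + 1) powr \<kappa> * (K * 2 powr (\<epsilon> / 2 * real u)))"
        by (rule mult_left_mono[OF le]) simp
      also have "\<dots> = ?c * (2 powr (- \<epsilon> * real u) * 2 powr (\<epsilon> / 2 * real u))"
        unfolding pw by (simp only: mult_ac)
      also have "2 powr (- \<epsilon> * real u) * 2 powr (\<epsilon> / 2 * real u) = ?q ^ u"
        unfolding powr_nat_mult[symmetric] powr_add[symmetric] by (rule arg_cong[where f = "(powr) 2"]) simp
      finally show "2 powr (- \<epsilon> * real s) * (real s + 1) powr \<kappa> \<le> ?c * ?q ^ (s - M)" by (simp add: s)
    qed
    also have "\<dots> = ?c * (\<Sum>s\<in>{M..S}. ?q ^ (s - M))" by (rule sum_distrib_left[symmetric])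
    also have "(\<Sum>s\<in>{M..S}. ?q ^ (s - M)) = (\<Sum>u<Suc S - M. ?q ^ u)"
      by (rule sum.reindex_bij_witness[where i = "\<lambda>u. u + M" and j = "\<lambda>s. s - M"]) auto
    also have "?c * (\<Sum>u<Suc S - M. ?q ^ u) \<le> ?c * (1 / (1 - ?q))"
    proof (intro mult_left_mono)
      have "(\<Sum>u<Suc S - M. ?q ^ u) \<le> (\<Sum>u. ?q ^ u)"
        using q by (intro sum_le_suminf summable_geometric) auto
      also have "\<dots> = 1 / (1 - ?q)" using q by (intro suminf_geometric) auto
      finally show "(\<Sum>u<Suc S - M. ?q ^ u) \<le> 1 / (1 - ?q)" .
    qed (use K in auto)
    finally show ?thesis by (simp add: mult_ac)
  qed
  then show ?thesis using K q by (intro exI[of _ "K / (1 - ?q)"]) auto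
qed

text \<open>A geometric sum with ratio other than 1 is controlled by its larger end, the upper one
  for \<open>r < 1\<close> and the lower one for \<open>r > 1\<close>; the maximum covers
  both.\<close>

lemma low_sum_bound:
  fixes \<kappa> r :: real
  assumes \<kappa>: "\<kappa> \<ge> 0" and r: "r \<noteq> 1"
  shows "(\<Sum>s<M. 2 powr ((1 - r) * real s) * (2 * (real s + 1) powr \<kappa>))
    \<le> 2 / \<bar>1 - 2 powr (1 - r)\<bar> * (real M + 1) powr \<kappa> * max (2 powr ((1 - r) * real M)) 1"
proof -
  let ?x = "2 powr (1 - r) :: real"
  have x: "?x \<noteq> 1" "?x > 0" using r by auto
  have "(\<Sum>s<M. 2 powr ((1 - r) * real s) * (2 * (real s + 1) powr \<kappa>)) \<le>
      (\<Sum>s<M. ?x ^ s * (2 * (real M + 1) powr \<kappa>))"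
    using \<kappa> unfolding powr_nat_mult by (intro sum_mono mult_left_mono powr_mono2) auto
  also have "\<dots> = (\<Sum>s<M. ?x ^ s) * (2 * (real M + 1) powr \<kappa>)"
    by (rule sum_distrib_right[symmetric])
  also have "(\<Sum>s<M. ?x ^ s) \<le> max (?x ^ M) 1 / \<bar>1 - ?x\<bar>"
  proof -
    have "(\<Sum>s<M. ?x ^ s) = (1 - ?x ^ M) / (1 - ?x)" using x by (simp add: sum_gp_strict)
    also have "\<dots> \<le> \<bar>1 - ?x ^ M\<bar> / \<bar>1 - ?x\<bar>" by (metis abs_divide abs_ge_self)
    also have "\<dots> \<le> max (?x ^ M) 1 / \<bar>1 - ?x\<bar>"
      using x by (intro divide_right_mono) (auto simp: abs_if)
    finally show ?thesis .
  qed
  finally show ?thesis unfolding powr_nat_mult by (simp add: mult_right_mono mult_ac)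
qed

lemma shell_sum_le:
  fixes w :: "nat ^ 'd::finite \<Rightarrow> real"
  assumes hb: "\<And>S. finite S \<Longrightarrow> S \<noteq> {} \<Longrightarrow> (\<Sum>j\<in>S. w j) \<le> 2 * real (card S) powr \<tau>"
    and \<tau>: "0 \<le> \<tau>" and A: "finite A" "finite I" "total ` A \<subseteq> I" and F: "\<And>s. 0 \<le> F s"
  shows "(\<Sum>j\<in>A. F (total j) * w j) \<le> (\<Sum>s\<in>I. F s * (2 * (real s + 1) powr ((real CARD('d) - 1) * \<tau>)))"
proof -
  have "(\<Sum>j\<in>A. F (total j) * w j) = (\<Sum>s\<in>I. \<Sum>j\<in>{j \<in> A. total j = s}. F (total j) * w j)"
    by (rule sum.group[symmetric]) (use A in auto)
  also have "\<dots> = (\<Sum>s\<in>I. F s * (\<Sum>j\<in>{j \<in> A. total j = s}. w j))"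
    by (intro sum.cong refl) (simp add: sum_distrib_left)
  also have "\<dots> \<le> (\<Sum>s\<in>I. F s * (2 * (real s + 1) powr ((real CARD('d) - 1) * \<tau>)))"
  proof (intro sum_mono mult_left_mono F)
    fix s
    let ?S = "{j \<in> A. total j = s}"
    show "(\<Sum>j\<in>?S. w j) \<le> 2 * (real s + 1) powr ((real CARD('d) - 1) * \<tau>)"
    proof (cases "?S = {}")
      case True
      show ?thesis unfolding True by simp
    next
      case False
      have "card ?S \<le> card {j :: nat ^ 'd. total j = s}"
        by (rule card_mono[OF finite_shell]) auto
      also have "\<dots> \<le> (s + 1) ^ (CARD('d) - 1)" by (rule card_shell)
      finally have "real (card ?S) \<le> real ((s + 1) ^ (CARD('d) - 1))" by (simp only: of_nat_le_iff)
      also have "\<dots> = (real s + 1) powr real (CARD('d) - 1)"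
        by (subst powr_realpow) (auto simp: add.commute)
      finally have "real (card ?S) powr \<tau> \<le> ((real s + 1) powr real (CARD('d) - 1)) powr \<tau>"
        using \<tau> by (intro powr_mono2) auto
      also have "\<dots> = (real s + 1) powr ((real CARD('d) - 1) * \<tau>)"
        by (simp add: powr_powr of_nat_diff Suc_le_eq)
      finally show ?thesis using hb[of ?S] False A by simp
    qed
  qed
  finally show ?thesis .
qed

section \<open>Estimates for a single dyadic block\<close>

lemma sampled_block:
  fixes f :: "real ^ 'd::finite \<Rightarrow> real"
  assumes \<phi>: "admissible_cutoff \<phi>" and p: "1 \<le> p"
    and L: "Lp_norm p torus (dyadic_block \<phi> j f) = ennreal \<Lambda>" and \<Lambda>: "\<Lambda> \<ge> 0"
  obtains y where "sampled_tpoly (\<lambda>i. j $ i + 1) (block_coeff \<phi> f j) y (recip p) \<Lambda>"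
proof -
  have "Lp_norm p torus (tpolyd (\<lambda>i. 2 ^ (j $ i + 1)) (block_coeff \<phi> f j)) \<le> ennreal \<Lambda>"
    using L unfolding dyadic_block_tpolyd[OF \<phi>] by simp
  then obtain y where "pmean_le (recip p) (grid (\<lambda>i. 4 * 2 ^ (j $ i + 1)))
      (\<lambda>z. norm (tpolyd (\<lambda>i. 2 ^ (j $ i + 1)) (block_coeff \<phi> f j) (gpt (\<lambda>i. 4 * 2 ^ (j $ i + 1)) y z))) \<Lambda>"
    using sampled_exists[OF p _ \<Lambda>, where n = "\<lambda>i. 4 * 2 ^ (j $ i + 1)"] by fastforce
  then have "sampled_tpoly (\<lambda>i. j $ i + 1) (block_coeff \<phi> f j) y (recip p) \<Lambda>"
    by (intro sampled_tpoly.intro recip_bounds p \<Lambda>)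
  then show ?thesis by (rule that)
qed

lemma dyadic_block_sup:
  fixes f :: "real ^ 'd::finite \<Rightarrow> real"
  assumes \<phi>: "admissible_cutoff \<phi>" and p: "1 \<le> p"
    and L: "Lp_norm p torus (dyadic_block \<phi> j f) = ennreal \<Lambda>" and \<Lambda>: "\<Lambda> \<ge> 0"
  shows "norm (dyadic_block \<phi> j f x) \<le>
    2 * 5 ^ CARD('d) * 2 ^ (3 * CARD('d)) * 2 powr (recip p * real (total j)) * \<Lambda>"
proof -
  obtain y where "sampled_tpoly (\<lambda>i. j $ i + 1) (block_coeff \<phi> f j) y (recip p) \<Lambda>"
    by (rule sampled_block[OF assms])
  then interpret sampled_tpoly "\<lambda>i. j $ i + 1" "block_coeff \<phi> f j" y "recip p" \<Lambda> .
  have "V = 2 powr (real (total j) + 3 * real CARD('d))"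
  proof -
    have "(\<Prod>i\<in>UNIV. 4 * 2 ^ (j $ i + 1)) = (\<Prod>i\<in>UNIV. 2 ^ (j $ i) * (8::nat))"
      by (intro prod.cong) auto
    also have "\<dots> = 2 ^ total j * 2 ^ (3 * CARD('d))"
      by (simp add: prod.distrib power_sum power_mult)
    also have "\<dots> = 2 ^ (total j + 3 * CARD('d))" by (simp only: power_add)
    finally have "V = real (2 ^ (total j + 3 * CARD('d)))" by (simp only:)
    then show ?thesis by (simp flip: powr_realpow)
  qed
  then have "V powr recip p = 2 powr (recip p * real (total j)) * 2 powr (recip p * (3 * real CARD('d)))"
    by (simp add: powr_powr powr_add[symmetric] algebra_simps)
  \<comment> \<open>Bounding \<open>recip p\<close> by 1 makes the constant independent of
    \<open>p\<close>.\<close>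
  also have "\<dots> \<le> 2 powr (recip p * real (total j)) * 2 powr (1 * (3 * real CARD('d)))"
    using recip_bounds[OF p] by (intro mult_left_mono powr_mono mult_right_mono) auto
  also have "2 powr (1 * (3 * real CARD('d))) = 2 ^ (3 * CARD('d))"
    by (simp flip: powr_realpow)
  finally have "V powr recip p \<le> 2 ^ (3 * CARD('d)) * 2 powr (recip p * real (total j))" by (simp only: mult_ac)
  then have "2 * 5 ^ CARD('d) * V powr recip p * \<Lambda> \<le>
      2 * 5 ^ CARD('d) * (2 ^ (3 * CARD('d)) * 2 powr (recip p * real (total j))) * \<Lambda>"
    using \<Lambda> by (intro mult_right_mono mult_left_mono) auto
  then show ?thesis
    using sup_bound[of x] unfolding dyadic_block_tpolyd[OF \<phi>] by (simp only: mult.assoc)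
qed

lemma err_const_nonneg: "0 \<le> err_const d"
proof -
  have "(2::real) powr (- 1/2) < 1" using powr_less_mono[of "-1/2" 0 "2::real"] by simp
  then show ?thesis by (simp add: err_const_def walsh_const_def)
qed

text \<open>Per coordinate \<open>lvl\<close> exceeds \<open>j $ i\<close> by 3: 1 from the support
  of the cutoff, 2 from the degree of the kernel. Hence \<open>total j < M\<close> gives
  \<open>lvl + T < L\<close>, the condition of \<open>error_low\<close>; otherwise
  \<open>error_high\<close> applies.\<close>

lemma dyadic_block_error:
  fixes f :: "real ^ 'd::finite \<Rightarrow> real"
  assumes \<phi>: "admissible_cutoff \<phi>" and p: "1 \<le> p"
    and Lp: "Lp_norm p torus (dyadic_block \<phi> j f) = ennreal \<Lambda>" and \<Lambda>: "\<Lambda> \<ge> 0"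
    and seq: "order_digital_seq 2 t E"
    and E: "\<And>i l k. \<lbrakk>1 \<le> l; 2 * l < k\<rbrakk> \<Longrightarrow> E i k l = 0"
    and N: "N \<le> 2 ^ L"
  defines "T \<equiv> (t + 1) div 2"
  defines "M \<equiv> L - T - 3 * CARD('d)"
  shows "norm (\<Sum>k<N. dyadic_block \<phi> j f (digital_seq E k) - block_coeff \<phi> f j 0) \<le>
    err_const CARD('d) * 2 ^ (3 * CARD('d)) *
      (if total j < M then 2 ^ T * 2 powr real (total j)
       else 2 ^ L * 2 powr (recip p * (real (total j) - real M))) * \<Lambda>"
proof -
  let ?e = "err_const CARD('d)" and ?d = "3 * CARD('d)"
  obtain y where "sampled_tpoly (\<lambda>i. j $ i + 1) (block_coeff \<phi> f j) y (recip p) \<Lambda>"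
    by (rule sampled_block[OF \<phi> p Lp \<Lambda>])
  then interpret sampled_tpoly "\<lambda>i. j $ i + 1" "block_coeff \<phi> f j" y "recip p" \<Lambda> .
  have lvl: "lvl = total j + ?d"
    by (simp only: sum.distrib) simp
  let ?err = "norm (\<Sum>k<N. dyadic_block \<phi> j f (digital_seq E k) - block_coeff \<phi> f j 0)"
  show ?thesis
  proof (cases "total j < M")
    case True
    then have "lvl + T < L" unfolding lvl M_def by linarith
    from error_low[OF seq E N this[unfolded T_def]]
    have "?err \<le> ?e * 2 ^ (lvl + T) * \<Lambda>"
      unfolding dyadic_block_tpolyd[OF \<phi>] T_def .
    also have "\<dots> = ?e * 2 ^ ?d * (2 ^ T * 2 powr real (total j)) * \<Lambda>"
    proof -
      have pt: "2 powr real (total j) = 2 ^ total j" by (rule powr_realpow) simp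
      show ?thesis unfolding lvl pt power_add by (simp only: mult_ac)
    qed
    finally show ?thesis using True by simp
  next
    case False
    from error_high[OF seq E N]
    have "?err \<le> ?e * 2 ^ L * (2 ^ (lvl - (L - T))) powr recip p * \<Lambda>"
      unfolding dyadic_block_tpolyd[OF \<phi>] T_def .
    also have "(2 ^ (lvl - (L - T))) powr recip p = 2 powr (recip p * real (lvl - (L - T)))"
      by (simp add: powr_powr mult.commute flip: powr_realpow)
    also have "?e * 2 ^ L * 2 powr (recip p * real (lvl - (L - T))) * \<Lambda> \<le>
       ?e * 2 ^ L * (2 ^ ?d * 2 powr (recip p * (real (total j) - real M))) * \<Lambda>"
    proof (intro mult_right_mono mult_left_mono)
      have "lvl - (L - T) \<le> (total j - M) + ?d" using False unfolding lvl M_def by linarith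
      then have "real (lvl - (L - T)) \<le> real ((total j - M) + ?d)" by (simp only: of_nat_le_iff)
      also have "\<dots> = (real (total j) - real M) + real ?d" using False by (simp add: of_nat_diff)
      finally have "recip p * real (lvl - (L - T)) \<le> recip p * ((real (total j) - real M) + real ?d)"
        using recip_bounds[OF p] by (intro mult_left_mono) auto
      also have "\<dots> \<le> recip p * (real (total j) - real M) + 1 * real ?d"
        using recip_bounds[OF p] unfolding distrib_left by (intro add_left_mono mult_right_mono) auto
      finally have "2 powr (recip p * real (lvl - (L - T))) \<le> 2 powr (recip p * (real (total j) - real M) + real ?d)"
        by (intro powr_mono) auto
      also have "\<dots> = 2 ^ ?d * 2 powr (recip p * (real (total j) - real M))"
      proof -
        have pd: "2 powr real ?d = 2 ^ ?d" by (rule powr_realpow) simp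
        show ?thesis unfolding powr_add pd by (rule mult.commute)
      qed
      finally show "2 powr (recip p * real (lvl - (L - T))) \<le> 2 ^ ?d * 2 powr (recip p * (real (total j) - real M))" .
    qed (use \<Lambda> err_const_nonneg in auto)
    finally show ?thesis using False by (simp add: mult_ac)
  qed
qed

section \<open>From levels to powers of \<open>N\<close> and \<open>t\<close>\<close>

lemma log_level_bound:
  assumes N: "N \<ge> 2" and L: "(2::nat) ^ L \<le> 2 * N" and M: "M \<le> L"
  shows "real M + 1 \<le> 3 / ln 2 * ln (real N)"
proof -
  have "ln ((2::real) ^ L) \<le> ln (2 * real N)"
  proof (subst ln_le_cancel_iff)
    have "real (2 ^ L) \<le> real (2 * N)" using L by (simp only: of_nat_le_iff)
    then show "(2::real) ^ L \<le> 2 * real N" by simp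
  qed (use N in auto)
  then have 1: "real L * ln 2 \<le> ln 2 + ln (real N)" using N by (simp add: ln_realpow ln_mult)
  have 2: "ln 2 \<le> ln (real N)" using N by (subst ln_le_cancel_iff) auto
  have "(real M + 1) * ln 2 \<le> (real L + 1) * ln 2" using M by (intro mult_right_mono) auto
  \<comment> \<open>The left side is at most \<open>2 * ln 2 + ln N\<close>, and
    \<open>ln 2 \<le> ln N\<close>.\<close>
  also have "\<dots> \<le> 3 * ln (real N)" using 1 2 by (simp add: distrib_right)
  finally show ?thesis by (simp add: field_simps)
qed

lemma level_power_bound:
  assumes N: "N \<ge> 2" and L: "(2::nat) ^ L \<le> 2 * N" and r: "r \<ge> 0"
  shows "2 powr ((1 - r) * real L) \<le> 2 * real N powr (1 - min r 1)"
proof (cases "r < 1")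
  case True
  have "2 powr ((1 - r) * real L) = ((2::real) ^ L) powr (1 - r)"
    by (simp add: powr_powr mult.commute flip: powr_realpow)
  also have "\<dots> \<le> (2 * real N) powr (1 - r)"
  proof (intro powr_mono2)
    have "real (2 ^ L) \<le> real (2 * N)" using L by (simp only: of_nat_le_iff)
    then show "(2::real) ^ L \<le> 2 * real N" by simp
  qed (use True in auto)
  also have "\<dots> = 2 powr (1 - r) * real N powr (1 - r)" by (simp add: powr_mult)
  also have "\<dots> \<le> 2 powr 1 * real N powr (1 - r)"
    using r by (intro mult_right_mono powr_mono) auto
  finally show ?thesis using True by (simp add: min_def)
next
  case False
  then have "(1 - r) * real L \<le> 0" by (simp add: mult_nonpos_nonneg)
  then have "2 powr ((1 - r) * real L) \<le> 2 powr 0" by (intro powr_mono) auto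
  then show ?thesis using False N by (simp add: min_def)
qed

text \<open>Size of the low sum without logarithms. It is 0 for the empty range
  \<open>M = 0\<close>, so that later estimates may assume that \<open>M = L - T - D\<close> was not
  truncated.\<close>

definition low_factor :: "real \<Rightarrow> nat \<Rightarrow> real" where
  "low_factor r M = (if M = 0 then 0 else if r = 1 then 1 else max (2 powr ((1 - r) * real M)) 1)"

text \<open>The exponent \<open>(r + 1 - \<rho>) * t / 2\<close> dominates \<open>t / 2\<close>
  because \<open>\<rho> < r\<close>, and \<open>r * t / 2\<close> because
  \<open>\<rho> \<le> 1\<close>. The first is used for \<open>r \<ge> 1\<close>, the second for
  \<open>r < 1\<close>.\<close>

lemma low_level_bound:
  fixes r \<rho> :: real
  assumes N: "N \<ge> 2" and L: "(2::nat) ^ L \<le> 2 * N" and \<rho>: "0 \<le> \<rho>" "\<rho> \<le> 1" "\<rho> < r"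
    and T: "T = (t + 1) div 2" and M: "M = L - T - D"
  shows "2 ^ T * low_factor r M \<le>
    2 * 2 powr (r / 2 + 1 / 2) * (2 powr ((r + 1 - \<rho>) * real t / 2) * real N powr (1 - min r 1))"
proof -
  let ?\<theta> = "(r + 1 - \<rho>) * real t / 2"
  have "2 * T \<le> t + 1" unfolding T by linarith
  then have "real (2 * T) \<le> real (t + 1)" by (simp only: of_nat_le_iff)
  then have T2: "real T \<le> (real t + 1) / 2" by simp
  have \<theta>: "real t / 2 \<le> ?\<theta>" "r * real t / 2 \<le> ?\<theta>"
  proof -
    have "1 * real t \<le> (r + 1 - \<rho>) * real t" using \<rho> by (intro mult_right_mono) auto
    then show "real t / 2 \<le> ?\<theta>" by simp
    have "r * real t \<le> (r + 1 - \<rho>) * real t" using \<rho> by (intro mult_right_mono) auto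
    then show "r * real t / 2 \<le> ?\<theta>" by simp
  qed
  have pT: "(2::real) ^ T = 2 powr real T" by (simp add: powr_realpow)
  consider "M = 0" | "M > 0" "r < 1" | "M > 0" "r \<ge> 1" by linarith
  then show ?thesis
  proof cases
    case 1
    then show ?thesis by (simp add: low_factor_def)
  next
    case 2
    have MleT: "real M \<le> real L - real T" using 2 unfolding M by linarith
    have "1 \<le> 2 powr ((1 - r) * real M)" using 2 by (intro ge_one_powr_ge_zero) auto
    then have lf: "low_factor r M = 2 powr ((1 - r) * real M)" using 2 by (simp add: low_factor_def)
    have "real T + (1 - r) * real M \<le> real T + (1 - r) * (real L - real T)"
      using 2 MleT by (intro add_left_mono mult_left_mono) auto
    also have "\<dots> = r * real T + (1 - r) * real L" by (simp add: algebra_simps)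
    also have "r * real T \<le> r * ((real t + 1) / 2)" using T2 \<rho> by (intro mult_left_mono) auto
    also have "r * ((real t + 1) / 2) = r * real t / 2 + r / 2" by (simp add: field_simps)
    finally have "real T + (1 - r) * real M \<le> (?\<theta> + (r / 2 + 1 / 2)) + (1 - r) * real L" using \<theta> by linarith
    then have "2 powr (real T + (1 - r) * real M) \<le> 2 powr ((?\<theta> + (r / 2 + 1 / 2)) + (1 - r) * real L)"
      by (intro powr_mono) auto
    also have "\<dots> = 2 powr ?\<theta> * 2 powr (r / 2 + 1 / 2) * 2 powr ((1 - r) * real L)" by (simp only: powr_add)
    also have "\<dots> \<le> 2 powr ?\<theta> * 2 powr (r / 2 + 1 / 2) * (2 * real N powr (1 - min r 1))"
      using \<rho> by (intro mult_left_mono level_power_bound N L) auto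
    finally have "2 powr (real T + (1 - r) * real M) \<le>
        2 * 2 powr (r / 2 + 1 / 2) * (2 powr ?\<theta> * real N powr (1 - min r 1))"
      by (simp only: mult_ac)
    then show ?thesis unfolding lf pT powr_add .
  next
    case 3
    then have "(1 - r) * real M \<le> 0" by (simp add: mult_nonpos_nonneg)
    then have "2 powr ((1 - r) * real M) \<le> 2 powr 0" by (intro powr_mono) auto
    then have lf: "low_factor r M = 1" using 3 by (simp add: low_factor_def)
    have "2 powr real T \<le> 2 powr (?\<theta> + (r / 2 + 1 / 2))"
      using T2 \<theta> \<rho> by (intro powr_mono) auto
    also have "\<dots> = 2 powr ?\<theta> * 2 powr (r / 2 + 1 / 2)" by (simp only: powr_add)
    also have "\<dots> \<le> 2 * 2 powr (r / 2 + 1 / 2) * (2 powr ?\<theta> * 1)" by simp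
    finally have "2 powr real T \<le> 2 * 2 powr (r / 2 + 1 / 2) * (2 powr ?\<theta> * 1)" .
    moreover have "real N powr (1 - min r 1) = 1" using 3 N by simp
    ultimately show ?thesis unfolding lf pT by simp
  qed
qed

text \<open>Truncation is harmless here: \<open>M\<close> is at least the real number
  \<open>L - T - D\<close> in any case, and its coefficient \<open>- r\<close> is negative.\<close>

lemma high_level_bound:
  fixes r \<rho> :: real
  assumes N: "N \<ge> 2" and L: "(2::nat) ^ L \<le> 2 * N" and \<rho>: "0 \<le> \<rho>" "\<rho> \<le> 1" "\<rho> < r"
    and T: "T = (t + 1) div 2" and M: "M = L - T - D"
  shows "2 ^ L * 2 powr (- r * real M) \<le>
    2 * 2 powr (r / 2 + r * real D) * (2 powr ((r + 1 - \<rho>) * real t / 2) * real N powr (1 - min r 1))"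
proof -
  let ?\<theta> = "(r + 1 - \<rho>) * real t / 2"
  have "2 * T \<le> t + 1" unfolding T by linarith
  then have "real (2 * T) \<le> real (t + 1)" by (simp only: of_nat_le_iff)
  then have T2: "real T \<le> (real t + 1) / 2" by simp
  have "r * real t \<le> (r + 1 - \<rho>) * real t" using \<rho> by (intro mult_right_mono) auto
  then have \<theta>: "r * real t / 2 \<le> ?\<theta>" by simp
  have "real L - real T - real D \<le> real M" unfolding M by linarith
  then have "real L + - r * real M \<le> real L + - r * (real L - real T - real D)"
    using \<rho> by (intro add_left_mono mult_left_mono_neg) auto
  also have "\<dots> = (1 - r) * real L + r * real T + r * real D" by (simp add: algebra_simps)
  also have "r * real T \<le> r * ((real t + 1) / 2)" using T2 \<rho> by (intro mult_left_mono) auto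
  also have "r * ((real t + 1) / 2) = r * real t / 2 + r / 2" by (simp add: field_simps)
  finally have "real L + - r * real M \<le> (?\<theta> + (r / 2 + r * real D)) + (1 - r) * real L" using \<theta> by linarith
  then have "2 powr (real L + - r * real M) \<le> 2 powr ((?\<theta> + (r / 2 + r * real D)) + (1 - r) * real L)"
    by (intro powr_mono) auto
  also have "\<dots> = 2 powr ?\<theta> * 2 powr (r / 2 + r * real D) * 2 powr ((1 - r) * real L)" by (simp only: powr_add)
  also have "\<dots> \<le> 2 powr ?\<theta> * 2 powr (r / 2 + r * real D) * (2 * real N powr (1 - min r 1))"
    using \<rho> by (intro mult_left_mono level_power_bound N L) auto
  finally have "2 powr (real L + - r * real M) \<le>
      2 * 2 powr (r / 2 + r * real D) * (2 powr ?\<theta> * real N powr (1 - min r 1))"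
    by (simp only: mult_ac)
  moreover have "2 powr (real L + - r * real M) = 2 ^ L * 2 powr (- r * real M)"
    unfolding powr_add by (subst powr_realpow) simp_all
  ultimately show ?thesis by simp
qed

text \<open>For \<open>r = 1\<close> all shells weigh the same, and one Hoelder step over at most
  \<open>(M + 1) ^ CARD('d)\<close> indices gives the exponent with \<open>d\<close>. Otherwise
  Hoelder's inequality is applied shell by shell, with \<open>d - 1\<close>.\<close>

lemma low_part_bound:
  fixes w :: "nat ^ 'd::finite \<Rightarrow> real"
  assumes hb: "\<And>S. finite S \<Longrightarrow> S \<noteq> {} \<Longrightarrow> (\<Sum>j\<in>S. w j) \<le> 2 * real (card S) powr \<tau>"
    and \<tau>: "0 \<le> \<tau>" and A: "finite A" "\<And>j. j \<in> A \<Longrightarrow> total j < M"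
    and \<kappa>: "\<kappa> = (if r \<noteq> 1 then (real CARD('d) - 1) * \<tau> else real CARD('d) * \<tau>)"
  shows "(\<Sum>j\<in>A. 2 powr ((1 - r) * real (total j)) * w j) \<le>
    (2 + 2 / \<bar>1 - 2 powr (1 - r)\<bar>) * (real M + 1) powr \<kappa> * low_factor r M"
proof -
  have cardd: "real CARD('d) \<ge> 1" by (simp add: Suc_le_eq)
  have g: "2 / \<bar>1 - 2 powr (1 - r)\<bar> \<ge> 0" by simp
  show ?thesis
  proof (cases "A = {}")
    case True
    then show ?thesis using g by (simp add: low_factor_def)
  next
    case False
    then have M: "M > 0" using A(2) by fastforce
    show ?thesis
    proof (cases "r = 1")
      case True
      have "A \<subseteq> idx_box M"
      proof
        fix j assume "j \<in> A"
        then have "total j < M" by (rule A(2))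
        then have "j $ i \<le> M" for i using component_le_total[of j i] by linarith
        then show "j \<in> idx_box M" by (simp add: idx_box_def)
      qed
      then have "card A \<le> (M + 1) ^ CARD('d)"
        unfolding card_idx_box[symmetric] by (rule card_mono[OF finite_idx_box])
      then have "real (card A) \<le> real ((M + 1) ^ CARD('d))" by (simp only: of_nat_le_iff)
      also have "\<dots> = (real M + 1) powr real CARD('d)" by (subst powr_realpow) (auto simp: add.commute)
      finally have "real (card A) powr \<tau> \<le> ((real M + 1) powr real CARD('d)) powr \<tau>"
        using \<tau> by (intro powr_mono2) auto
      also have "\<dots> = (real M + 1) powr \<kappa>" using True by (simp add: powr_powr \<kappa>)
      finally have "(\<Sum>j\<in>A. w j) \<le> 2 * (real M + 1) powr \<kappa>" using hb[OF A(1) False] by linarith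
      then show ?thesis using True M by (simp add: low_factor_def)
    next
      case False
      have \<kappa>0: "\<kappa> \<ge> 0" using False \<tau> cardd by (simp add: \<kappa>)
      have "(\<Sum>j\<in>A. 2 powr ((1 - r) * real (total j)) * w j) \<le>
          (\<Sum>s\<in>{..<M}. 2 powr ((1 - r) * real s) * (2 * (real s + 1) powr ((real CARD('d) - 1) * \<tau>)))"
        using A by (intro shell_sum_le hb \<tau>) auto
      also have "\<dots> = (\<Sum>s\<in>{..<M}. 2 powr ((1 - r) * real s) * (2 * (real s + 1) powr \<kappa>))"
        using False by (simp add: \<kappa>)
      also have "\<dots> \<le> 2 / \<bar>1 - 2 powr (1 - r)\<bar> * (real M + 1) powr \<kappa> * max (2 powr ((1 - r) * real M)) 1"
        by (rule low_sum_bound[OF \<kappa>0 False])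
      also have "\<dots> = 2 / \<bar>1 - 2 powr (1 - r)\<bar> * (real M + 1) powr \<kappa> * low_factor r M"
        using False M by (simp add: low_factor_def)
      also have "\<dots> \<le> (2 + 2 / \<bar>1 - 2 powr (1 - r)\<bar>) * (real M + 1) powr \<kappa> * low_factor r M"
        by (intro mult_right_mono) (auto simp: low_factor_def)
      finally show ?thesis .
    qed
  qed
qed

lemma high_part_bound:
  fixes w :: "nat ^ 'd::finite \<Rightarrow> real"
  assumes hb: "\<And>S. finite S \<Longrightarrow> S \<noteq> {} \<Longrightarrow> (\<Sum>j\<in>S. w j) \<le> 2 * real (card S) powr \<tau>"
    and \<tau>: "0 \<le> \<tau>" and A: "finite A" "\<And>j. j \<in> A \<Longrightarrow> M \<le> total j"
    and G: "\<And>M S. (\<Sum>s\<in>{M..S}. 2 powr (- (r - \<rho>) * real s) * (real s + 1) powr ((real CARD('d) - 1) * \<tau>))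
      \<le> G * 2 powr (- (r - \<rho>) * real M) * (real M + 1) powr ((real CARD('d) - 1) * \<tau>)"
  shows "(\<Sum>j\<in>A. 2 powr (- (r - \<rho>) * real (total j)) * w j) \<le>
    2 * G * 2 powr (- (r - \<rho>) * real M) * (real M + 1) powr ((real CARD('d) - 1) * \<tau>)"
proof -
  let ?\<kappa> = "(real CARD('d) - 1) * \<tau>"
  define S where "S = Max (insert 0 (total ` A))"
  have "(\<Sum>j\<in>A. 2 powr (- (r - \<rho>) * real (total j)) * w j) \<le>
      (\<Sum>s\<in>{M..S}. 2 powr (- (r - \<rho>) * real s) * (2 * (real s + 1) powr ?\<kappa>))"
    using A by (intro shell_sum_le hb \<tau>) (auto simp: S_def)
  also have "\<dots> = 2 * (\<Sum>s\<in>{M..S}. 2 powr (- (r - \<rho>) * real s) * (real s + 1) powr ?\<kappa>)"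
    unfolding sum_distrib_left by (intro sum.cong refl) simp
  also have "\<dots> \<le> 2 * (G * 2 powr (- (r - \<rho>) * real M) * (real M + 1) powr ?\<kappa>)"
    by (intro mult_left_mono G) simp
  finally show ?thesis by (simp only: mult.assoc)
qed

section \<open>Assembly of the estimates\<close>

lemma main_bound:
  fixes \<phi> :: "real \<Rightarrow> complex" and p q :: ennreal and r :: real
  assumes \<phi>: "admissible_cutoff \<phi>" and p: "1 \<le> p" and q: "1 \<le> q" and r: "recip p < r"
  shows "\<exists>C>0. \<forall>t (E :: 'd::finite \<Rightarrow> nat \<Rightarrow> nat \<Rightarrow> bit) N f.
    order_digital_seq 2 t E \<longrightarrow> (\<forall>i. \<forall>l\<ge>1. \<forall>k>2 * l. E i k l = 0) \<longrightarrow> 2 \<le> N \<longrightarrow>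
    f \<in> besov_space_cont \<phi> r p q \<longrightarrow> besov_norm \<phi> r p q f \<le> 1 \<longrightarrow>
    \<bar>(LINT y|torus. f y) - (1 / real N) * (\<Sum>k<N. f (digital_seq E k))\<bar> \<le>
      C * 2 powr ((r + 1 - recip p) * real t / 2) *
      (ln (real N) powr (if r \<noteq> 1 then (real CARD('d) - 1) * (1 - recip q) else real CARD('d) * (1 - recip q))
        * real N powr (- min r 1))"
proof -
  define \<rho> where "\<rho> = recip p"
  define \<tau> where "\<tau> = 1 - recip q"
  define \<kappa>0 where "\<kappa>0 = (real CARD('d) - 1) * \<tau>"
  define \<kappa> where "\<kappa> = (if r \<noteq> 1 then (real CARD('d) - 1) * \<tau> else real CARD('d) * \<tau>)"
  define D where "D = 3 * CARD('d)"
  have \<rho>: "0 \<le> \<rho>" "\<rho> \<le> 1" "\<rho> < r" using recip_bounds[OF p] r by (auto simp: \<rho>_def)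
  have \<tau>: "0 \<le> \<tau>" using recip_bounds[OF q] by (simp add: \<tau>_def)
  have cardd: "real CARD('d) \<ge> 1" by (simp add: Suc_le_eq)
  have "(real CARD('d) - 1) * \<tau> \<le> real CARD('d) * \<tau>" using \<tau> by (intro mult_right_mono) auto
  then have \<kappa>0: "0 \<le> \<kappa>0" "\<kappa>0 \<le> \<kappa>" using \<tau> cardd by (simp_all add: \<kappa>0_def \<kappa>_def)
  have \<kappa>: "0 \<le> \<kappa>" using \<kappa>0 by linarith
  obtain G where G: "G > 0" "\<And>M S. (\<Sum>s\<in>{M..S}. 2 powr (- (r - \<rho>) * real s) * (real s + 1) powr \<kappa>0)
      \<le> G * 2 powr (- (r - \<rho>) * real M) * (real M + 1) powr \<kappa>0"
    using tail_sum_bound[OF \<kappa>0(1), of "r - \<rho>"] \<rho> by auto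
  define cl where "cl = (2 + 2 / \<bar>1 - 2 powr (1 - r)\<bar>) * (2 * 2 powr (r / 2 + 1 / 2))"
  define ch where "ch = 2 * G * (2 * 2 powr (r / 2 + r * real D))"
  define C where "C = err_const CARD('d) * 2 ^ D * (cl + ch) * (3 / ln 2) powr \<kappa> + 1"
  have cl0: "cl \<ge> 0" and ch0: "ch \<ge> 0" using G by (auto simp: cl_def ch_def)
  have C: "C > 0"
  proof -
    have "0 \<le> err_const CARD('d) * 2 ^ D * (cl + ch) * (3 / ln 2) powr \<kappa>"
      using cl0 ch0 err_const_nonneg by (intro mult_nonneg_nonneg) auto
    then show ?thesis by (simp add: C_def)
  qed
  have "\<bar>(LINT y|torus. f y) - (1 / real N) * (\<Sum>k<N. f (digital_seq E k))\<bar> \<le>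
      C * 2 powr ((r + 1 - \<rho>) * real t / 2) * (ln (real N) powr \<kappa> * real N powr (- min r 1))"
    if seq: "order_digital_seq 2 t E" and E': "\<forall>i. \<forall>l\<ge>1. \<forall>k>2 * l. E i k l = 0" and N: "2 \<le> N"
      and f: "f \<in> besov_space_cont \<phi> r p q" and nf: "besov_norm \<phi> r p q f \<le> 1"
    for t and E :: "'d \<Rightarrow> nat \<Rightarrow> nat \<Rightarrow> bit" and N f
  proof -
    have E: "\<And>i l k. \<lbrakk>1 \<le> l; 2 * l < k\<rbrakk> \<Longrightarrow> E i k l = 0" using E' by blast
    have fc: "continuous_on UNIV f" "periodic f"
      using f by (auto simp: besov_space_cont_def besov_space_def)
    obtain \<Lambda> where \<Lambda>: "\<And>j. \<Lambda> j \<ge> 0" "\<And>j. Lp_norm p torus (dyadic_block \<phi> j f) = ennreal (\<Lambda> j)"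
      and hb': "\<And>S. finite S \<Longrightarrow> S \<noteq> {} \<Longrightarrow>
        (\<Sum>j\<in>S. 2 powr (r * real (total j)) * \<Lambda> j) \<le> 2 * real (card S) powr (1 - recip q)"
      by (rule besov_unit_ball[OF q nf]) blast
    define w where "w = (\<lambda>j. 2 powr (r * real (total j)) * \<Lambda> j)"
    have hb: "(\<Sum>j\<in>S. w j) \<le> 2 * real (card S) powr \<tau>" if "finite S" "S \<noteq> {}" for S
      using hb'[OF that] by (simp add: w_def \<tau>_def)
    have w0: "w j \<ge> 0" for j using \<Lambda> by (simp add: w_def)
    have \<Lambda>w: "\<Lambda> j = 2 powr (- r * real (total j)) * w j" for j
      unfolding w_def by (simp add: powr_minus)
    \<comment> \<open>One more than the binary logarithm of \<open>N\<close> rounded down.\<close>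
    obtain L where L: "N \<le> 2 ^ L" "(2::nat) ^ L \<le> 2 * N"
    proof -
      obtain n where "(2::nat) ^ n \<le> N" "N < 2 ^ (n + 1)" using ex_power_ivl1[of 2 N] N by auto
      then show ?thesis by (intro that[of "n + 1"]) auto
    qed
    define T where "T = (t + 1) div 2"
    define M where "M = L - T - D"
    \<comment> \<open>\<open>N\<close> times the target rate, without the logarithm.\<close>
    define P where "P = 2 powr ((r + 1 - \<rho>) * real t / 2) * real N powr (1 - min r 1)"
    have P0: "P \<ge> 0" by (simp add: P_def)
    let ?err = "\<lambda>j. norm (\<Sum>k<N. dyadic_block \<phi> j f (digital_seq E k) - block_coeff \<phi> f j 0)"
    let ?c = "err_const CARD('d) * 2 ^ D"
    have c0: "?c \<ge> 0" using err_const_nonneg by simp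
    have Mle: "M \<le> L" by (simp add: M_def)
    \<comment> \<open>By \<open>dyadic_block_sup\<close> a block is at most a constant times
      \<open>2 powr (- (r - \<rho>) * total j) * w j\<close>; \<open>r > 1 / p\<close> makes this
      summable.\<close>
    have lim: "(\<lambda>n. partial_sum \<phi> f n x) \<longlonglongrightarrow> complex_of_real (f x)" for x
    proof (rule partial_sum_converges[OF \<phi> fc])
      let ?K = "2 * 5 ^ CARD('d) * 2 ^ (3 * CARD('d)) :: real"
      let ?M = "\<lambda>j. ?K * (2 powr (- (r - \<rho>) * real (total j)) * w j)"
      show "norm (dyadic_block \<phi> j f x) \<le> ?M j" for j x
      proof -
        have "norm (dyadic_block \<phi> j f x) \<le> ?K * 2 powr (\<rho> * real (total j)) * \<Lambda> j"
          unfolding \<rho>_def by (rule dyadic_block_sup[OF \<phi> p \<Lambda>(2,1)])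
        also have "\<dots> = ?K * ((2 powr (\<rho> * real (total j)) * 2 powr (- r * real (total j))) * w j)"
          unfolding \<Lambda>w[of j] by (simp only: mult_ac)
        also have "2 powr (\<rho> * real (total j)) * 2 powr (- r * real (total j)) = 2 powr (- (r - \<rho>) * real (total j))"
          unfolding powr_add[symmetric] by (rule arg_cong[where f = "(powr) 2"]) (simp add: algebra_simps)
        finally show ?thesis .
      qed
      fix \<epsilon> :: real assume \<epsilon>: "\<epsilon> > 0"
      \<comment> \<open>Half of the decay is given up to absorb the polynomial factor of the tail
        bound.\<close>
      let ?h = "(r - \<rho>) / 2"
      obtain H where H: "H > 0" "\<And>u::nat. (real u + 1) powr \<kappa>0 \<le> H * 2 powr (?h * real u)"
        using poly_le_exponential[OF \<kappa>0(1), of ?h] \<rho> by auto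
      have tail: "(\<Sum>j\<in>idx_box n - idx_box m. ?M j) \<le> ?K * (2 * G * H) * (2 powr (- ?h)) ^ m" for n m
      proof -
        have "(\<Sum>j\<in>idx_box n - idx_box m. 2 powr (- (r - \<rho>) * real (total j)) * w j) \<le>
            2 * G * 2 powr (- (r - \<rho>) * real m) * (real m + 1) powr \<kappa>0"
          unfolding \<kappa>0_def
        proof (rule high_part_bound[OF hb \<tau> _ _ G(2)[unfolded \<kappa>0_def]])
          fix j assume "j \<in> idx_box n - idx_box m"
          then obtain i where "m < j $ i" by (auto simp: idx_box_def not_le)
          then show "m \<le> total j" using component_le_total[of j i] by linarith
        qed auto
        also have "\<dots> \<le> 2 * G * 2 powr (- (r - \<rho>) * real m) * (H * 2 powr (?h * real m))"
          using G H by (intro mult_left_mono) auto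
        also have "\<dots> = 2 * G * H * (2 powr (- (r - \<rho>) * real m) * 2 powr (?h * real m))"
          by (simp only: mult_ac)
        also have "2 powr (- (r - \<rho>) * real m) * 2 powr (?h * real m) = (2 powr (- ?h)) ^ m"
          unfolding powr_nat_mult[symmetric] powr_add[symmetric]
          by (rule arg_cong[where f = "(powr) 2"]) (simp add: field_simps)
        finally have "?K * (\<Sum>j\<in>idx_box n - idx_box m. 2 powr (- (r - \<rho>) * real (total j)) * w j) \<le>
            ?K * (2 * G * H * (2 powr (- ?h)) ^ m)" by (rule mult_left_mono) simp
        then show ?thesis unfolding sum_distrib_left by (simp only: mult.assoc)
      qed
      have "(\<lambda>m. ?K * (2 * G * H) * (2 powr (- ?h)) ^ m) \<longlonglongrightarrow> ?K * (2 * G * H) * 0"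
        using \<rho> powr_less_mono[of "- ?h" 0 "2::real"]
        by (intro tendsto_mult tendsto_const LIMSEQ_power_zero) auto
      then have "\<forall>\<^sub>F m in sequentially. ?K * (2 * G * H) * (2 powr (- ?h)) ^ m < \<epsilon>"
        using \<epsilon> by (intro order_tendstoD(2)) auto
      then obtain m where "?K * (2 * G * H) * (2 powr (- ?h)) ^ m < \<epsilon>"
        unfolding eventually_sequentially by blast
      then show "\<exists>m. \<forall>n\<ge>m. (\<Sum>j\<in>idx_box n - idx_box m. ?M j) \<le> \<epsilon>"
        using tail by (intro exI[of _ m]) (meson less_imp_le order_trans)
    qed
    have bd: "(\<Sum>j\<in>idx_box n. ?err j) \<le> ?c * (cl + ch) * ((real M + 1) powr \<kappa> * P)" for n
    proof -
      let ?A = "{j \<in> (idx_box n :: (nat ^ 'd) set). total j < M}"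
        and ?B = "{j \<in> (idx_box n :: (nat ^ 'd) set). \<not> total j < M}"
      have "(\<Sum>j\<in>idx_box n. ?err j) = (\<Sum>j\<in>?A. ?err j) + (\<Sum>j\<in>?B. ?err j)"
        by (subst sum.union_disjoint[symmetric]) (auto intro: sum.cong)
      also have "(\<Sum>j\<in>?A. ?err j) \<le> (\<Sum>j\<in>?A. ?c * 2 ^ T * (2 powr ((1 - r) * real (total j)) * w j))"
      proof (intro sum_mono)
        fix j assume j: "j \<in> ?A"
        have "?err j \<le> ?c * (2 ^ T * 2 powr real (total j)) * \<Lambda> j"
          using dyadic_block_error[OF \<phi> p \<Lambda>(2,1) seq E L(1), of j] j by (simp add: M_def T_def D_def)
        also have "\<dots> = ?c * 2 ^ T * ((2 powr real (total j) * 2 powr (- r * real (total j))) * w j)"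
          unfolding \<Lambda>w[of j] by (simp only: mult_ac)
        also have "2 powr real (total j) * 2 powr (- r * real (total j)) = 2 powr ((1 - r) * real (total j))"
          unfolding powr_add[symmetric] by (rule arg_cong[where f = "(powr) 2"]) (simp add: algebra_simps)
        finally show "?err j \<le> ?c * 2 ^ T * (2 powr ((1 - r) * real (total j)) * w j)" .
      qed
      also have "\<dots> = ?c * 2 ^ T * (\<Sum>j\<in>?A. 2 powr ((1 - r) * real (total j)) * w j)"
        by (rule sum_distrib_left[symmetric])
      also have "\<dots> \<le> ?c * 2 ^ T * ((2 + 2 / \<bar>1 - 2 powr (1 - r)\<bar>) * (real M + 1) powr \<kappa> * low_factor r M)"
        using c0 by (intro mult_left_mono low_part_bound[OF hb \<tau> _ _ \<kappa>_def]) auto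
      also have "\<dots> = ?c * ((2 + 2 / \<bar>1 - 2 powr (1 - r)\<bar>) * (real M + 1) powr \<kappa> * (2 ^ T * low_factor r M))"
        by (simp only: mult_ac)
      also have "\<dots> \<le> ?c * ((2 + 2 / \<bar>1 - 2 powr (1 - r)\<bar>) * (real M + 1) powr \<kappa> *
          (2 * 2 powr (r / 2 + 1 / 2) * P))"
        unfolding P_def using c0
        by (intro mult_left_mono low_level_bound[OF N L(2) \<rho> T_def M_def]) auto
      also have "\<dots> = ?c * cl * ((real M + 1) powr \<kappa> * P)"
        unfolding cl_def by (simp only: mult_ac)
      also have "(\<Sum>j\<in>?B. ?err j) \<le> (\<Sum>j\<in>?B. ?c * 2 ^ L * 2 powr (- \<rho> * real M) * (2 powr (- (r - \<rho>) * real (total j)) * w j))"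
      proof (intro sum_mono)
        fix j assume j: "j \<in> ?B"
        have "?err j \<le> ?c * (2 ^ L * 2 powr (\<rho> * (real (total j) - real M))) * \<Lambda> j"
          using dyadic_block_error[OF \<phi> p \<Lambda>(2,1) seq E L(1), of j] j by (simp add: M_def T_def D_def \<rho>_def)
        also have "\<dots> = ?c * 2 ^ L * ((2 powr (\<rho> * (real (total j) - real M)) * 2 powr (- r * real (total j))) * w j)"
          unfolding \<Lambda>w[of j] by (simp only: mult_ac)
        also have "2 powr (\<rho> * (real (total j) - real M)) * 2 powr (- r * real (total j)) =
            2 powr (- \<rho> * real M) * 2 powr (- (r - \<rho>) * real (total j))"
          unfolding powr_add[symmetric] by (rule arg_cong[where f = "(powr) 2"]) (simp add: algebra_simps)
        finally show "?err j \<le> ?c * 2 ^ L * 2 powr (- \<rho> * real M) * (2 powr (- (r - \<rho>) * real (total j)) * w j)"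
          by (simp only: mult_ac)
      qed
      also have "\<dots> = ?c * 2 ^ L * 2 powr (- \<rho> * real M) * (\<Sum>j\<in>?B. 2 powr (- (r - \<rho>) * real (total j)) * w j)"
        by (rule sum_distrib_left[symmetric])
      also have "\<dots> \<le> ?c * 2 ^ L * 2 powr (- \<rho> * real M) * (2 * G * 2 powr (- (r - \<rho>) * real M) * (real M + 1) powr \<kappa>0)"
      proof (rule mult_left_mono)
        show "(\<Sum>j\<in>?B. 2 powr (- (r - \<rho>) * real (total j)) * w j) \<le>
            2 * G * 2 powr (- (r - \<rho>) * real M) * (real M + 1) powr \<kappa>0"
          unfolding \<kappa>0_def
          by (rule high_part_bound[OF hb \<tau> _ _ G(2)[unfolded \<kappa>0_def]]) auto
      qed (use c0 in simp)
      also have "\<dots> = ?c * (2 * G) * (2 ^ L * (2 powr (- \<rho> * real M) * 2 powr (- (r - \<rho>) * real M))) * (real M + 1) powr \<kappa>0"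
        by (simp only: mult_ac)
      \<comment> \<open>Here \<open>\<rho>\<close> cancels: missing resolution only slows the decay
        beyond \<open>M\<close>, and the whole tail is governed by its value at
        \<open>M\<close>.\<close>
      also have "2 powr (- \<rho> * real M) * 2 powr (- (r - \<rho>) * real M) = 2 powr (- r * real M)"
        unfolding powr_add[symmetric] by (rule arg_cong[where f = "(powr) 2"]) (simp add: algebra_simps)
      also have "?c * (2 * G) * (2 ^ L * 2 powr (- r * real M)) * (real M + 1) powr \<kappa>0 \<le>
          ?c * (2 * G) * (2 * 2 powr (r / 2 + r * real D) * P) * (real M + 1) powr \<kappa>"
      proof (rule mult_mono[OF mult_left_mono])
        show "2 ^ L * 2 powr (- r * real M) \<le> 2 * 2 powr (r / 2 + r * real D) * P"
          unfolding P_def by (rule high_level_bound[OF N L(2) \<rho> T_def M_def])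
        show "(real M + 1) powr \<kappa>0 \<le> (real M + 1) powr \<kappa>" using \<kappa>0 by (intro powr_mono) auto
      qed (use c0 G P0 err_const_nonneg in auto)
      also have "\<dots> = ?c * ch * ((real M + 1) powr \<kappa> * P)"
        unfolding ch_def by (simp only: mult_ac)
      finally show ?thesis by (simp add: algebra_simps)
    qed
    have "\<bar>(LINT y|torus. f y) - (1 / real N) * (\<Sum>k<N. f (digital_seq E k))\<bar> \<le>
        ?c * (cl + ch) * ((real M + 1) powr \<kappa> * P) / real N"
      by (rule integration_error_le[OF \<phi> lim _ bd]) (use N in auto)
    also have "\<dots> \<le> ?c * (cl + ch) * ((3 / ln 2 * ln (real N)) powr \<kappa> * P) / real N"
      using c0 cl0 ch0 P0 \<kappa> log_level_bound[OF N L(2) Mle]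
      by (intro divide_right_mono mult_left_mono mult_right_mono powr_mono2) auto
    also have "(3 / ln 2 * ln (real N)) powr \<kappa> = (3 / ln 2) powr \<kappa> * ln (real N) powr \<kappa>"
      by (rule powr_mult)
    also have "?c * (cl + ch) * ((3 / ln 2) powr \<kappa> * ln (real N) powr \<kappa> * P) / real N =
       (C - 1) * (2 powr ((r + 1 - \<rho>) * real t / 2) * (ln (real N) powr \<kappa> * (real N powr (1 - min r 1) / real N)))"
      unfolding C_def P_def by simp
    also have "real N powr (1 - min r 1) / real N = real N powr (- min r 1)"
      using N by (simp add: powr_diff powr_minus divide_inverse)
    also have "(C - 1) * (2 powr ((r + 1 - \<rho>) * real t / 2) * (ln (real N) powr \<kappa> * real N powr (- min r 1))) \<le>
       C * (2 powr ((r + 1 - \<rho>) * real t / 2) * (ln (real N) powr \<kappa> * real N powr (- min r 1)))"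
      by (intro mult_right_mono) auto
    finally show ?thesis by (simp only: mult.assoc)
  qed
  then show ?thesis
    using C unfolding \<rho>_def \<kappa>_def \<tau>_def by (intro exI[of _ C] conjI allI impI) auto
qed

theorem theorem12:
  fixes \<phi> :: "real \<Rightarrow> complex" and p q :: ennreal and r :: real
  assumes "admissible_cutoff \<phi>"
    and "1 \<le> p" and "1 \<le> q"
    and "recip p < r" and "r < 2"
  shows "\<exists>C::real. C > 0 \<and>
    (\<forall>(t::nat) (E :: 'd::finite \<Rightarrow> nat \<Rightarrow> nat \<Rightarrow> bit).
       order_digital_seq 2 t E \<and> (\<forall>i. \<forall>l\<ge>1. \<forall>k>2 * l. E i k l = 0) \<longrightarrow>
       (\<forall>N::nat. N \<ge> 2 \<longrightarrow>
          wce N (digital_seq E) (besov_space_cont \<phi> r p q) (besov_norm \<phi> r p q)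
          \<le> ennreal (C * 2 powr ((r + 1 - recip p) * real t / 2) *
              (if r \<noteq> 1
               then ln (real N) powr ((real CARD('d) - 1) * (1 - recip q)) * real N powr (- min r 1)
               else ln (real N) powr (real CARD('d) * (1 - recip q)) * real N powr (- 1)))))"
proof -
  obtain C where C: "C > 0" and bound: "\<And>t (E :: 'd \<Rightarrow> nat \<Rightarrow> nat \<Rightarrow> bit) N f.
    \<lbrakk>order_digital_seq 2 t E; \<forall>i. \<forall>l\<ge>1. \<forall>k>2 * l. E i k l = 0; 2 \<le> N;
      f \<in> besov_space_cont \<phi> r p q; besov_norm \<phi> r p q f \<le> 1\<rbrakk> \<Longrightarrow>
    \<bar>(LINT y|torus. f y) - (1 / real N) * (\<Sum>k<N. f (digital_seq E k))\<bar> \<le>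
      C * 2 powr ((r + 1 - recip p) * real t / 2) *
      (ln (real N) powr (if r \<noteq> 1 then (real CARD('d) - 1) * (1 - recip q) else real CARD('d) * (1 - recip q))
        * real N powr (- min r 1))"
    using main_bound[OF assms(1-4), where 'd = 'd] by blast
  show ?thesis
  proof (intro exI[of _ C] conjI allI impI C)
    fix t and E :: "'d \<Rightarrow> nat \<Rightarrow> nat \<Rightarrow> bit" and N :: nat
    assume E: "order_digital_seq 2 t E \<and> (\<forall>i. \<forall>l\<ge>1. \<forall>k>2 * l. E i k l = 0)" and N: "2 \<le> N"
    have "wce N (digital_seq E) (besov_space_cont \<phi> r p q) (besov_norm \<phi> r p q) \<le>
      ennreal (C * 2 powr ((r + 1 - recip p) * real t / 2) *
      (ln (real N) powr (if r \<noteq> 1 then (real CARD('d) - 1) * (1 - recip q) else real CARD('d) * (1 - recip q))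
        * real N powr (- min r 1)))"
      unfolding wce_def
      by (intro SUP_least ennreal_leI) (use bound E N in auto)
    then show "wce N (digital_seq E) (besov_space_cont \<phi> r p q) (besov_norm \<phi> r p q)
          \<le> ennreal (C * 2 powr ((r + 1 - recip p) * real t / 2) *
              (if r \<noteq> 1
               then ln (real N) powr ((real CARD('d) - 1) * (1 - recip q)) * real N powr (- min r 1)
               else ln (real N) powr (real CARD('d) * (1 - recip q)) * real N powr (- 1)))"
      by (cases "r = 1") auto
  qed
qed

end
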